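(* Let $\mathbb{A}$ be a finite relational structure, let $\mathbb{B}$ be its idempotent core (the core of $\mathbb{A}$ expanded by all singleton unary relations), and let $\mathscr{A}$, $\mathscr{B}$ be the polymorphism clones of $\mathbb{A}$, $\mathbb{B}$. Let $\mathbf{1}$ denote the clone of projections on a two-element set. Then the following are equivalent. \begin{itemize} \item[(i)] There is no clone homomorphism from $\mathscr{B}$ to $\mathbf{1}$. \item[(ii)] There is no h1 clone homomorphism from $\mathscr{B}$ to $\mathbf{1}$. \item[(ii')] There is no h1 clone homomorphism from $\mathscr{A}$ to $\mathbf{1}$. \item[(iii)] $\mathscr{B}$ contains a cyclic operation, that is, an operation $t$ of some arity $n\ge 2$ such that $t(x_1,\dots,x_n)\approx t(x_2,\dots,x_n,x_1)$. \item[(iii')] $\mathscr{A}$ contains a cyclic operation. \item[(iv)] $\mathscr{B}$ contains a Siggers operation, that is, a $4$-ary operation $t$ such that $t(a,r,e,a)\approx t(r,a,r,e)$. \item[(iv')] $\mathscr{A}$ contains a Siggers operation. \end{itemize}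
   Context: Relational structures have nonempty domains. The polymorphism clone of a structure is the set of all finitary operations (of arity $\ge1$) on its domain preserving all its relations. A function clone is a set of finitary operations (arity $\ge 1$) on a set containing all projections and closed under composition; $\pi^m_i$ denotes the $m$-ary projection onto the $i$-th coordinate. The symbol $\approx$ means equality for all values of the variables. A finite structure is a core if each of its endomorphisms is an automorphism; the core of a finite structure $\mathbb{A}$ is the (unique up to isomorphism) core homomorphically equivalent to $\mathbb{A}$ (i.e. having the same signature and admitting homomorphisms to and from $\mathbb{A}$). Let $\xi\colon\mathscr{C}\to\mathscr{D}$ be an arity-preserving map between function clones. It is a clone homomorphism if $\xi(\pi^n_k)=\pi^n_k$ for all $1\le k\le n$ and $\xi(f(g_1,\dots,g_n))=\xi(f)(\xi(g_1),\dots,\xi(g_n))$ for all $n$-ary $f$ and $m$-ary $g_1,\dots,g_n$ in $\mathscr{C}$. It is an h1 clone homomorphism if $\xi(f(\pi^m_{i_1},\dots,\pi^m_{i_n}))=\xi(f)(\pi^m_{i_1},\dots,\pi^m_{i_n})$ for all $n,m\ge1$, all $i_1,\dots,i_n\in\{1,\dots,m\}$ and all $n$-ary $f\in\mathscr{C}$. *)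

theory Defs
  imports Main "HOL-Library.FuncSet"
begin

section \<open>Relational structures\<close>

text \<open>The signature is a set of symbols (possibly empty or infinite) rather than a whole type;
  the fields \<open>arity\<close> and \<open>rel\<close> are irrelevant outside \<open>symbols\<close>.\<close>

record ('s, 'a) rstruct =
  domain :: "'a set"
  symbols :: "'s set"
  arity :: "'s \<Rightarrow> nat"
  rel :: "'s \<Rightarrow> 'a list set"

definition tuples :: "'a set \<Rightarrow> nat \<Rightarrow> 'a list set" where
  "tuples D n = {xs. length xs = n \<and> set xs \<subseteq> D}"

definition rel_structure :: "('s, 'a) rstruct \<Rightarrow> bool" where
  "rel_structure A \<longleftrightarrow> domain A \<noteq> {} \<and> (\<forall>s\<in>symbols A. rel A s \<subseteq> tuples (domain A) (arity A s))"

definition finite_structure :: "('s, 'a) rstruct \<Rightarrow> bool" where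
  "finite_structure A \<longleftrightarrow> rel_structure A \<and> finite (domain A)"

definition same_signature :: "('s, 'a) rstruct \<Rightarrow> ('s, 'b) rstruct \<Rightarrow> bool" where
  "same_signature A B \<longleftrightarrow> symbols A = symbols B \<and> (\<forall>s\<in>symbols A. arity A s = arity B s)"

definition homomorphism :: "('s, 'a) rstruct \<Rightarrow> ('s, 'b) rstruct \<Rightarrow> ('a \<Rightarrow> 'b) \<Rightarrow> bool" where
  "homomorphism A B h \<longleftrightarrow> h \<in> domain A \<rightarrow> domain B \<and>
     (\<forall>s\<in>symbols A. \<forall>xs\<in>rel A s. map h xs \<in> rel B s)"

definition hom_equivalent :: "('s, 'a) rstruct \<Rightarrow> ('s, 'b) rstruct \<Rightarrow> bool" where
  "hom_equivalent A B \<longleftrightarrow> same_signature A B \<and>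
     (\<exists>h. homomorphism A B h) \<and> (\<exists>h. homomorphism B A h)"

definition automorphism :: "('s, 'a) rstruct \<Rightarrow> ('a \<Rightarrow> 'a) \<Rightarrow> bool" where
  "automorphism A h \<longleftrightarrow> bij_betw h (domain A) (domain A) \<and>
     homomorphism A A h \<and> homomorphism A A (inv_into (domain A) h)"

definition is_core :: "('s, 'a) rstruct \<Rightarrow> bool" where
  "is_core A \<longleftrightarrow> finite_structure A \<and> (\<forall>h. homomorphism A A h \<longrightarrow> automorphism A h)"

text \<open>Cores are unique only up to isomorphism, so being the core of \<open>A\<close> is a relation; the
  core may live on a different type.\<close>

definition core_of :: "('s, 'b) rstruct \<Rightarrow> ('s, 'a) rstruct \<Rightarrow> bool" where
  "core_of C A \<longleftrightarrow> is_core C \<and> hom_equivalent C A"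

definition expand_by_singletons :: "('s, 'a) rstruct \<Rightarrow> ('s + 'a, 'a) rstruct" where
  "expand_by_singletons A =
     \<lparr>domain = domain A,
      symbols = Inl ` symbols A \<union> Inr ` domain A,
      arity = case_sum (arity A) (\<lambda>_. 1),
      rel = case_sum (rel A) (\<lambda>a. {[a]})\<rparr>"

definition idempotent_core_of :: "('s + 'b, 'b) rstruct \<Rightarrow> ('s, 'a) rstruct \<Rightarrow> bool" where
  "idempotent_core_of B A \<longleftrightarrow> (\<exists>C. core_of C A \<and> B = expand_by_singletons C)"

section \<open>Function clones\<close>

text \<open>An \<open>n\<close>-ary operation on \<open>D\<close> is a function on lists that is \<open>undefined\<close> outside
  \<open>tuples D n\<close>, so that equality of HOL functions is equality of operations.
  Sets of operations are graded by arity because such a function need not determine its arity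
  (for instance if \<open>D = {undefined}\<close>).\<close>

definition operations :: "'a set \<Rightarrow> nat \<Rightarrow> ('a list \<Rightarrow> 'a) set" where
  "operations D n = tuples D n \<rightarrow>\<^sub>E D"

text \<open>Coordinates are numbered from 0.\<close>

definition proj :: "'a set \<Rightarrow> nat \<Rightarrow> nat \<Rightarrow> 'a list \<Rightarrow> 'a" where
  "proj D n i = (\<lambda>xs\<in>tuples D n. xs ! i)"

text \<open>\<open>compose_op D m f [g\<^sub>1, \<dots>, g\<^sub>n]\<close> is the \<open>m\<close>-ary operation \<open>f(g\<^sub>1, \<dots>, g\<^sub>n)\<close>.\<close>

definition compose_op ::
  "'a set \<Rightarrow> nat \<Rightarrow> ('a list \<Rightarrow> 'a) \<Rightarrow> ('a list \<Rightarrow> 'a) list \<Rightarrow> 'a list \<Rightarrow> 'a" where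
  "compose_op D m f gs = (\<lambda>xs\<in>tuples D m. f (map (\<lambda>g. g xs) gs))"

record 'a op_set =
  base :: "'a set"
  ops :: "nat \<Rightarrow> ('a list \<Rightarrow> 'a) set"

definition function_clone :: "'a op_set \<Rightarrow> bool" where
  "function_clone C \<longleftrightarrow>
     ops C 0 = {} \<and>
     (\<forall>n. ops C n \<subseteq> operations (base C) n) \<and>
     (\<forall>n i. i < n \<longrightarrow> proj (base C) n i \<in> ops C n) \<and>
     (\<forall>n\<ge>1. \<forall>m\<ge>1. \<forall>f\<in>ops C n. \<forall>gs\<in>tuples (ops C m) n. compose_op (base C) m f gs \<in> ops C m)"

text \<open>In \<open>preserves\<close>, the list \<open>rs\<close> consists of \<open>n\<close> tuples of \<open>R\<close>, and the \<open>n\<close>-ary \<open>f\<close> is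
  applied to them coordinatewise; \<open>k\<close> is the arity of \<open>R\<close>.\<close>

definition preserves :: "nat \<Rightarrow> ('a list \<Rightarrow> 'a) \<Rightarrow> nat \<Rightarrow> 'a list set \<Rightarrow> bool" where
  "preserves n f k R \<longleftrightarrow>
     (\<forall>rs\<in>tuples R n. map (\<lambda>j. f (map (\<lambda>r. r ! j) rs)) [0..<k] \<in> R)"

definition Pol :: "('s, 'a) rstruct \<Rightarrow> 'a op_set" where
  "Pol A =
     \<lparr>base = domain A,
      ops = (\<lambda>n. {f \<in> operations (domain A) n.
               n \<ge> 1 \<and> (\<forall>s\<in>symbols A. preserves n f (arity A s) (rel A s))})\<rparr>"

definition projection_clone :: "'a set \<Rightarrow> 'a op_set" where
  "projection_clone D = \<lparr>base = D, ops = (\<lambda>n. {proj D n i |i. i < n})\<rparr>"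

definition one_clone :: "bool op_set" where
  "one_clone = projection_clone UNIV"

lemma function_clone_Pol:
  assumes "rel_structure A"
  shows "function_clone (Pol A)"
proof -
  let ?D = "domain A"
  have P: "proj ?D n i \<in> ops (Pol A) n" if i: "i < n" for n i
  proof -
    have "preserves n (proj ?D n i) (arity A s) (rel A s)" if s: "s \<in> symbols A" for s
      unfolding preserves_def
    proof
      fix rs assume rs: "rs \<in> tuples (rel A s) n"
      have l: "length r = arity A s \<and> set r \<subseteq> ?D" if "r \<in> set rs" for r
        using that rs assms s unfolding rel_structure_def tuples_def by blast
      have t: "map (\<lambda>r. r ! j) rs \<in> tuples ?D n" if "j < arity A s" for j
        using l that rs unfolding tuples_def by force
      have n: "length rs = n" "rs ! i \<in> rel A s" and m: "rs ! i \<in> set rs"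
        using rs i unfolding tuples_def by (auto simp: subset_iff)
      have "map (\<lambda>j. proj ?D n i (map (\<lambda>r. r ! j) rs)) [0..<arity A s] = rs ! i"
        by (rule nth_equalityI) (use l[OF m] t n i in \<open>auto simp: proj_def\<close>)
      then show "map (\<lambda>j. proj ?D n i (map (\<lambda>r. r ! j) rs)) [0..<arity A s] \<in> rel A s"
        using n by simp
    qed
    moreover have "proj ?D n i \<in> operations ?D n"
      using i by (auto simp: proj_def operations_def tuples_def subset_iff)
    ultimately show ?thesis using i by (auto simp: Pol_def)
  qed
  have C: "compose_op ?D m f gs \<in> ops (Pol A) m"
    if f: "f \<in> ops (Pol A) n" and gs: "gs \<in> tuples (ops (Pol A) m) n" and m: "m \<ge> 1" for n m f gs
  proof -
    have g: "g \<in> operations ?D m" "\<And>s. s \<in> symbols A \<Longrightarrow> preserves m g (arity A s) (rel A s)"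
      if "g \<in> set gs" for g
      using gs that by (auto simp: tuples_def Pol_def)
    have gl: "length gs = n" using gs by (simp add: tuples_def)
    have f': "f \<in> operations ?D n" "\<And>s. s \<in> symbols A \<Longrightarrow> preserves n f (arity A s) (rel A s)"
      using f by (auto simp: Pol_def)
    have "map (\<lambda>g. g xs) gs \<in> tuples ?D n" if "xs \<in> tuples ?D m" for xs
      using g(1) gl that by (auto simp: tuples_def operations_def)
    then have o: "compose_op ?D m f gs \<in> operations ?D m"
      using f'(1) by (auto simp: compose_op_def operations_def)
    have "preserves m (compose_op ?D m f gs) (arity A s) (rel A s)" if s: "s \<in> symbols A" for s
      unfolding preserves_def
    proof
      fix rs assume rs: "rs \<in> tuples (rel A s) m"
      let ?k = "arity A s"
      let ?app = "\<lambda>g. map (\<lambda>j. g (map (\<lambda>r. r ! j) rs)) [0..<?k]"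
      have l: "length r = ?k \<and> set r \<subseteq> ?D" if "r \<in> set rs" for r
        using that rs assms s unfolding rel_structure_def tuples_def by blast
      have t: "map (\<lambda>r. r ! j) rs \<in> tuples ?D m" if "j < ?k" for j
        using l that rs unfolding tuples_def by force
      have "map ?app gs \<in> tuples (rel A s) n"
        using g(2)[OF _ s] rs gl by (auto simp: preserves_def tuples_def)
      then have "map (\<lambda>j. f (map (\<lambda>r. r ! j) (map ?app gs))) [0..<?k] \<in> rel A s"
        using f'(2)[OF s] by (simp only: preserves_def)
      also have "map (\<lambda>j. f (map (\<lambda>r. r ! j) (map ?app gs))) [0..<?k] = ?app (compose_op ?D m f gs)"
        using t by (auto simp: compose_op_def comp_def)
      finally show "?app (compose_op ?D m f gs) \<in> rel A s" .
    qed
    then show ?thesis using o m by (simp add: Pol_def)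
  qed
  show ?thesis unfolding function_clone_def
    using P C by (auto simp: Pol_def)
qed

lemma function_clone_projection_clone: "function_clone (projection_clone D)"
proof -
  have C1: "compose_op D m (proj D n i) gs = gs ! i"
    if i: "i < n" and gs: "gs \<in> tuples {proj D m j |j. j < m} n" for m n i gs
  proof
    fix xs
    have l: "length gs = n" using gs by (simp add: tuples_def)
    have g: "\<exists>j<m. g = proj D m j" if "g \<in> set gs" for g
      using gs that by (auto simp: tuples_def)
    have "g xs \<in> D" if "g \<in> set gs" "xs \<in> tuples D m" for g
      using g[OF that(1)] that(2) by (auto simp: proj_def tuples_def subset_iff)
    then have "map (\<lambda>g. g xs) gs \<in> tuples D n" if "xs \<in> tuples D m"
      using that l by (auto simp: tuples_def)
    then show "compose_op D m (proj D n i) gs xs = (gs ! i) xs"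
      using g[of "gs ! i"] l i by (auto simp: compose_op_def proj_def)
  qed
  have C2: "gs ! i \<in> {proj D m j |j. j < m}"
    if "i < n" "gs \<in> tuples {proj D m j |j. j < m} n" for m n i gs
    using that unfolding tuples_def by (auto dest: nth_mem)
  have c: "compose_op D m (proj D n i) gs \<in> {proj D m j |j. j < m}"
    if "i < n" "gs \<in> tuples {proj D m j |j. j < m} n" for m n i gs
    unfolding C1[OF that] by (rule C2[OF that])
  have "proj D n i \<in> operations D n" if "i < n" for n i
    using that unfolding operations_def proj_def
    by (intro restrict_PiE_iff[THEN iffD2]) (auto simp: tuples_def subset_iff)
  then have o: "{proj D n i |i. i < n} \<subseteq> operations D n" for n
    by blast
  show ?thesis
    unfolding function_clone_def projection_clone_def op_set.simps
  proof (intro conjI allI impI ballI)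
    fix n m :: nat and f gs
    assume "f \<in> {proj D n i |i. i < n}" and gs: "gs \<in> tuples {proj D m i |i. i < m} n"
    then obtain i where "i < n" "f = proj D n i" by blast
    then show "compose_op D m f gs \<in> {proj D m i |i. i < m}" using c gs by simp
  qed (use o in auto)
qed

section \<open>Clone homomorphisms\<close>

text \<open>An arity-preserving map assigns to each arity \<open>n\<close> a map \<open>\<xi> n\<close> between the sets of
  \<open>n\<close>-ary operations.\<close>

definition arity_preserving ::
  "'a op_set \<Rightarrow> 'b op_set \<Rightarrow> (nat \<Rightarrow> ('a list \<Rightarrow> 'a) \<Rightarrow> 'b list \<Rightarrow> 'b) \<Rightarrow> bool" where
  "arity_preserving C D \<xi> \<longleftrightarrow> (\<forall>n\<ge>1. \<xi> n \<in> ops C n \<rightarrow> ops D n)"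

definition clone_hom ::
  "'a op_set \<Rightarrow> 'b op_set \<Rightarrow> (nat \<Rightarrow> ('a list \<Rightarrow> 'a) \<Rightarrow> 'b list \<Rightarrow> 'b) \<Rightarrow> bool" where
  "clone_hom C D \<xi> \<longleftrightarrow> arity_preserving C D \<xi> \<and>
     (\<forall>n k. k < n \<longrightarrow> \<xi> n (proj (base C) n k) = proj (base D) n k) \<and>
     (\<forall>n\<ge>1. \<forall>m\<ge>1. \<forall>f\<in>ops C n. \<forall>gs\<in>tuples (ops C m) n.
        \<xi> m (compose_op (base C) m f gs) = compose_op (base D) m (\<xi> n f) (map (\<xi> m) gs))"

definition h1_clone_hom ::
  "'a op_set \<Rightarrow> 'b op_set \<Rightarrow> (nat \<Rightarrow> ('a list \<Rightarrow> 'a) \<Rightarrow> 'b list \<Rightarrow> 'b) \<Rightarrow> bool" where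
  "h1_clone_hom C D \<xi> \<longleftrightarrow> arity_preserving C D \<xi> \<and>
     (\<forall>n\<ge>1. \<forall>m\<ge>1. \<forall>f\<in>ops C n. \<forall>is\<in>tuples {..<m} n.
        \<xi> m (compose_op (base C) m f (map (proj (base C) m) is)) =
          compose_op (base D) m (\<xi> n f) (map (proj (base D) m) is))"

section \<open>Cyclic and Siggers operations\<close>

definition cyclic_op :: "'a set \<Rightarrow> nat \<Rightarrow> ('a list \<Rightarrow> 'a) \<Rightarrow> bool" where
  "cyclic_op D n t \<longleftrightarrow> n \<ge> 2 \<and> (\<forall>xs\<in>tuples D n. t xs = t (rotate1 xs))"

definition siggers_op :: "'a set \<Rightarrow> ('a list \<Rightarrow> 'a) \<Rightarrow> bool" where
  "siggers_op D t \<longleftrightarrow> (\<forall>a\<in>D. \<forall>r\<in>D. \<forall>e\<in>D. t [a, r, e, a] = t [r, a, r, e])"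

definition has_cyclic :: "'a op_set \<Rightarrow> bool" where
  "has_cyclic C \<longleftrightarrow> (\<exists>n. \<exists>t\<in>ops C n. cyclic_op (base C) n t)"

definition has_siggers :: "'a op_set \<Rightarrow> bool" where
  "has_siggers C \<longleftrightarrow> (\<exists>t\<in>ops C 4. siggers_op (base C) t)"

end

theory Submission
  imports Defs "HOL-Computational_Algebra.Primes"
begin

text \<open>
  Let \<open>K\<close> be the core of \<open>A\<close>, so that \<open>B\<close> is \<open>K\<close> with all singletons. All implications but one are
  short, and they are arranged in the circle
  (i) \<open>\<Longrightarrow>\<close> (iii) \<open>\<Longrightarrow>\<close> (iii') \<open>\<Longrightarrow>\<close> (iv') \<open>\<Longrightarrow>\<close> (ii') \<open>\<Longrightarrow>\<close> (ii) \<open>\<Longrightarrow>\<close> (i),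
  to which (iii) \<open>\<Longrightarrow>\<close> (iv) \<open>\<Longrightarrow>\<close> (ii) is added. Operations are carried between \<open>A\<close> and \<open>K\<close>
  by conjugation with the two homomorphisms, and a polymorphism of \<open>K\<close> becomes idempotent when it is
  followed by the inverse of its diagonal, which is an automorphism because \<open>K\<close> is a core. A cyclic operation
  of any arity \<open>n \<ge> 2\<close> yields a Siggers operation because the digraph of the Siggers identity has
  closed walks of every length \<open>n \<ge> 2\<close>; and projections do not satisfy the Siggers identity.

  The deep step is (i) \<open>\<Longrightarrow>\<close> (iii), a theorem of Barto and Kozik: a finite idempotent algebra whose
  clone has no homomorphism to the projections has a cyclic operation of every prime arity \<open>p\<close> larger
  than the algebra. By composing operations it is enough that every nonempty cyclic relation
  \<open>R \<le> X\<^sup>p\<close> contains a constant tuple (\<open>cyclic_rel_constant\<close>). The proof is by induction on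
  \<open>|X|\<close>. If some tuple of \<open>R\<close> lies in a proper subuniverse, or \<open>X\<close> has a proper nontrivial congruence,
  the induction hypothesis applies. So let \<open>X\<close> be simple and \<open>R\<close> subdirect.

  Suppose that \<open>X\<close> has no proper nonempty subuniverse that is absorbing with respect to a ternary term. Then, whenever
  \<open>R\<close> projects onto \<open>X\<^sup>J\<close> for a set \<open>J\<close> of coordinates, every further coordinate is either determined by those in
  \<open>J\<close> or independent of them. Hence \<open>|R| = |X|\<^sup>k\<close> for some \<open>k\<close>. This number is prime to \<open>p\<close>, so
  the rotation of \<open>R\<close>, of order \<open>p\<close>, has a fixed point. The
  dichotomy is an absorption theorem (\<open>linked_center\<close>). Its source is the fact that the center
  \<open>{y. \<forall>x\<in>X. (y, x) \<in> S}\<close> of a relation \<open>S\<close> is ternary absorbing as soon as it is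
  nonempty and \<open>X\<close> has no binary absorption (\<open>center_ternary_absorbs\<close>, an observation of Zhuk). The absence of a
  homomorphism to the projections enters only there, through \<open>expanding_one\<close>.

  Suppose that \<open>X\<close> has a proper nonempty ternary absorbing subuniverse. Among the subuniverses absorbing by the same
  term, choose a proper one \<open>B\<close> such that the set of \<open>j\<close> for which every element occurs at place
  \<open>j\<close> of some tuple of \<open>R\<close> with place \<open>0\<close> in \<open>B\<close> is as large as possible. If some \<open>j \<noteq> 0\<close> fails, then moving
  from \<open>B\<close> along the projection of \<open>R\<close> to the places \<open>0, j\<close> gives a better choice, unless place
  \<open>j\<close> determines place \<open>0\<close>, when \<open>R\<close> has a constant tuple for arithmetical reasons. If no \<open>j\<close> fails, any two
  places can be put into \<open>B\<close> at the same time, and ternary absorption extends this to all places. So \<open>R\<close> meets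
  \<open>B\<^sup>p\<close> and the induction hypothesis applies.
\<close>

section \<open>Abstract clones and their algebras\<close>

definition vec2 :: "'x \<Rightarrow> 'x \<Rightarrow> nat \<Rightarrow> 'x" where
  "vec2 a b = (\<lambda>k. if k = 0 then a else b)"

definition vec3 :: "'x \<Rightarrow> 'x \<Rightarrow> 'x \<Rightarrow> nat \<Rightarrow> 'x" where
  "vec3 a b c = (\<lambda>k. if k = 0 then a else if k = 1 then b else c)"

lemma vec_simps [simp]:
  "vec2 a b 0 = a" "vec2 a b (Suc k) = b"
  "vec3 a b c 0 = a" "vec3 a b c (Suc 0) = b" "vec3 a b c (Suc (Suc k)) = c"
  by (simp_all add: vec2_def vec3_def)

text \<open>Subalgebras, powers and quotients of an algebra all carry the same term operations. They are therefore
  presented as actions of one set \<open>Sym\<close> of operation symbols that is closed under substitution: \<open>cmp m f gs\<close>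
  names the composite of \<open>f\<close> with the \<open>m\<close>-ary \<open>gs 0, gs 1, \<dots>\<close>, and \<open>prj n i\<close> names a projection.
  Arguments are functions on \<open>nat\<close>, of which an operation reads the first \<open>ar f\<close> values; this makes
  substitution and the formation of powers pointwise.\<close>

locale abstract_clone =
  fixes Sym :: "'f set" and ar :: "'f \<Rightarrow> nat"
    and cmp :: "nat \<Rightarrow> 'f \<Rightarrow> (nat \<Rightarrow> 'f) \<Rightarrow> 'f" and prj :: "nat \<Rightarrow> nat \<Rightarrow> 'f"
  assumes prj: "i < n \<Longrightarrow> prj n i \<in> Sym \<and> ar (prj n i) = n"
    and cmp: "\<lbrakk>f \<in> Sym; \<And>k. k < ar f \<Longrightarrow> gs k \<in> Sym \<and> ar (gs k) = m\<rbrakk>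
      \<Longrightarrow> cmp m f gs \<in> Sym \<and> ar (cmp m f gs) = m"
    and ar_pos: "f \<in> Sym \<Longrightarrow> 0 < ar f"
begin

definition closed :: "('f \<Rightarrow> (nat \<Rightarrow> 'x) \<Rightarrow> 'x) \<Rightarrow> 'x set \<Rightarrow> bool" where
  "closed act S \<longleftrightarrow> (\<forall>f\<in>Sym. \<forall>x. (\<forall>k<ar f. x k \<in> S) \<longrightarrow> act f x \<in> S)"

text \<open>Only idempotent algebras occur. Idempotence is what makes fixing some coordinates of an invariant relation
  to constants, and taking a block of a congruence, produce subuniverses.\<close>

definition algebra :: "'x set \<Rightarrow> ('f \<Rightarrow> (nat \<Rightarrow> 'x) \<Rightarrow> 'x) \<Rightarrow> bool" where
  "algebra X act \<longleftrightarrow> closed act X \<and>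
     (\<forall>f\<in>Sym. \<forall>x y. (\<forall>k<ar f. x k = y k) \<longrightarrow> act f x = act f y) \<and>
     (\<forall>f\<in>Sym. \<forall>m gs x. (\<forall>k<ar f. gs k \<in> Sym \<and> ar (gs k) = m) \<longrightarrow> (\<forall>k<m. x k \<in> X) \<longrightarrow>
        act (cmp m f gs) x = act f (\<lambda>k. act (gs k) x)) \<and>
     (\<forall>n i x. i < n \<longrightarrow> (\<forall>k<n. x k \<in> X) \<longrightarrow> act (prj n i) x = x i) \<and>
     (\<forall>f\<in>Sym. \<forall>a\<in>X. act f (\<lambda>_. a) = a)"

lemma closedD: "closed act S \<Longrightarrow> f \<in> Sym \<Longrightarrow> (\<And>k. k < ar f \<Longrightarrow> x k \<in> S) \<Longrightarrow> act f x \<in> S"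
  by (auto simp: closed_def)

lemma closedI: "(\<And>f x. f \<in> Sym \<Longrightarrow> (\<And>k. k < ar f \<Longrightarrow> x k \<in> S) \<Longrightarrow> act f x \<in> S) \<Longrightarrow> closed act S"
  by (auto simp: closed_def)

lemma algebra_closed: "algebra X act \<Longrightarrow> closed act X"
  by (simp add: algebra_def)

lemma act_cong: "algebra X act \<Longrightarrow> f \<in> Sym \<Longrightarrow> (\<And>k. k < ar f \<Longrightarrow> x k = y k) \<Longrightarrow> act f x = act f y"
  by (simp add: algebra_def)

lemma act_cmp: "algebra X act \<Longrightarrow> f \<in> Sym \<Longrightarrow> (\<And>k. k < ar f \<Longrightarrow> gs k \<in> Sym \<and> ar (gs k) = m)
   \<Longrightarrow> (\<And>k. k < m \<Longrightarrow> x k \<in> X) \<Longrightarrow> act (cmp m f gs) x = act f (\<lambda>k. act (gs k) x)"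
  by (simp add: algebra_def)

lemma act_prj: "algebra X act \<Longrightarrow> i < n \<Longrightarrow> (\<And>k. k < n \<Longrightarrow> x k \<in> X) \<Longrightarrow> act (prj n i) x = x i"
  by (simp add: algebra_def)

lemma act_idem: "algebra X act \<Longrightarrow> f \<in> Sym \<Longrightarrow> a \<in> X \<Longrightarrow> act f (\<lambda>_. a) = a"
  by (simp add: algebra_def)

lemma act_const:
  assumes "algebra X act" "f \<in> Sym" "a \<in> X" "\<And>k. k < ar f \<Longrightarrow> x k = a"
  shows "act f x = a"
  using act_cong[OF assms(1,2), of x "\<lambda>_. a"] act_idem[OF assms(1,2,3)] assms(4) by simp

lemma subalgebra: "algebra X act \<Longrightarrow> S \<subseteq> X \<Longrightarrow> closed act S \<Longrightarrow> algebra S act"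
  unfolding algebra_def by (auto simp: subset_iff)

definition pair_act ::
  "('f \<Rightarrow> (nat \<Rightarrow> 'x) \<Rightarrow> 'x) \<Rightarrow> ('f \<Rightarrow> (nat \<Rightarrow> 'y) \<Rightarrow> 'y) \<Rightarrow> 'f \<Rightarrow> (nat \<Rightarrow> 'x \<times> 'y) \<Rightarrow> 'x \<times> 'y" where
  "pair_act act act' f x = (act f (\<lambda>k. fst (x k)), act' f (\<lambda>k. snd (x k)))"

definition power_act ::
  "('f \<Rightarrow> (nat \<Rightarrow> 'x) \<Rightarrow> 'x) \<Rightarrow> 'f \<Rightarrow> (nat \<Rightarrow> 'i \<Rightarrow> 'x) \<Rightarrow> 'i \<Rightarrow> 'x" where
  "power_act act f v = (\<lambda>i. act f (\<lambda>k. v k i))"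

lemma closed_pairD:
  assumes "closed (pair_act act act') E" "f \<in> Sym" "\<And>k. k < ar f \<Longrightarrow> (x k, y k) \<in> E"
  shows "(act f x, act' f y) \<in> E"
  using closedD[OF assms(1,2), of "\<lambda>k. (x k, y k)"] assms(3) by (simp add: pair_act_def)

lemma closed_pairI:
  assumes "\<And>f x y. f \<in> Sym \<Longrightarrow> (\<And>k. k < ar f \<Longrightarrow> (x k, y k) \<in> E) \<Longrightarrow> (act f x, act' f y) \<in> E"
  shows "closed (pair_act act act') E"
  by (rule closedI) (auto simp: pair_act_def intro!: assms)

lemma power_algebra:
  assumes X: "algebra X act" and R: "closed (power_act act) R" "\<And>r i. r \<in> R \<Longrightarrow> r i \<in> X"
  shows "algebra R (power_act act)"
  unfolding algebra_def
proof (intro conjI ballI allI impI)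
  show "closed (power_act act) R" by (rule R)
next
  fix f and x y :: "nat \<Rightarrow> 'b \<Rightarrow> 'a" assume "f \<in> Sym" "\<forall>k<ar f. x k = y k"
  then show "power_act act f x = power_act act f y"
    unfolding power_act_def by (intro ext act_cong[OF X]) auto
next
  fix f m gs and x :: "nat \<Rightarrow> 'b \<Rightarrow> 'a"
  assume "f \<in> Sym" "\<forall>k<ar f. gs k \<in> Sym \<and> ar (gs k) = m" "\<forall>k<m. x k \<in> R"
  then show "power_act act (cmp m f gs) x = power_act act f (\<lambda>k. power_act act (gs k) x)"
    unfolding power_act_def by (intro ext act_cmp[OF X]) (auto simp: R)
next
  fix n i and x :: "nat \<Rightarrow> 'b \<Rightarrow> 'a"
  assume "i < n" "\<forall>k<n. x k \<in> R"
  then show "power_act act (prj n i) x = x i"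
    unfolding power_act_def by (intro ext act_prj[OF X]) (auto simp: R)
next
  fix f a assume "f \<in> Sym" "a \<in> R"
  then show "power_act act f (\<lambda>_. a) = a"
    unfolding power_act_def by (intro ext act_idem[OF X]) (auto simp: R)
qed

definition binary_absorbs where
  "binary_absorbs act s C X \<longleftrightarrow> s \<in> Sym \<and> ar s = 2 \<and>
     (\<forall>c\<in>C. \<forall>x\<in>X. act s (vec2 c x) \<in> C \<and> act s (vec2 x c) \<in> C)"

definition ternary_absorbs where
  "ternary_absorbs act t C X \<longleftrightarrow> t \<in> Sym \<and> ar t = 3 \<and>
     (\<forall>c\<in>C. \<forall>c'\<in>C. \<forall>x\<in>X.
        act t (vec3 c c' x) \<in> C \<and> act t (vec3 c x c') \<in> C \<and> act t (vec3 x c c') \<in> C)"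

definition binary_free where
  "binary_free X act \<longleftrightarrow> (\<forall>C s. C \<subseteq> X \<and> C \<noteq> {} \<and> closed act C \<and> binary_absorbs act s C X \<longrightarrow> C = X)"

definition ternary_free where
  "ternary_free X act \<longleftrightarrow> (\<forall>C t. C \<subseteq> X \<and> C \<noteq> {} \<and> closed act C \<and> ternary_absorbs act t C X \<longrightarrow> C = X)"

lemma ternary_freeD:
  "ternary_free X act \<Longrightarrow> C \<subseteq> X \<Longrightarrow> C \<noteq> {} \<Longrightarrow> closed act C \<Longrightarrow> \<exists>t. ternary_absorbs act t C X \<Longrightarrow> C = X"
  unfolding ternary_free_def by blast

lemma act_vec2: "algebra X act \<Longrightarrow> f \<in> Sym \<Longrightarrow> ar f = 2 \<Longrightarrow> act f x = act f (vec2 (x 0) (x (Suc 0)))"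
  by (rule act_cong) (auto simp: less_2_cases_iff)

lemma act_vec3: "algebra X act \<Longrightarrow> f \<in> Sym \<Longrightarrow> ar f = 3
   \<Longrightarrow> act f x = act f (vec3 (x 0) (x (Suc 0)) (x (Suc (Suc 0))))"
  by (rule act_cong) (auto simp: numeral_3_eq_3 less_Suc_eq)

lemma closed_vec2: "closed act S \<Longrightarrow> s \<in> Sym \<Longrightarrow> ar s = 2 \<Longrightarrow> a \<in> S \<Longrightarrow> b \<in> S \<Longrightarrow> act s (vec2 a b) \<in> S"
  by (rule closedD) (auto simp: less_2_cases_iff)

text \<open>If \<open>C\<close> absorbs by \<open>s(x, y)\<close>, it absorbs by \<open>s(s(x, y), z)\<close>.\<close>

lemma ternary_free_imp_binary_free:
  assumes X: "algebra X act" and free: "ternary_free X act"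
  shows "binary_free X act"
  unfolding binary_free_def
proof (intro allI impI, elim conjE)
  fix C s assume C: "C \<subseteq> X" "C \<noteq> {}" "closed act C" and abs: "binary_absorbs act s C X"
  have s: "s \<in> Sym" "ar s = 2" using abs by (auto simp: binary_absorbs_def)
  define u where "u = cmp 3 s (vec2 (prj 3 0) (prj 3 1))"
  define t where "t = cmp 3 s (vec2 u (prj 3 2))"
  have gs: "\<And>k. k < ar s \<Longrightarrow> vec2 (prj 3 0) (prj 3 1) k \<in> Sym \<and> ar (vec2 (prj 3 0) (prj 3 1) k) = 3"
    using prj[of _ 3] s by (auto simp: less_2_cases_iff)
  have u: "u \<in> Sym" "ar u = 3"
    using cmp[OF s(1) gs] by (auto simp: u_def)
  have hs: "\<And>k. k < ar s \<Longrightarrow> vec2 u (prj 3 2) k \<in> Sym \<and> ar (vec2 u (prj 3 2) k) = 3"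
    using prj[of _ 3] s u by (auto simp: less_2_cases_iff)
  have t: "t \<in> Sym" "ar t = 3"
    using cmp[OF s(1) hs] by (auto simp: t_def)
  have u3: "act u (vec3 a b c) = act s (vec2 a b)" if "a \<in> X" "b \<in> X" "c \<in> X" for a b c
  proof -
    have v: "\<And>k. k < 3 \<Longrightarrow> vec3 a b c k \<in> X" using that by (auto simp: vec3_def)
    have "act u (vec3 a b c) = act s (\<lambda>k. act (vec2 (prj 3 0) (prj 3 1) k) (vec3 a b c))"
      unfolding u_def by (rule act_cmp[OF X s(1) gs v]) auto
    also have "\<dots> = act s (vec2 a b)"
      by (subst act_vec2[OF X s]) (simp add: act_prj[OF X _ v])
    finally show ?thesis .
  qed
  have t3: "act t (vec3 a b c) = act s (vec2 (act s (vec2 a b)) c)" if "a \<in> X" "b \<in> X" "c \<in> X" for a b c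
  proof -
    have v: "\<And>k. k < 3 \<Longrightarrow> vec3 a b c k \<in> X" using that by (auto simp: vec3_def)
    have "act t (vec3 a b c) = act s (\<lambda>k. act (vec2 u (prj 3 2) k) (vec3 a b c))"
      unfolding t_def by (rule act_cmp[OF X s(1) hs v]) auto
    also have "\<dots> = act s (vec2 (act s (vec2 a b)) c)"
      by (subst act_vec2[OF X s]) (simp add: act_prj[OF X _ v] u3[OF that] numeral_2_eq_2)
    finally show ?thesis .
  qed
  have sX: "act s (vec2 a b) \<in> X" if "a \<in> X" "b \<in> X" for a b
    using closed_vec2[OF algebra_closed[OF X] s that] .
  have "ternary_absorbs act t C X"
    using abs C(1) sX t unfolding ternary_absorbs_def binary_absorbs_def
    by (auto simp: t3 subset_iff)
  then show "C = X" using free C unfolding ternary_free_def by blast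
qed

lemma closed_relcomp:
  assumes "closed (pair_act act1 act2) E" "closed (pair_act act2 act3) F"
  shows "closed (pair_act act1 act3) (E O F)"
proof (rule closed_pairI)
  fix f x z assume f: "f \<in> Sym" and xz: "\<And>k. k < ar f \<Longrightarrow> (x k, z k) \<in> E O F"
  then have "\<forall>k. \<exists>y. k < ar f \<longrightarrow> (x k, y) \<in> E \<and> (y, z k) \<in> F" by blast
  then obtain y where "\<And>k. k < ar f \<Longrightarrow> (x k, y k) \<in> E \<and> (y k, z k) \<in> F" by metis
  then have "(act1 f x, act2 f y) \<in> E" "(act2 f y, act3 f z) \<in> F"
    using closed_pairD[OF assms(1) f, of x y] closed_pairD[OF assms(2) f, of y z] by auto
  then show "(act1 f x, act3 f z) \<in> E O F" by blast
qed

lemma closed_converse: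
  assumes "closed (pair_act act1 act2) E"
  shows "closed (pair_act act2 act1) (E\<inverse>)"
  by (rule closed_pairI) (auto intro: closed_pairD[OF assms])

text \<open>Chains of different lengths cannot be combined directly. Instead a maximal invariant relation between
  \<open>T\<close> and its transitive closure is taken: composing it with itself shows that it is transitive.\<close>

lemma closed_trancl:
  assumes T: "T \<subseteq> X \<times> X" "finite X" "closed (pair_act act act) T" "\<And>x. x \<in> X \<Longrightarrow> (x, x) \<in> T"
  shows "closed (pair_act act act) (T\<^sup>+)"
proof -
  have TX: "T\<^sup>+ \<subseteq> X \<times> X" using trancl_subset_Sigma[OF T(1)] .
  have ex: "\<exists>S\<in>{S. T \<subseteq> S \<and> S \<subseteq> T\<^sup>+ \<and> closed (pair_act act act) S}. T \<subseteq> S \<and>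
     (\<forall>S'\<in>{S. T \<subseteq> S \<and> S \<subseteq> T\<^sup>+ \<and> closed (pair_act act act) S}. S \<subseteq> S' \<longrightarrow> S = S')"
  proof (rule finite_has_maximal2)
    show "finite {S. T \<subseteq> S \<and> S \<subseteq> T\<^sup>+ \<and> closed (pair_act act act) S}"
      by (rule finite_subset[of _ "Pow (X \<times> X)"]) (use TX T(2) in auto)
  qed (use T(3) in auto)
  then obtain S where S: "T \<subseteq> S" "S \<subseteq> T\<^sup>+" "closed (pair_act act act) S"
    and max': "\<forall>S'. T \<subseteq> S' \<and> S' \<subseteq> T\<^sup>+ \<and> closed (pair_act act act) S' \<longrightarrow> S \<subseteq> S' \<longrightarrow> S = S'"
    by auto
  have max: "S = S'" if "T \<subseteq> S'" "S' \<subseteq> T\<^sup>+" "closed (pair_act act act) S'" "S \<subseteq> S'" for S'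
    using max' that by simp
  have sub: "S \<subseteq> S O S" using S(1,2) TX T(4) by blast
  have "S = S O S"
  proof (rule max)
    show "T \<subseteq> S O S" using S(1) sub by blast
    show "S O S \<subseteq> T\<^sup>+"
    proof (rule subrelI)
      fix x z assume "(x, z) \<in> S O S"
      then obtain y where "(x, y) \<in> T\<^sup>+" "(y, z) \<in> T\<^sup>+" using S(2) by blast
      then show "(x, z) \<in> T\<^sup>+" by (rule trancl_trans)
    qed
    show "closed (pair_act act act) (S O S)" by (rule closed_relcomp[OF S(3) S(3)])
  qed (rule sub)
  then have "trans S" by (metis relcompI transI)
  then have "T\<^sup>+ \<subseteq> S" using S(1) by (metis trancl_id trancl_mono_subset)
  then show ?thesis using S by (metis subset_antisym)
qed

lemma closed_image:
  assumes X: "algebra X act" and R: "closed (power_act act) R" and B: "closed act B"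
  shows "closed act ((\<lambda>r. r j) ` {r \<in> R. r i \<in> B})"
proof (rule closedI)
  let ?C = "(\<lambda>r. r j) ` {r \<in> R. r i \<in> B}"
  fix f x assume f: "f \<in> Sym" and "\<And>k. k < ar f \<Longrightarrow> x k \<in> ?C"
  then have "\<forall>k. \<exists>r. k < ar f \<longrightarrow> r \<in> R \<and> r i \<in> B \<and> x k = r j" by blast
  then obtain r where r: "\<And>k. k < ar f \<Longrightarrow> r k \<in> R \<and> r k i \<in> B \<and> x k = r k j" by metis
  have "power_act act f r \<in> R" by (rule closedD[OF R f]) (use r in auto)
  moreover have "power_act act f r i \<in> B"
    unfolding power_act_def by (rule closedD[OF B f]) (use r in auto)
  moreover have "act f x = power_act act f r j"
    unfolding power_act_def by (rule act_cong[OF X f]) (use r in auto)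
  ultimately show "act f x \<in> ?C" by blast
qed

lemma absorbs_image:
  assumes X: "algebra X act" and R: "closed (power_act act) R"
    and full: "\<And>a. a \<in> X \<Longrightarrow> \<exists>r\<in>R. r j = a" and RX: "\<And>r i. r \<in> R \<Longrightarrow> r i \<in> X"
    and B: "ternary_absorbs act t B X"
  shows "ternary_absorbs act t ((\<lambda>r. r j) ` {r \<in> R. r i \<in> B}) X"
proof -
  have t: "t \<in> Sym" "ar t = 3" using B by (auto simp: ternary_absorbs_def)
  let ?C = "(\<lambda>r. r j) ` {r \<in> R. r i \<in> B}"
  have mem: "act t (vec3 (p j) (q j) (s j)) \<in> ?C"
    if "p \<in> R" "q \<in> R" "s \<in> R" "act t (vec3 (p i) (q i) (s i)) \<in> B" for p q s
  proof -
    have eq: "power_act act t (vec3 p q s) k = act t (vec3 (p k) (q k) (s k))" for k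
      unfolding power_act_def by (subst act_vec3[OF X t]) simp
    have "power_act act t (vec3 p q s) \<in> R"
      by (rule closedD[OF R t(1)]) (use that in \<open>auto simp: vec3_def\<close>)
    then show ?thesis using that(4) by (intro image_eqI[of _ _ "power_act act t (vec3 p q s)"]) (auto simp: eq)
  qed
  show ?thesis
    unfolding ternary_absorbs_def
  proof (intro conjI ballI t)
    fix c c' x assume "c \<in> ?C" "c' \<in> ?C" "x \<in> X"
    then obtain p q s where pqs: "p \<in> R" "q \<in> R" "s \<in> R" "p i \<in> B" "q i \<in> B" "c = p j" "c' = q j" "x = s j"
      using full by blast
    then have "s i \<in> X" using RX by auto
    then have "act t (vec3 (p i) (q i) (s i)) \<in> B" "act t (vec3 (p i) (s i) (q i)) \<in> B"
        "act t (vec3 (s i) (p i) (q i)) \<in> B"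
      using B pqs by (auto simp: ternary_absorbs_def)
    then show "act t (vec3 c c' x) \<in> ?C" "act t (vec3 c x c') \<in> ?C" "act t (vec3 x c c') \<in> ?C"
      using mem pqs by auto
  qed
qed

lemma common_coordinate_rel:
  assumes X: "algebra X act" and R: "closed (power_act act) R"
  shows "closed (pair_act act act) {(r i, r' i) |r r'. r \<in> R \<and> r' \<in> R \<and> (\<forall>j\<in>J. r j = r' j)}"
proof (rule closed_pairI)
  let ?T = "{(r i, r' i) |r r'. r \<in> R \<and> r' \<in> R \<and> (\<forall>j\<in>J. r j = r' j)}"
  fix f x y assume f: "f \<in> Sym" and xy: "\<And>k. k < ar f \<Longrightarrow> (x k, y k) \<in> ?T"
  then have "\<forall>k. \<exists>r r'. k < ar f \<longrightarrow> r \<in> R \<and> r' \<in> R \<and> (\<forall>j\<in>J. r j = r' j) \<and> x k = r i \<and> y k = r' i" by blast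
  then obtain r r' where r: "\<And>k. k < ar f \<Longrightarrow> r k \<in> R \<and> r' k \<in> R \<and> (\<forall>j\<in>J. r k j = r' k j) \<and> x k = r k i \<and> y k = r' k i"
    by metis
  have "power_act act f r \<in> R" "power_act act f r' \<in> R" using r by (auto intro!: closedD[OF R f])
  moreover have "\<forall>j\<in>J. power_act act f r j = power_act act f r' j"
    unfolding power_act_def by (intro ballI act_cong[OF X f]) (use r in auto)
  moreover have "act f x = power_act act f r i" "act f y = power_act act f r' i"
    unfolding power_act_def by (intro act_cong[OF X f]; use r in auto)+
  ultimately show "(act f x, act f y) \<in> ?T" by blast
qed

text \<open>\<open>t\<close> applied to \<open>ar t\<close> copies of \<open>s\<close>, all with separate variables; copy \<open>k\<close> reads the
  variables from \<open>k * ar s\<close> on.\<close>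

definition star :: "'f \<Rightarrow> 'f \<Rightarrow> 'f" where
  "star t s = (let m = ar t * ar s in
     cmp m t (\<lambda>k. cmp m s (\<lambda>j. prj m (k * ar s + j))))"

lemma block_less: "k < a \<Longrightarrow> j < b \<Longrightarrow> k * b + j < a * (b::nat)"
proof -
  assume "k < a" "j < b"
  then have "k * b + j < Suc k * b" by simp
  also have "\<dots> \<le> a * b" using \<open>k < a\<close> by (intro mult_right_mono) auto
  finally show ?thesis .
qed

lemma star_Sym:
  assumes "t \<in> Sym" "s \<in> Sym"
  shows "star t s \<in> Sym" "ar (star t s) = ar t * ar s"
proof -
  have "star t s \<in> Sym \<and> ar (star t s) = ar t * ar s"
    unfolding star_def Let_def
    by (intro cmp assms prj block_less)
  then show "star t s \<in> Sym" "ar (star t s) = ar t * ar s" by auto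
qed

lemma act_star:
  assumes X: "algebra X act" and ts: "t \<in> Sym" "s \<in> Sym"
    and x: "\<And>k. k < ar t * ar s \<Longrightarrow> x k \<in> X"
  shows "act (star t s) x = act t (\<lambda>k. act s (\<lambda>j. x (k * ar s + j)))"
proof -
  let ?m = "ar t * ar s"
  have g: "cmp ?m s (\<lambda>j. prj ?m (k * ar s + j)) \<in> Sym \<and> ar (cmp ?m s (\<lambda>j. prj ?m (k * ar s + j))) = ?m"
    if "k < ar t" for k
    by (intro cmp ts prj block_less that)
  have "act (star t s) x = act t (\<lambda>k. act (cmp ?m s (\<lambda>j. prj ?m (k * ar s + j))) x)"
    unfolding star_def Let_def by (rule act_cmp[OF X ts(1) g x])
  also have "\<dots> = act t (\<lambda>k. act s (\<lambda>j. x (k * ar s + j)))"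
  proof (rule act_cong[OF X ts(1)])
    fix k assume k: "k < ar t"
    have "act (cmp ?m s (\<lambda>j. prj ?m (k * ar s + j))) x = act s (\<lambda>j. act (prj ?m (k * ar s + j)) x)"
      by (rule act_cmp[OF X ts(2) _ x]) (intro prj block_less k, assumption+)
    also have "\<dots> = act s (\<lambda>j. x (k * ar s + j))"
      by (rule act_cong[OF X ts(2)], rule act_prj[OF X block_less[OF k] x])
    finally show "act (cmp ?m s (\<lambda>j. prj ?m (k * ar s + j))) x = act s (\<lambda>j. x (k * ar s + j))" .
  qed
  finally show ?thesis .
qed

text \<open>No position of \<open>t\<close> is dominated by \<open>C\<close>: membership of a single argument in \<open>C\<close> never forces the value
  into \<open>C\<close>.\<close>

definition expands where
  "expands X act t C \<longleftrightarrow> (\<forall>i<ar t. \<exists>x. (\<forall>k<ar t. x k \<in> X) \<and> x i \<in> C \<and> act t x \<notin> C)"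

text \<open>Nesting keeps the expansion property of either factor, by idempotence: the inner copies may be fed with constant
  blocks, so that \<open>t\<close> acts alone, or all with the same arguments, so that \<open>s\<close> acts alone.\<close>

lemma expands_star1:
  assumes X: "algebra X act" and ts: "t \<in> Sym" "s \<in> Sym" and e: "expands X act t C"
  shows "expands X act (star t s) C"
  unfolding expands_def star_Sym[OF ts]
proof (intro allI impI)
  fix i assume i: "i < ar t * ar s"
  then have "i div ar s < ar t" by (simp add: less_mult_imp_div_less)
  then obtain y where y: "\<forall>k<ar t. y k \<in> X" "y (i div ar s) \<in> C" "act t y \<notin> C"
    using e by (auto simp: expands_def)
  let ?x = "\<lambda>l. y (l div ar s)"
  have xX: "?x l \<in> X" if "l < ar t * ar s" for l
    using y(1) that by (simp add: less_mult_imp_div_less)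
  have "act (star t s) ?x = act t (\<lambda>k. act s (\<lambda>j. y ((k * ar s + j) div ar s)))"
    by (rule act_star[OF X ts xX])
  also have "\<dots> = act t y"
  proof (rule act_cong[OF X ts(1)])
    fix k assume k: "k < ar t"
    show "act s (\<lambda>j. y ((k * ar s + j) div ar s)) = y k"
      by (rule act_const[OF X ts(2)]) (use y(1) k in auto)
  qed
  finally show "\<exists>x. (\<forall>k<ar t * ar s. x k \<in> X) \<and> x i \<in> C \<and> act (star t s) x \<notin> C"
    using xX y by (intro exI[of _ ?x]) auto
qed

lemma expands_star2:
  assumes X: "algebra X act" and ts: "t \<in> Sym" "s \<in> Sym" and e: "expands X act s C"
  shows "expands X act (star t s) C"
  unfolding expands_def star_Sym[OF ts]
proof (intro allI impI)
  fix i assume i: "i < ar t * ar s"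
  have j: "i mod ar s < ar s" using ar_pos[OF ts(2)] by simp
  then obtain y where y: "\<forall>k<ar s. y k \<in> X" "y (i mod ar s) \<in> C" "act s y \<notin> C"
    using e by (auto simp: expands_def)
  let ?x = "\<lambda>l. y (l mod ar s)"
  have xX: "?x l \<in> X" if "l < ar t * ar s" for l
    using y(1) ar_pos[OF ts(2)] by simp
  have yX: "act s y \<in> X" using closedD[OF algebra_closed[OF X] ts(2)] y(1) by simp
  have "act (star t s) ?x = act t (\<lambda>k. act s (\<lambda>j. y ((k * ar s + j) mod ar s)))"
    by (rule act_star[OF X ts xX])
  also have "\<dots> = act t (\<lambda>k. act s y)"
    by (rule act_cong[OF X ts(1)], rule act_cong[OF X ts(2)]) simp
  also have "\<dots> = act s y" by (rule act_idem[OF X ts(1) yX])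
  finally show "\<exists>x. (\<forall>k<ar t * ar s. x k \<in> X) \<and> x i \<in> C \<and> act (star t s) x \<notin> C"
    using xX y by (intro exI[of _ ?x]) auto
qed

section \<open>Absorption and essential relations\<close>

text \<open>An \<open>n\<close>-ary invariant relation that misses \<open>K\<^sup>n\<close> although dropping any one coordinate makes it meet the
  power of \<open>K\<close>. Such relations are the obstructions to absorption of low arity.\<close>

definition essential :: "('f \<Rightarrow> (nat \<Rightarrow> 'y) \<Rightarrow> 'y) \<Rightarrow> 'y set \<Rightarrow> 'y set \<Rightarrow> nat \<Rightarrow> bool" where
  "essential act Y K n \<longleftrightarrow> (\<exists>Q. closed (power_act act) Q \<and> (\<forall>q\<in>Q. \<forall>i<n. q i \<in> Y) \<and>
     (\<forall>i<n. \<exists>q\<in>Q. \<forall>j<n. j \<noteq> i \<longrightarrow> q j \<in> K) \<and> \<not> (\<exists>q\<in>Q. \<forall>j<n. q j \<in> K))"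

text \<open>Absorption by a term of arbitrary arity: one argument may leave \<open>K\<close>.\<close>

definition near_absorbs where
  "near_absorbs act s K Y \<longleftrightarrow> s \<in> Sym \<and>
     (\<forall>i<ar s. \<forall>y. (\<forall>k<ar s. k \<noteq> i \<longrightarrow> y k \<in> K) \<longrightarrow> y i \<in> Y \<longrightarrow> act s y \<in> K)"

text \<open>The tuples that leave \<open>K\<close> at one coordinate only are combined by \<open>s\<close>: every coordinate then sees at most one
  argument outside \<open>K\<close>.\<close>

lemma essential_bound:
  assumes abs: "near_absorbs act s K Y" and K: "closed act K" and ess: "essential act Y K n"
  shows "n < ar s"
proof (rule ccontr)
  assume n: "\<not> n < ar s"
  have s: "s \<in> Sym" using abs by (simp add: near_absorbs_def)
  obtain Q where Q: "closed (power_act act) Q" "\<forall>q\<in>Q. \<forall>i<n. q i \<in> Y"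
      "\<forall>i<n. \<exists>q\<in>Q. \<forall>j<n. j \<noteq> i \<longrightarrow> q j \<in> K" "\<not> (\<exists>q\<in>Q. \<forall>j<n. q j \<in> K)"
    using ess by (auto simp: essential_def)
  obtain q where q: "\<And>i. i < n \<Longrightarrow> q i \<in> Q" "\<And>i j. i < n \<Longrightarrow> j < n \<Longrightarrow> j \<noteq> i \<Longrightarrow> q i j \<in> K"
    using Q(3) by metis
  have "power_act act s q \<in> Q" by (rule closedD[OF Q(1) s]) (use q n in auto)
  moreover have "power_act act s q j \<in> K" if j: "j < n" for j
  proof (cases "j < ar s")
    case True
    have "\<forall>k<ar s. k \<noteq> j \<longrightarrow> q k j \<in> K" using q(2) j n by auto
    moreover have "q j j \<in> Y" using Q(2) q(1) j by auto
    ultimately show ?thesis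
      using abs True by (auto simp: near_absorbs_def power_act_def)
  next
    case False
    then show ?thesis unfolding power_act_def
      by (intro closedD[OF K s] q(2)) (use n j in auto)
  qed
  ultimately show False using Q(4) by blast
qed

text \<open>Consider the triples of elements with at least two entries in \<open>K\<close>, and the relation formed by the values of all ternary
  terms on them. A minimal set of triples that no ternary term sends into \<open>K\<close> gives an essential relation. It has at
  least three members, as two triples always share a position at which both are in \<open>K\<close>, where a projection works.\<close>

lemma ternary_absorbs_if_not_essential:
  assumes Y: "algebra Y act" "finite Y" and K: "K \<subseteq> Y"
    and no: "\<And>n. n \<ge> 3 \<Longrightarrow> \<not> essential act Y K n"
  shows "\<exists>t. ternary_absorbs act t K Y"
proof -
  define I where "I = {(a, b, c). a \<in> Y \<and> b \<in> Y \<and> c \<in> Y \<and> (a \<in> K \<and> b \<in> K \<or> a \<in> K \<and> c \<in> K \<or> b \<in> K \<and> c \<in> K)}"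
  have "finite I" by (rule finite_subset[of _ "Y \<times> Y \<times> Y"]) (use Y(2) in \<open>auto simp: I_def\<close>)
  define tup where "tup p = (case p of (a, b, c) \<Rightarrow> vec3 a b c)" for p :: "'a \<times> 'a \<times> 'a"
  have tupY: "tup p k \<in> Y" if "p \<in> I" for p k
    using that by (auto simp: tup_def I_def vec3_def)
  have "\<exists>u\<in>Sym. ar u = 3 \<and> (\<forall>p\<in>C. act u (tup p) \<in> K)" if "finite C" "C \<subseteq> I" for C
    using that
  proof (induction C rule: finite_psubset_induct)
    case (psubset C)
    show ?case
    proof (cases "card C \<ge> 3")
      case True
      define n where "n = card C"
      obtain e where e: "bij_betw e {..<n} C"
        using ex_bij_betw_nat_finite[OF psubset(1)] by (auto simp: n_def atLeast0LessThan)
      have eI: "e i \<in> I" if "i < n" for i using e psubset(3) that by (auto simp: bij_betw_def)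
      define Q where "Q = {q. \<exists>u\<in>Sym. ar u = 3 \<and> (\<forall>i<n. q i = act u (tup (e i)))}"
      have clQ: "closed (power_act act) Q"
      proof (rule closedI)
        fix f and x :: "nat \<Rightarrow> nat \<Rightarrow> 'a"
        assume f: "f \<in> Sym" and x: "\<And>k. k < ar f \<Longrightarrow> x k \<in> Q"
        then obtain u where u: "\<And>k. k < ar f \<Longrightarrow> u k \<in> Sym \<and> ar (u k) = 3"
            "\<And>k i. k < ar f \<Longrightarrow> i < n \<Longrightarrow> x k i = act (u k) (tup (e i))"
          unfolding Q_def mem_Collect_eq by metis
        have "power_act act f x i = act (cmp 3 f u) (tup (e i))" if i: "i < n" for i
        proof -
          have "act (cmp 3 f u) (tup (e i)) = act f (\<lambda>k. act (u k) (tup (e i)))"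
            by (rule act_cmp[OF Y(1) f u(1) tupY[OF eI[OF i]]])
          also have "\<dots> = power_act act f x i"
            unfolding power_act_def by (rule act_cong[OF Y(1) f]) (simp add: u(2) i)
          finally show ?thesis by simp
        qed
        then show "power_act act f x \<in> Q" using cmp[OF f, of u 3, OF u(1)] unfolding Q_def by blast
      qed
      have QY: "q i \<in> Y" if q: "q \<in> Q" and i: "i < n" for q i
      proof -
        obtain u where u: "u \<in> Sym" "q i = act u (tup (e i))" using q i by (auto simp: Q_def)
        show ?thesis unfolding u(2)
          by (rule closedD[OF algebra_closed[OF Y(1)] u(1)]) (rule tupY[OF eI[OF i]])
      qed
      have drop: "\<exists>q\<in>Q. \<forall>j<n. j \<noteq> i \<longrightarrow> q j \<in> K" if i: "i < n" for i
      proof -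
        have "e i \<in> C" using e i by (auto simp: bij_betw_def)
        then have "C - {e i} \<subset> C" by blast
        then obtain u where u: "u \<in> Sym" "ar u = 3" "\<forall>p\<in>C - {e i}. act u (tup p) \<in> K"
          using psubset.IH[of "C - {e i}"] psubset(3) by blast
        have "act u (tup (e j)) \<in> K" if "j < n" "j \<noteq> i" for j
          using u(3) e i that by (auto simp: bij_betw_def inj_on_def)
        then show ?thesis using u by (intro bexI[of _ "\<lambda>i. act u (tup (e i))"]) (auto simp: Q_def)
      qed
      have "\<not> essential act Y K n" by (rule no) (use True n_def in simp)
      then obtain q where q: "q \<in> Q" "\<forall>j<n. q j \<in> K"
        using clQ QY drop unfolding essential_def by blast
      then obtain u where u: "u \<in> Sym" "ar u = 3" "\<forall>i<n. q i = act u (tup (e i))" by (auto simp: Q_def)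
      have "act u (tup p) \<in> K" if p: "p \<in> C" for p
      proof -
        obtain i where "i < n" "p = e i" using e p by (auto simp: bij_betw_def)
        then show ?thesis using u q by auto
      qed
      then show ?thesis using u by blast
    next
      case False
      have pr: "prj 3 i \<in> Sym \<and> ar (prj 3 i) = 3" if "i < 3" for i using prj that by blast
      have apr: "act (prj 3 i) (tup p) = tup p i" if "i < 3" "p \<in> I" for i p
        by (rule act_prj[OF Y(1) that(1)]) (rule tupY[OF that(2)])
      define bad where "bad p = {i. i < 3 \<and> tup p i \<notin> K}" for p
      have bad1: "card (bad p) \<le> 1" if p: "p \<in> I" for p
      proof -
        have "\<exists>j. bad p \<subseteq> {j}"
          using p by (auto simp: bad_def I_def tup_def numeral_3_eq_3 less_Suc_eq)
        then show ?thesis by (metis card.empty card_insert_le_m1 card_mono finite.emptyI finite_insert is_singletonI is_singleton_altdef le_numeral_extra(4))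
      qed
      have "card (\<Union>p\<in>C. bad p) \<le> (\<Sum>p\<in>C. card (bad p))"
        by (rule card_UN_le) (rule psubset(1))
      also have "\<dots> \<le> (\<Sum>p\<in>C. 1)" by (rule sum_mono) (use bad1 psubset(3) in auto)
      also have "\<dots> < 3" using False by simp
      finally have "card (\<Union>p\<in>C. bad p) < card {..<3::nat}" by simp
      moreover have "finite (\<Union>p\<in>C. bad p)" using psubset(1) by (auto simp: bad_def)
      ultimately have "\<not> {..<3::nat} \<subseteq> (\<Union>p\<in>C. bad p)" by (meson card_mono leD)
      then obtain i where i: "i < 3" "\<forall>p\<in>C. i \<notin> bad p" by auto
      then have "\<forall>p\<in>C. act (prj 3 i) (tup p) \<in> K"
        using apr psubset(3) by (auto simp: bad_def)
      then show ?thesis using pr[OF i(1)] by blast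
    qed
  qed
  from this[OF \<open>finite I\<close> subset_refl] obtain u where u: "u \<in> Sym" "ar u = 3" "\<forall>p\<in>I. act u (tup p) \<in> K"
    by blast
  have "ternary_absorbs act u K Y"
    unfolding ternary_absorbs_def
  proof (intro conjI ballI u)
    fix c c' x assume *: "c \<in> K" "c' \<in> K" "x \<in> Y"
    have "(c, c', x) \<in> I" "(c, x, c') \<in> I" "(x, c, c') \<in> I" using * K by (auto simp: I_def)
    then show "act u (vec3 c c' x) \<in> K" "act u (vec3 c x c') \<in> K" "act u (vec3 x c c') \<in> K"
      using u(3) by (force simp: tup_def)+
  qed
  then show ?thesis by blast
qed

end

section \<open>Clones without a homomorphism to the projections\<close>

locale taylor_clone = abstract_clone Sym ar cmp prj
  for Sym :: "'f set" and ar :: "'f \<Rightarrow> nat"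
    and cmp :: "nat \<Rightarrow> 'f \<Rightarrow> (nat \<Rightarrow> 'f) \<Rightarrow> 'f" and prj :: "nat \<Rightarrow> nat \<Rightarrow> 'f" +
  assumes no_proj_hom: "\<nexists>\<xi>. (\<forall>f\<in>Sym. \<xi> f < ar f) \<and> (\<forall>n i. i < n \<longrightarrow> \<xi> (prj n i) = i) \<and>
    (\<forall>f\<in>Sym. \<forall>m gs. (\<forall>k<ar f. gs k \<in> Sym \<and> ar (gs k) = m) \<longrightarrow> \<xi> (cmp m f gs) = \<xi> (gs (\<xi> f)))"
begin

text \<open>If every term had a position dominated by \<open>C\<close>, this position would be unique: with two of them, identifying the
  remaining variables would give a binary term by which \<open>C\<close> absorbs \<open>X\<close>. Sending a term to the projection at its dominated position
  would then be a homomorphism to the clone of projections.\<close>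

lemma expanding_one:
  assumes X: "algebra X act" and free: "binary_free X act"
    and C: "C \<subseteq> X" "C \<noteq> {}" "closed act C" "C \<noteq> X"
  shows "\<exists>t\<in>Sym. expands X act t C"
proof (rule ccontr)
  assume no: "\<not> ?thesis"
  define P where "P t i \<longleftrightarrow> i < ar t \<and> (\<forall>x. (\<forall>k<ar t. x k \<in> X) \<longrightarrow> x i \<in> C \<longrightarrow> act t x \<in> C)" for t i
  have ex: "\<exists>i. P t i" if "t \<in> Sym" for t
    using no that unfolding expands_def P_def by blast
  have uniq: "i = j" if t: "t \<in> Sym" and i: "P t i" and j: "P t j" for t i j
  proof (rule ccontr)
    assume ij: "i \<noteq> j"
    let ?gs = "\<lambda>k. prj 2 (if k = i then 0 else 1)"
    have gs: "\<And>k. k < ar t \<Longrightarrow> ?gs k \<in> Sym \<and> ar (?gs k) = 2"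
      by (intro prj) auto
    let ?s = "cmp 2 t ?gs"
    have s: "?s \<in> Sym" "ar ?s = 2" using cmp[OF t gs] by auto
    have eq: "act ?s (vec2 a b) = act t (\<lambda>k. if k = i then a else b)" if ab: "a \<in> X" "b \<in> X" for a b
    proof -
      have v: "\<And>k. k < 2 \<Longrightarrow> vec2 a b k \<in> X" using ab by (auto simp: vec2_def)
      have "act ?s (vec2 a b) = act t (\<lambda>k. act (?gs k) (vec2 a b))"
        by (rule act_cmp[OF X t gs v])
      also have "(\<lambda>k. act (?gs k) (vec2 a b)) = (\<lambda>k. if k = i then a else b)"
        by (rule ext) (auto simp: act_prj[OF X _ v])
      finally show ?thesis .
    qed
    have "binary_absorbs act ?s C X"
      unfolding binary_absorbs_def
      using s i j ij C(1) by (auto simp: eq subset_iff P_def)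
    then show False using free C unfolding binary_free_def by blast
  qed
  define \<xi> where "\<xi> t = (THE i. P t i)" for t
  have \<xi>: "\<xi> t = i" if "t \<in> Sym" "P t i" for t i
    unfolding \<xi>_def using that uniq by blast
  have P\<xi>: "P t (\<xi> t)" if "t \<in> Sym" for t
    using ex[OF that] \<xi>[OF that] by auto
  have "\<xi> (prj n i) = i" if "i < n" for n i
    using prj[OF that] that by (intro \<xi>) (auto simp: P_def act_prj[OF X])
  moreover have "\<xi> (cmp m f gs) = \<xi> (gs (\<xi> f))"
    if f: "f \<in> Sym" and gs: "\<forall>k<ar f. gs k \<in> Sym \<and> ar (gs k) = m" for f m gs
  proof (rule \<xi>)
    show "cmp m f gs \<in> Sym" using cmp[OF f] gs by auto
    have lt: "\<xi> f < ar f" using P\<xi>[OF f] by (simp add: P_def)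
    have g: "gs (\<xi> f) \<in> Sym" "ar (gs (\<xi> f)) = m" using gs lt by auto
    have arc: "ar (cmp m f gs) = m" using cmp[OF f] gs by auto
    show "P (cmp m f gs) (\<xi> (gs (\<xi> f)))"
      unfolding P_def arc
    proof (intro conjI allI impI)
      show "\<xi> (gs (\<xi> f)) < m" using P\<xi>[OF g(1)] g(2) by (simp add: P_def)
      fix x assume x: "\<forall>k<m. x k \<in> X" "x (\<xi> (gs (\<xi> f))) \<in> C"
      have "act (gs (\<xi> f)) x \<in> C" using P\<xi>[OF g(1)] g(2) x by (simp add: P_def)
      moreover have "\<forall>k<ar f. act (gs k) x \<in> X"
        using gs x closedD[OF algebra_closed[OF X]] by auto
      ultimately have "act f (\<lambda>k. act (gs k) x) \<in> C"
        using P\<xi>[OF f] by (simp add: P_def)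
      then show "act (cmp m f gs) x \<in> C"
        by (subst act_cmp[OF X f]) (use gs x in auto)
    qed
  qed
  moreover have "\<xi> f < ar f" if "f \<in> Sym" for f using P\<xi>[OF that] by (simp add: P_def)
  ultimately have "(\<forall>f\<in>Sym. \<xi> f < ar f) \<and> (\<forall>n i. i < n \<longrightarrow> \<xi> (prj n i) = i) \<and>
    (\<forall>f\<in>Sym. \<forall>m gs. (\<forall>k<ar f. gs k \<in> Sym \<and> ar (gs k) = m) \<longrightarrow> \<xi> (cmp m f gs) = \<xi> (gs (\<xi> f)))"
    by simp
  then show False using no_proj_hom by (elim notE) (rule exI)
qed

lemma expanding_all:
  assumes X: "algebra X act" "finite X" and free: "binary_free X act"
  shows "\<exists>t\<in>Sym. \<forall>C. C \<subseteq> X \<and> C \<noteq> {} \<and> closed act C \<and> C \<noteq> X \<longrightarrow> expands X act t C"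
proof -
  let ?F = "{C. C \<subseteq> X \<and> C \<noteq> {} \<and> closed act C \<and> C \<noteq> X}"
  have fin: "finite ?F" by (rule finite_subset[of _ "Pow X"]) (use X(2) in auto)
  have "\<exists>t\<in>Sym. \<forall>C\<in>G. expands X act t C" if "finite G" "G \<subseteq> ?F" for G
    using that
  proof (induction G)
    case empty
    then show ?case using prj[of 0 1] by auto
  next
    case (insert C G)
    obtain t where t: "t \<in> Sym" "\<forall>C\<in>G. expands X act t C" using insert by auto
    obtain s where s: "s \<in> Sym" "expands X act s C"
      using expanding_one[OF X(1) free, of C] insert by auto
    have "\<forall>C\<in>insert C G. expands X act (star t s) C"
      using expands_star1[OF X(1) t(1) s(1)] expands_star2[OF X(1) t(1) s(1)] s t by auto
    then show ?case using star_Sym(1)[OF t(1) s(1)] by blast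
  qed
  from this[OF fin] show ?thesis by auto
qed

section \<open>Centers absorb\<close>

context
  fixes X :: "'x set" and act :: "'f \<Rightarrow> (nat \<Rightarrow> 'x) \<Rightarrow> 'x"
    and Y :: "'y set" and act' :: "'f \<Rightarrow> (nat \<Rightarrow> 'y) \<Rightarrow> 'y"
    and S :: "('y \<times> 'x) set" and N :: "'y \<Rightarrow> 'x set" and K :: "'y set"
  assumes X: "algebra X act" "finite X" "binary_free X act"
    and Y: "algebra Y act'"
    and S: "S \<subseteq> Y \<times> X" "closed (pair_act act' act) S" "\<And>y. y \<in> Y \<Longrightarrow> \<exists>x. (y, x) \<in> S"
  defines N_def: "N \<equiv> \<lambda>y. {x. (y, x) \<in> S}"
    and K_def: "K \<equiv> {y \<in> Y. \<forall>x\<in>X. (y, x) \<in> S}"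
begin

lemma neighbours_subset: "N y \<subseteq> X" using S(1) by (auto simp: N_def)

lemma neighbours_closed: "y \<in> Y \<Longrightarrow> closed act (N y)"
  unfolding N_def
proof (rule closedI)
  fix f and x :: "nat \<Rightarrow> 'x" assume y: "y \<in> Y" and f: "f \<in> Sym" and x: "\<And>k. k < ar f \<Longrightarrow> x k \<in> {x. (y, x) \<in> S}"
  have "(act' f (\<lambda>_. y), act f x) \<in> S" by (rule closed_pairD[OF S(2) f]) (use x in auto)
  then show "act f x \<in> {x. (y, x) \<in> S}" using act_idem[OF Y f y] by simp
qed

lemma neighbours_nonempty: "y \<in> Y \<Longrightarrow> N y \<noteq> {}" using S(3) by (auto simp: N_def)

lemma neighbours_act:
  assumes "f \<in> Sym" "\<And>k. k < ar f \<Longrightarrow> x k \<in> N (y k)"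
  shows "act f x \<in> N (act' f y)"
  using closed_pairD[OF S(2) assms(1), of y x] assms(2) by (auto simp: N_def)

lemma center_iff: "y \<in> Y \<Longrightarrow> y \<in> K \<longleftrightarrow> N y = X"
  using S(1) by (auto simp: K_def N_def)

lemma center_subset: "K \<subseteq> Y" by (auto simp: K_def)

lemma center_closed: "closed act' K"
proof (rule closedI)
  fix f and y :: "nat \<Rightarrow> 'y" assume f: "f \<in> Sym" and y: "\<And>k. k < ar f \<Longrightarrow> y k \<in> K"
  have yY: "act' f y \<in> Y" using closedD[OF algebra_closed[OF Y] f] y center_subset by blast
  have "(act' f y, x) \<in> S" if x: "x \<in> X" for x
    using closed_pairD[OF S(2) f, of y "\<lambda>_. x"] y x act_idem[OF X(1) f x] by (auto simp: K_def)
  then show "act' f y \<in> K" using yY by (auto simp: K_def)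
qed

text \<open>Put \<open>y\<close> at one position of an expanding term and elements of the center elsewhere. As all elements of \<open>X\<close> are neighbours of the
  center, the neighbourhood of the value contains that of \<open>y\<close> and, by expansion, more. Nesting the
  term \<open>|X|\<close> times exhausts \<open>X\<close>.\<close>

lemma center_near_absorbs: "\<exists>s. near_absorbs act' s K Y"
proof -
  obtain t where t: "t \<in> Sym" and ex: "\<And>C. C \<subseteq> X \<Longrightarrow> C \<noteq> {} \<Longrightarrow> closed act C \<Longrightarrow> C \<noteq> X \<Longrightarrow> expands X act t C"
    using expanding_all[OF X] by blast
  have fN: "finite (N y)" for y using neighbours_subset X(2) finite_subset by blast
  have "\<exists>s\<in>Sym. \<forall>i<ar s. \<forall>y. (\<forall>k<ar s. k \<noteq> i \<longrightarrow> y k \<in> K) \<longrightarrow> y i \<in> Y \<longrightarrow>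
      act' s y \<in> K \<or> card (N (act' s y)) > n" for n
  proof (induction n)
    case 0
    have "prj 1 0 \<in> Sym" "ar (prj 1 0) = 1" using prj by auto
    moreover have "act' (prj 1 0) y = y 0" if "y 0 \<in> Y" for y using act_prj[OF Y, of 0 1 y] that by simp
    moreover have "card (N y) > 0" if "y \<in> Y" for y using neighbours_nonempty[OF that] fN by (simp add: card_gt_0_iff)
    ultimately show ?case by (intro bexI[of _ "prj 1 0"]) auto
  next
    case (Suc n)
    then obtain s where s: "s \<in> Sym" and IH: "\<And>i y. i < ar s \<Longrightarrow> (\<And>k. k < ar s \<Longrightarrow> k \<noteq> i \<Longrightarrow> y k \<in> K) \<Longrightarrow> y i \<in> Y \<Longrightarrow>
      act' s y \<in> K \<or> card (N (act' s y)) > n" by blast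
    have "act' (star t s) y \<in> K \<or> card (N (act' (star t s) y)) > Suc n"
      if i: "i < ar t * ar s" and y: "\<And>k. k < ar t * ar s \<Longrightarrow> k \<noteq> i \<Longrightarrow> y k \<in> K" and yi: "y i \<in> Y" for i y
    proof -
      define k0 where "k0 = i div ar s"
      define j0 where "j0 = i mod ar s"
      have k0: "k0 < ar t" using i by (simp add: k0_def less_mult_imp_div_less)
      have j0: "j0 < ar s" using ar_pos[OF s] by (simp add: j0_def)
      have ii: "i = k0 * ar s + j0" by (simp add: k0_def j0_def)
      define z where "z k = act' s (\<lambda>j. y (k * ar s + j))" for k
      have eq: "act' (star t s) y = act' t z"
        unfolding z_def by (rule act_star[OF Y t s]) (use y yi center_subset in blast)
      have zK: "z k \<in> K" if k: "k < ar t" "k \<noteq> k0" for k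
        unfolding z_def
      proof (rule closedD[OF center_closed s], rule y)
        fix j assume "j < ar s"
        then show "k * ar s + j < ar t * ar s" "k * ar s + j \<noteq> i"
          using block_less[OF k(1)] k(2) by (auto simp: k0_def)
      qed
      have z0: "z k0 \<in> K \<or> card (N (z k0)) > n"
        unfolding z_def
        by (rule IH[OF j0]) (use y yi ii block_less[OF k0] in auto)
      have z0Y: "z k0 \<in> Y"
        unfolding z_def using y yi center_subset block_less[OF k0]
        by (intro closedD[OF algebra_closed[OF Y] s]) blast
      show ?thesis
      proof (cases "z k0 \<in> K")
        case True
        have "act' t z \<in> K" by (rule closedD[OF center_closed t]) (use True zK in blast)
        then show ?thesis by (simp add: eq)
      next
        case False
        then have "N (z k0) \<noteq> X" using center_iff[OF z0Y] by simp
        then have "expands X act t (N (z k0))" using ex[OF neighbours_subset neighbours_nonempty[OF z0Y] neighbours_closed[OF z0Y]] by simp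
        then obtain x where x: "\<forall>k<ar t. x k \<in> X" "x k0 \<in> N (z k0)" "act t x \<notin> N (z k0)"
          using k0 by (auto simp: expands_def)
        have NzX: "N (z k) = X" if "k < ar t" "k \<noteq> k0" for k
          using zK[OF that] center_iff center_subset by blast
        have "act t x \<in> N (act' t z)"
          by (rule neighbours_act[OF t]) (use x NzX in blast)
        moreover have "N (z k0) \<subseteq> N (act' t z)"
        proof
          fix e assume e: "e \<in> N (z k0)"
          have "act t (\<lambda>_. e) \<in> N (act' t z)" by (rule neighbours_act[OF t]) (use e NzX neighbours_subset in blast)
          then show "e \<in> N (act' t z)" using act_idem[OF X(1) t subsetD[OF neighbours_subset e]] by simp
        qed
        ultimately have "N (z k0) \<subset> N (act' t z)" using x(3) by blast
        then have "card (N (z k0)) < card (N (act' t z))" by (rule psubset_card_mono[OF fN])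
        then show ?thesis using z0 False by (simp add: eq)
      qed
    qed
    then show ?case using star_Sym[OF t s] by (intro bexI[of _ "star t s"]) auto
  qed
  from this[of "card X"] obtain s where s: "s \<in> Sym" "\<forall>i<ar s. \<forall>y. (\<forall>k<ar s. k \<noteq> i \<longrightarrow> y k \<in> K) \<longrightarrow> y i \<in> Y \<longrightarrow>
      act' s y \<in> K \<or> card (N (act' s y)) > card X" by blast
  have "\<not> card (N y) > card X" for y using card_mono[OF X(2) neighbours_subset] by (simp add: not_less)
  then have "near_absorbs act' s K Y" using s unfolding near_absorbs_def by blast
  then show ?thesis by blast
qed

text \<open>Two copies of an essential relation are glued along their first coordinates. Joining them by equality
  would not do, since the common value could be the same element \<open>a\<close> outside the center. The relation \<open>T\<close> used instead connects
  \<open>a\<close> with every element of the center, but it relates no two possible first entries \<open>z, z'\<close> of tuples that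
  are otherwise in the center: for \<open>a\<close> chosen among these entries with a largest neighbourhood, \<open>(z, z') \<in> T\<close> would provide a binary term by which
  the neighbourhood of \<open>a\<close> absorbs \<open>X\<close>.\<close>

lemma essential_grows:
  assumes n: "n \<ge> 3" and ess: "essential act' Y K n"
  shows "essential act' Y K (2 * (n - 1))"
proof -
  obtain Q where Q: "closed (power_act act') Q" "\<forall>q\<in>Q. \<forall>i<n. q i \<in> Y"
      "\<forall>i<n. \<exists>q\<in>Q. \<forall>j<n. j \<noteq> i \<longrightarrow> q j \<in> K" "\<not> (\<exists>q\<in>Q. \<forall>j<n. q j \<in> K)"
    using ess by (auto simp: essential_def)
  define Q1 where "Q1 = {q 0 |q. q \<in> Q \<and> (\<forall>j<n. j \<noteq> 0 \<longrightarrow> q j \<in> K)}"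
  have Q1Y: "Q1 \<subseteq> Y" using Q(2) n by (auto simp: Q1_def)
  have Q1K: "y \<notin> K" if y: "y \<in> Q1" for y
  proof
    assume "y \<in> K"
    moreover obtain q where q: "q \<in> Q" "y = q 0" "\<forall>j<n. j \<noteq> 0 \<longrightarrow> q j \<in> K"
      using y unfolding Q1_def by blast
    ultimately have "\<forall>j<n. q j \<in> K" by metis
    then show False using Q(4) q(1) by blast
  qed
  have "Q1 \<noteq> {}" using Q(3) n by (force simp: Q1_def)
  have "\<exists>a\<in>Q1. \<forall>z\<in>Q1. card (N z) \<le> card (N a)"
  proof -
    obtain a0 where "a0 \<in> Q1" using \<open>Q1 \<noteq> {}\<close> by auto
    moreover have "card (N y) \<le> card X" for y by (rule card_mono[OF X(2) neighbours_subset])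
    ultimately have "\<exists>a. a \<in> Q1 \<and> (\<forall>z. z \<in> Q1 \<longrightarrow> card (N z) \<le> card (N a))"
      by (intro Lattices_Big.ex_has_greatest_nat[of _ a0 _ "Suc (card X)"]) (auto simp: less_Suc_eq_le)
    then show ?thesis by blast
  qed
  then obtain a where a: "a \<in> Q1" and amax: "\<And>z. z \<in> Q1 \<Longrightarrow> card (N z) \<le> card (N a)" by blast
  have aY: "a \<in> Y" using a Q1Y by auto
  \<comment> \<open>The relation is invariant: the witnessing binary terms can be composed.\<close>
  define T where "T = {(y, y'). y \<in> Y \<and> y' \<in> Y \<and> (\<exists>s\<in>Sym. ar s = 2 \<and>
    (\<forall>x\<in>N a. \<forall>x'\<in>X. act s (vec2 x x') \<in> N y \<and> act s (vec2 x' x) \<in> N y'))}"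
  have TI: "(y, y') \<in> T" if "y \<in> Y" "y' \<in> Y" "s \<in> Sym \<and> ar s = 2"
    "\<And>x x'. x \<in> N a \<Longrightarrow> x' \<in> X \<Longrightarrow> act s (vec2 x x') \<in> N y \<and> act s (vec2 x' x) \<in> N y'" for y y' s
    using that unfolding T_def by blast
  have clT: "closed (pair_act act' act') T"
  proof (rule closed_pairI)
    fix f and y y' :: "nat \<Rightarrow> 'y" assume f: "f \<in> Sym" and yy: "\<And>k. k < ar f \<Longrightarrow> (y k, y' k) \<in> T"
    then obtain s where s: "\<And>k. k < ar f \<Longrightarrow> s k \<in> Sym \<and> ar (s k) = 2"
      "\<And>k x x'. k < ar f \<Longrightarrow> x \<in> N a \<Longrightarrow> x' \<in> X \<Longrightarrow> act (s k) (vec2 x x') \<in> N (y k) \<and> act (s k) (vec2 x' x) \<in> N (y' k)"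
      unfolding T_def mem_Collect_eq case_prod_conv by metis
    have eq: "act (cmp 2 f s) (vec2 u v) = act f (\<lambda>k. act (s k) (vec2 u v))" if "u \<in> X" "v \<in> X" for u v
      by (rule act_cmp[OF X(1) f s(1)]) (use that in \<open>auto simp: vec2_def\<close>)
    have "act (cmp 2 f s) (vec2 x x') \<in> N (act' f y) \<and> act (cmp 2 f s) (vec2 x' x) \<in> N (act' f y')"
      if x: "x \<in> N a" "x' \<in> X" for x x'
    proof -
      have "x \<in> X" using x neighbours_subset by blast
      show ?thesis unfolding eq[OF \<open>x \<in> X\<close> x(2)] eq[OF x(2) \<open>x \<in> X\<close>]
        by (intro conjI neighbours_act[OF f]) (use s(2) x in blast)+
    qed
    moreover have "act' f y \<in> Y" "act' f y' \<in> Y"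
      using yy closedD[OF algebra_closed[OF Y] f] by (auto simp: T_def)
    ultimately show "(act' f y, act' f y') \<in> T"
      using cmp[OF f, of s 2, OF s(1)] by (intro TI[of _ _ "cmp 2 f s"]) auto
  qed
  have NK: "N k = X" if "k \<in> K" for k using that center_iff center_subset by blast
  have pr2: "act (prj 2 i) (vec2 u v) = vec2 u v i" if "i < 2" "u \<in> X" "v \<in> X" for i u v
    by (rule act_prj[OF X(1) that(1)]) (use that in \<open>auto simp: vec2_def\<close>)
  have T_a_center: "(a, k) \<in> T" if k: "k \<in> K" for k
  proof -
    have "act (prj 2 0) (vec2 x x') \<in> N a \<and> act (prj 2 0) (vec2 x' x) \<in> N k"
      if "x \<in> N a" "x' \<in> X" for x x'
      using that subsetD[OF neighbours_subset, of x a] by (simp add: pr2 NK[OF k])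
    then show ?thesis using prj[of 0 2] aY k center_subset by (intro TI[of _ _ "prj 2 0"]) auto
  qed
  have T_center_a: "(k, a) \<in> T" if k: "k \<in> K" for k
  proof -
    have "act (prj 2 1) (vec2 x x') \<in> N k \<and> act (prj 2 1) (vec2 x' x) \<in> N a"
      if "x \<in> N a" "x' \<in> X" for x x'
      using that subsetD[OF neighbours_subset, of x a] by (simp add: pr2 NK[OF k])
    then show ?thesis using prj[of 1 2] aY k center_subset by (intro TI[of _ _ "prj 2 1"]) auto
  qed
  have TQ: False if z: "z \<in> Q1" "z' \<in> Q1" "(z, z') \<in> T" for z z'
  proof -
    obtain s where s: "s \<in> Sym" "ar s = 2"
      "\<And>x x'. x \<in> N a \<Longrightarrow> x' \<in> X \<Longrightarrow> act s (vec2 x x') \<in> N z \<and> act s (vec2 x' x) \<in> N z'"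
      using z(3) by (auto simp: T_def)
    have ss: "act s (vec2 x x) = x" if "x \<in> X" for x
      by (rule act_const[OF X(1) s(1) that]) (auto simp: vec2_def)
    have "N a \<subseteq> N z" "N a \<subseteq> N z'" using s(3) ss neighbours_subset by (metis subset_iff)+
    then have "N z = N a" "N z' = N a"
      using amax[OF z(1)] amax[OF z(2)] card_seteq[of "N z" "N a"] card_seteq[of "N z'" "N a"]
        finite_subset[OF neighbours_subset X(2)] by metis+
    then have "binary_absorbs act s (N a) X" using s by (auto simp: binary_absorbs_def)
    then have "N a = X" using X(3) neighbours_subset neighbours_nonempty[OF aY] neighbours_closed[OF aY] unfolding binary_free_def by blast
    then show False using center_iff[OF aY] Q1K[OF a] by blast
  qed
  define W where "W = {w. \<exists>q\<in>Q. \<exists>q'\<in>Q. (q 0, q' 0) \<in> T \<and> (\<forall>i<n-1. w i = q (Suc i)) \<and> (\<forall>i<n-1. w (n - 1 + i) = q' (Suc i))}"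
  have split: "(\<forall>j<2 * (n - 1). P j) \<longleftrightarrow> (\<forall>i<n-1. P i) \<and> (\<forall>i<n-1. P (n - 1 + i))" for P
  proof
    assume *: "(\<forall>i<n-1. P i) \<and> (\<forall>i<n-1. P (n - 1 + i))"
    show "\<forall>j<2 * (n - 1). P j"
    proof (intro allI impI)
      fix j assume j: "j < 2 * (n - 1)"
      show "P j"
      proof (cases "j < n - 1")
        case False
        then show ?thesis using *[THEN conjunct2, rule_format, of "j - (n - 1)"] j by simp
      qed (use * in auto)
    qed
  qed auto
  have all_Suc: "(\<forall>j<n. j \<noteq> 0 \<longrightarrow> P j) \<longleftrightarrow> (\<forall>i<n-1. P (Suc i))" for P
  proof (intro iffI allI impI)
    fix j assume "\<forall>i<n-1. P (Suc i)" "j < n" "j \<noteq> 0"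
    then show "P j" by (cases j) auto
  qed auto
  have "closed (power_act act') W"
  proof (rule closedI)
    fix f and w :: "nat \<Rightarrow> nat \<Rightarrow> 'y" assume f: "f \<in> Sym" and w: "\<And>k. k < ar f \<Longrightarrow> w k \<in> W"
    have "\<forall>k. \<exists>q q'. k < ar f \<longrightarrow> q \<in> Q \<and> q' \<in> Q \<and> (q 0, q' 0) \<in> T \<and>
       (\<forall>i<n-1. w k i = q (Suc i)) \<and> (\<forall>i<n-1. w k (n - 1 + i) = q' (Suc i))"
      using w unfolding W_def by blast
    then obtain q q' where q: "\<And>k. k < ar f \<Longrightarrow> q k \<in> Q \<and> q' k \<in> Q \<and> (q k 0, q' k 0) \<in> T \<and>
       (\<forall>i<n-1. w k i = q k (Suc i)) \<and> (\<forall>i<n-1. w k (n - 1 + i) = q' k (Suc i))"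
      by metis
    have "power_act act' f q \<in> Q" "power_act act' f q' \<in> Q" using closedD[OF Q(1) f] q by blast+
    moreover have "(power_act act' f q 0, power_act act' f q' 0) \<in> T"
      unfolding power_act_def by (rule closed_pairD[OF clT f]) (use q in blast)
    moreover have "\<forall>i<n-1. power_act act' f w i = power_act act' f q (Suc i)"
      "\<forall>i<n-1. power_act act' f w (n - 1 + i) = power_act act' f q' (Suc i)"
      unfolding power_act_def by (intro allI impI act_cong[OF Y f]; use q in simp)+
    ultimately show "power_act act' f w \<in> W" unfolding W_def by blast
  qed
  moreover have "\<forall>w\<in>W. \<forall>i<2 * (n - 1). w i \<in> Y"
    unfolding split using Q(2) by (auto simp: W_def)
  moreover have "\<exists>w\<in>W. \<forall>j<2 * (n - 1). j \<noteq> i \<longrightarrow> w j \<in> K" if i: "i < 2 * (n - 1)" for i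
  proof -
    obtain qa where qa: "qa \<in> Q" "qa 0 = a" "\<forall>i<n-1. qa (Suc i) \<in> K"
      using a unfolding Q1_def all_Suc by blast
    define glue where "glue q q' j = (if j < n - 1 then q (Suc j) else q' (Suc (j - (n - 1))))"
      for q q' :: "nat \<Rightarrow> 'y" and j
    have glue: "glue q q' \<in> W" if "q \<in> Q" "q' \<in> Q" "(q 0, q' 0) \<in> T" for q q'
      using that unfolding W_def by (auto simp: glue_def)
    show ?thesis
    proof (cases "i < n - 1")
      case True
      then have "Suc i < n" by linarith
      then obtain q where q: "q \<in> Q" "\<forall>j<n. j \<noteq> Suc i \<longrightarrow> q j \<in> K" using Q(3) by blast
      then have "q 0 \<in> K" using n by auto
      then have "glue q qa \<in> W" using glue q(1) qa T_center_a by auto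
      moreover have "\<forall>j<2 * (n - 1). j \<noteq> i \<longrightarrow> glue q qa j \<in> K"
        unfolding split using q(2) qa(3) by (auto simp: glue_def)
      ultimately show ?thesis by blast
    next
      case False
      then obtain i' where i': "i = n - 1 + i'" "i' < n - 1" using i by (metis add_less_cancel_left le_Suc_ex mult_2 not_less)
      then have "Suc i' < n" by linarith
      then obtain q where q: "q \<in> Q" "\<forall>j<n. j \<noteq> Suc i' \<longrightarrow> q j \<in> K" using Q(3) by blast
      then have "q 0 \<in> K" using n by auto
      then have "glue qa q \<in> W" using glue q(1) qa T_a_center by auto
      moreover have "\<forall>j<2 * (n - 1). j \<noteq> i \<longrightarrow> glue qa q j \<in> K"
        unfolding split using q(2) qa(3) i' by (auto simp: glue_def)
      ultimately show ?thesis by blast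
    qed
  qed
  moreover have "\<not> (\<exists>w\<in>W. \<forall>j<2 * (n - 1). w j \<in> K)"
  proof
    assume "\<exists>w\<in>W. \<forall>j<2 * (n - 1). w j \<in> K"
    then obtain w q q' where "q \<in> Q" "q' \<in> Q" "(q 0, q' 0) \<in> T" and
      "\<forall>i<n-1. w i = q (Suc i)" "\<forall>i<n-1. w (n - 1 + i) = q' (Suc i)"
      "\<forall>i<n-1. w i \<in> K" "\<forall>i<n-1. w (n - 1 + i) \<in> K"
      unfolding split W_def by blast
    then have "q 0 \<in> Q1" "q' 0 \<in> Q1" unfolding Q1_def all_Suc by auto
    then show False using TQ \<open>(q 0, q' 0) \<in> T\<close> by blast
  qed
  ultimately show ?thesis unfolding essential_def by blast
qed

text \<open>An essential relation of arity at least \<open>3\<close> would produce ones of arbitrarily large arity, against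
  \<open>essential_bound\<close>.\<close>

lemma center_ternary_absorbs:
  assumes "finite Y"
  shows "\<exists>t. ternary_absorbs act' t K Y"
proof (rule ternary_absorbs_if_not_essential[OF Y assms center_subset])
  fix n :: nat assume n: "n \<ge> 3"
  obtain s where s: "near_absorbs act' s K Y" using center_near_absorbs by blast
  show "\<not> essential act' Y K n"
  proof
    assume "essential act' Y K n"
    then have "\<exists>n'\<ge>3 + i. essential act' Y K n'" for i
    proof (induction i)
      case 0
      then show ?case using n by auto
    next
      case (Suc i)
      then obtain n' where n': "n' \<ge> 3 + i" "essential act' Y K n'" by blast
      then have "essential act' Y K (2 * (n' - 1))" using essential_grows by simp
      moreover have "2 * (n' - 1) \<ge> 3 + Suc i" using n'(1) by linarith
      ultimately show ?case by blast
    qed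
    from this[of "ar s"] obtain n' where "n' \<ge> 3 + ar s" "essential act' Y K n'" by blast
    then show False using essential_bound[OF s center_closed, of n'] by simp
  qed
qed

end

section \<open>Linked relations over absorption-free algebras\<close>

text \<open>The induction is on the number of elements that need a common neighbour. For \<open>F = G \<union> {u, v}\<close>, let \<open>T\<close> relate \<open>a\<close> and \<open>b\<close>
  if \<open>G \<union> {a, b}\<close> has a common neighbour. If all sets smaller than \<open>F\<close> have one, then \<open>G\<close> lies in the
  center of \<open>T\<close>. The center is ternary absorbing, hence all of \<open>X\<close>, and \<open>(u, v) \<in> T\<close>.\<close>

lemma common_neighbour:
  assumes X: "algebra X act" "finite X" "ternary_free X act" and Y: "algebra Y act'"
    and E: "E \<subseteq> Y \<times> X" "closed (pair_act act' act) E"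
    and pairs: "\<And>u v. u \<in> X \<Longrightarrow> v \<in> X \<Longrightarrow> \<exists>y. (y, u) \<in> E \<and> (y, v) \<in> E"
    and ne: "X \<noteq> {}"
  shows "\<exists>y\<in>Y. \<forall>x\<in>X. (y, x) \<in> E"
proof -
  have "\<forall>F. F \<subseteq> X \<and> F \<noteq> {} \<and> card F \<le> n + 2 \<longrightarrow> (\<exists>y. \<forall>x\<in>F. (y, x) \<in> E)" for n
  proof (induction n)
    case 0
    show ?case
    proof (intro allI impI, elim conjE)
      fix F assume F: "F \<subseteq> X" "F \<noteq> {}" "card F \<le> 0 + 2"
      have fin: "finite F" using F X(2) finite_subset by blast
      obtain u where u: "u \<in> F" using F by auto
      show "\<exists>y. \<forall>x\<in>F. (y, x) \<in> E"
      proof (cases "F - {u} = {}")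
        case True
        then show ?thesis using pairs[of u u] u F(1) by blast
      next
        case False
        then obtain v where v: "v \<in> F" "v \<noteq> u" by blast
        then have "{u, v} = F" using u F(3) by (intro card_seteq[OF fin]) auto
        then show ?thesis using pairs[of u v] F(1) by blast
      qed
    qed
  next
    case (Suc n)
    show ?case
    proof (intro allI impI, elim conjE)
      fix F assume F: "F \<subseteq> X" "F \<noteq> {}" "card F \<le> Suc n + 2"
      have fin: "finite F" using F X(2) finite_subset by blast
      show "\<exists>y. \<forall>x\<in>F. (y, x) \<in> E"
      proof (cases "card F \<le> n + 2")
        case True
        then show ?thesis using Suc[THEN spec[of _ F]] F(1,2) by simp
      next
        case False
        then have cF: "card F = n + 3" using F(3) by simp
        obtain u where u: "u \<in> F" using F by auto
        have cFu: "card (F - {u}) = n + 2" using cF u fin by simp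
        then have "F - {u} \<noteq> {}" by (metis card.empty add_is_0 zero_neq_numeral)
        then obtain v where v: "v \<in> F - {u}" by blast
        define G where "G = F - {u} - {v}"
        have cG: "card G = n + 1" using cFu v fin unfolding G_def by (subst card_Diff_singleton) auto
        have "G \<noteq> {}" using cG by (metis card.empty add_is_0 zero_neq_one)
        then have G: "G \<subseteq> X" "finite G" "G \<noteq> {}" using F(1) fin by (auto simp: G_def)
        have IH: "\<exists>y. (y, q) \<in> E \<and> (\<forall>g\<in>G. (y, g) \<in> E)" if "q \<in> X" for q
        proof -
          have "card (insert q G) \<le> n + 2" using card_insert_le_m1[of "n + 2" G q] cG by simp
          then have "\<exists>y. \<forall>x\<in>insert q G. (y, x) \<in> E"
            using Suc[THEN spec[of _ "insert q G"]] that G(1) by simp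
          then show ?thesis by auto
        qed
        define T where "T = {(a, b). a \<in> X \<and> b \<in> X \<and> (\<exists>y. (y, a) \<in> E \<and> (y, b) \<in> E \<and> (\<forall>g\<in>G. (y, g) \<in> E))}"
        have clT: "closed (pair_act act act) T"
        proof (rule closed_pairI)
          fix f and a b :: "nat \<Rightarrow> 'a" assume f: "f \<in> Sym" and ab: "\<And>k. k < ar f \<Longrightarrow> (a k, b k) \<in> T"
          then have "\<forall>k. \<exists>y. k < ar f \<longrightarrow> (y, a k) \<in> E \<and> (y, b k) \<in> E \<and> (\<forall>g\<in>G. (y, g) \<in> E)"
            unfolding T_def by blast
          then obtain y where y: "\<And>k. k < ar f \<Longrightarrow> (y k, a k) \<in> E \<and> (y k, b k) \<in> E \<and> (\<forall>g\<in>G. (y k, g) \<in> E)"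
            by metis
          have "(act' f y, act f a) \<in> E" "(act' f y, act f b) \<in> E"
            using y by (auto intro: closed_pairD[OF E(2) f])
          moreover have "(act' f y, g) \<in> E" if g: "g \<in> G" for g
          proof -
            have "(act' f y, act f (\<lambda>_. g)) \<in> E" using y g by (auto intro: closed_pairD[OF E(2) f])
            then show ?thesis using act_idem[OF X(1) f] G(1) g by auto
          qed
          moreover have "act f a \<in> X" "act f b \<in> X"
            using ab by (auto simp: T_def intro: closedD[OF algebra_closed[OF X(1)] f])
          ultimately show "(act f a, act f b) \<in> T" unfolding T_def by blast
        qed
        have TX: "T \<subseteq> X \<times> X" by (auto simp: T_def)
        have Tsd: "\<exists>b. (a, b) \<in> T" if "a \<in> X" for a using IH[OF that] that by (auto simp: T_def)
        let ?C = "{a \<in> X. \<forall>b\<in>X. (a, b) \<in> T}"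
        have bf: "binary_free X act" by (rule ternary_free_imp_binary_free[OF X(1,3)])
        have "\<exists>t. ternary_absorbs act t ?C X"
          by (rule center_ternary_absorbs[OF X(1,2) bf X(1) TX clT Tsd X(2)])
        moreover have "closed act ?C"
          by (rule center_closed[OF X(1,2) bf X(1) TX clT Tsd])
        moreover have "G \<subseteq> ?C"
        proof
          fix g assume "g \<in> G"
          moreover have "(g, b) \<in> T" if "b \<in> X" for b
            using IH[OF that] \<open>g \<in> G\<close> G(1) that unfolding T_def by blast
          ultimately show "g \<in> ?C" using G(1) by blast
        qed
        moreover have "?C \<subseteq> X" "?C \<noteq> {}" using \<open>G \<subseteq> ?C\<close> G(3) by auto
        ultimately have "?C = X" using ternary_freeD[OF X(3)] by blast
        then have "u \<in> ?C" using u F(1) by auto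
        then have "(u, v) \<in> T" using v F(1) by blast
        then obtain y where "(y, u) \<in> E" "(y, v) \<in> E" "\<forall>g\<in>G. (y, g) \<in> E" by (auto simp: T_def)
        moreover have "F \<subseteq> insert u (insert v G)" by (auto simp: G_def)
        ultimately show ?thesis by blast
      qed
    qed
  qed
  from this[of "card X", THEN spec[of _ X]] have "\<exists>y. \<forall>x\<in>X. (y, x) \<in> E" using ne by simp
  then show ?thesis using E(1) ne by blast
qed

text \<open>If two elements of \<open>X\<close> have no common neighbour in \<open>Y\<close>, a maximal proper symmetric invariant relation \<open>S\<close> containing \<open>E\<inverse> O E\<close> has \<open>S O S = X \<times> X\<close>
  by linkedness. By \<open>common_neighbour\<close> it has a nonempty center, which must be all of \<open>X\<close>, so \<open>S\<close> is not proper. Hence any two elements have a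
  common neighbour, and \<open>common_neighbour\<close> applies to \<open>E\<close> itself.\<close>

lemma linked_center:
  assumes X: "algebra X act" "finite X" "ternary_free X act" "X \<noteq> {}"
    and Y: "algebra Y act'" "finite Y"
    and E: "E \<subseteq> Y \<times> X" "closed (pair_act act' act) E"
    and sdY: "\<And>y. y \<in> Y \<Longrightarrow> \<exists>x. (y, x) \<in> E" and sdX: "\<And>x. x \<in> X \<Longrightarrow> \<exists>y. (y, x) \<in> E"
    and linked: "(E\<inverse> O E)\<^sup>+ = X \<times> X"
  defines "K \<equiv> {y \<in> Y. \<forall>x\<in>X. (y, x) \<in> E}"
  shows "K \<noteq> {} \<and> closed act' K \<and> (\<exists>t. ternary_absorbs act' t K Y)"
proof -
  let ?T = "E\<inverse> O E"
  have bf: "binary_free X act" by (rule ternary_free_imp_binary_free[OF X(1,3)])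
  have T: "?T = X \<times> X"
  proof (rule ccontr)
    assume nT: "?T \<noteq> X \<times> X"
    define \<S> where "\<S> = {S. S \<subseteq> X \<times> X \<and> ?T \<subseteq> S \<and> sym S \<and> closed (pair_act act act) S \<and> S \<noteq> X \<times> X}"
    have "finite \<S>" by (rule finite_subset[of _ "Pow (X \<times> X)"]) (use X(2) in \<open>auto simp: \<S>_def\<close>)
    moreover have "?T \<in> \<S>"
      using nT E(1) closed_relcomp[OF closed_converse[OF E(2)] E(2)] by (auto simp: \<S>_def sym_def)
    ultimately obtain S where S: "S \<in> \<S>" and max: "\<And>S'. S' \<in> \<S> \<Longrightarrow> S \<subseteq> S' \<Longrightarrow> S = S'"
      using finite_has_maximal2 by metis
    have S': "S \<subseteq> X \<times> X" "?T \<subseteq> S" "sym S" "closed (pair_act act act) S" "S \<noteq> X \<times> X"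
      using S by (auto simp: \<S>_def)
    have refl: "(x, x) \<in> S" if "x \<in> X" for x using sdX[OF that] S'(2) by blast
    have SS: "S O S = X \<times> X"
    proof (rule ccontr)
      assume ne: "S O S \<noteq> X \<times> X"
      have sub: "S \<subseteq> S O S" using refl S'(1) by blast
      have "S O S \<subseteq> X \<times> X" "?T \<subseteq> S O S" using S'(1,2) sub by auto
      moreover have "sym (S O S)" using S'(3) by (auto simp: sym_def)
      ultimately have "S O S \<in> \<S>"
        using ne closed_relcomp[OF S'(4) S'(4)] by (simp add: \<S>_def)
      then have "S O S = S" using max sub by blast
      then have "trans S" by (metis relcompI transI)
      then have "?T\<^sup>+ \<subseteq> S" using S'(2) by (metis trancl_id trancl_mono_subset)
      then show False using linked S'(1,5) by blast
    qed
    have "\<exists>y\<in>X. \<forall>x\<in>X. (y, x) \<in> S"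
    proof (rule common_neighbour[OF X(1,2,3) X(1) S'(1,4) _ X(4)])
      fix u v assume "u \<in> X" "v \<in> X"
      then have "(u, v) \<in> S O S" using SS by simp
      then show "\<exists>y. (y, u) \<in> S \<and> (y, v) \<in> S" using S'(3) by (auto simp: sym_def)
    qed
    then have ne: "{y \<in> X. \<forall>x\<in>X. (y, x) \<in> S} \<noteq> {}" by blast
    have "\<exists>t. ternary_absorbs act t {y \<in> X. \<forall>x\<in>X. (y, x) \<in> S} X"
      by (rule center_ternary_absorbs[OF X(1,2) bf X(1) S'(1,4) _ X(2)]) (use refl in blast)
    moreover have "closed act {y \<in> X. \<forall>x\<in>X. (y, x) \<in> S}"
      by (rule center_closed[OF X(1,2) bf X(1) S'(1,4)]) (use refl in blast)
    ultimately have eq: "{y \<in> X. \<forall>x\<in>X. (y, x) \<in> S} = X"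
      by (intro ternary_freeD[OF X(3) _ ne]) auto
    have "X \<times> X \<subseteq> S"
    proof (rule subrelI)
      fix y x assume yx: "(y, x) \<in> X \<times> X"
      then have "y \<in> {y \<in> X. \<forall>x\<in>X. (y, x) \<in> S}" unfolding eq by simp
      then show "(y, x) \<in> S" using yx by blast
    qed
    then show False using S'(1,5) by blast
  qed
  have "\<exists>y\<in>Y. \<forall>x\<in>X. (y, x) \<in> E"
  proof (rule common_neighbour[OF X(1,2,3) Y(1) E _ X(4)])
    fix u v assume "u \<in> X" "v \<in> X"
    then have "(u, v) \<in> ?T" using T by simp
    then show "\<exists>y. (y, u) \<in> E \<and> (y, v) \<in> E" by blast
  qed
  then have "K \<noteq> {}" by (auto simp: K_def)
  moreover have "closed act' K" unfolding K_def by (rule center_closed[OF X(1,2) bf Y(1) E sdY])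
  moreover have "\<exists>t. ternary_absorbs act' t K Y"
    unfolding K_def by (rule center_ternary_absorbs[OF X(1,2) bf Y(1) E sdY Y(2)])
  ultimately show ?thesis by blast
qed

text \<open>The coordinates in \<open>J\<close> are fixed one by one: the values that remain possible for the next coordinate form a
  ternary absorbing subuniverse of \<open>X\<close>, and this is all of \<open>X\<close>.\<close>

lemma ternary_absorbing_full_projection:
  assumes X: "algebra X act" "ternary_free X act"
    and R: "\<And>r i. r \<in> R \<Longrightarrow> r i \<in> X"
    and full: "\<And>v. (\<And>j. j \<in> J \<Longrightarrow> v j \<in> X) \<Longrightarrow> \<exists>r\<in>R. \<forall>j\<in>J. r j = v j"
    and K: "K \<subseteq> R" "K \<noteq> {}" "closed (power_act act) K" "ternary_absorbs (power_act act) t K R"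
    and J: "finite J" and v: "\<And>j. j \<in> J \<Longrightarrow> v j \<in> X"
  shows "\<exists>k\<in>K. \<forall>j\<in>J. k j = v j"
proof -
  have t: "t \<in> Sym" "ar t = 3" using K(4) by (auto simp: ternary_absorbs_def)
  have "\<exists>k\<in>K. \<forall>j\<in>J'. k j = v j" if "finite J'" "J' \<subseteq> J" for J'
    using that
  proof (induction J')
    case empty
    then show ?case using K(2) by auto
  next
    case (insert x J')
    define K' where "K' = {k \<in> K. \<forall>j\<in>J'. k j = v j}"
    have K'R: "k \<in> R" if "k \<in> K'" for k using that K(1) by (auto simp: K'_def)
    define C where "C = (\<lambda>k. k x) ` K'"
    have "closed act C"
    proof (rule closedI)
      fix f c assume f: "f \<in> Sym" and c: "\<And>k. k < ar f \<Longrightarrow> c k \<in> C"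
      then have "\<forall>k. \<exists>q. k < ar f \<longrightarrow> q \<in> K' \<and> c k = q x" unfolding C_def by blast
      then obtain q where q: "\<And>k. k < ar f \<Longrightarrow> q k \<in> K' \<and> c k = q k x" by metis
      have "power_act act f q \<in> K" by (rule closedD[OF K(3) f]) (use q K'_def in auto)
      moreover have "power_act act f q j = v j" if "j \<in> J'" for j
        unfolding power_act_def using v insert.prems that q
        by (intro act_const[OF X(1) f]) (auto simp: K'_def)
      ultimately have "power_act act f q \<in> K'" by (auto simp: K'_def)
      moreover have "act f c = power_act act f q x"
        unfolding power_act_def by (rule act_cong[OF X(1) f]) (use q in auto)
      ultimately show "act f c \<in> C" by (auto simp: C_def)
    qed
    moreover have "C \<noteq> {}" using insert by (auto simp: C_def K'_def)
    moreover have CX: "C \<subseteq> X" using K'R R by (auto simp: C_def)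
    moreover have "ternary_absorbs act t C X"
      unfolding ternary_absorbs_def
    proof (intro conjI t ballI)
      fix c c' a assume "c \<in> C" "c' \<in> C" and a: "a \<in> X"
      then obtain k k' where k: "k \<in> K'" "k' \<in> K'" "c = k x" "c' = k' x" by (auto simp: C_def)
      have "\<exists>r\<in>R. \<forall>j\<in>J. r j = (v(x := a)) j"
        by (rule full) (use v a in auto)
      then obtain r where r: "r \<in> R" "\<forall>j\<in>J'. r j = v j" "r x = a"
        using insert.hyps insert.prems by (auto split: if_splits)
      have mem: "act t (vec3 (p x) (q x) (s x)) \<in> C"
        if "power_act act t (vec3 p q s) \<in> K" "\<forall>j\<in>J'. p j = v j \<and> q j = v j \<and> s j = v j" for p q s
      proof -
        have "power_act act t (vec3 p q s) j = v j" if j: "j \<in> J'" for j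
          unfolding power_act_def using \<open>\<forall>j\<in>J'. p j = v j \<and> q j = v j \<and> s j = v j\<close> j v insert.prems
          by (intro act_const[OF X(1) t(1)]) (auto simp: vec3_def)
        then have "power_act act t (vec3 p q s) \<in> K'" using that by (auto simp: K'_def)
        moreover have "power_act act t (vec3 p q s) x = act t (vec3 (p x) (q x) (s x))"
          unfolding power_act_def by (subst act_vec3[OF X(1) t]) simp
        ultimately show ?thesis unfolding C_def by (intro image_eqI[where x = "power_act act t (vec3 p q s)"]) simp_all
      qed
      have kk: "k \<in> K" "k' \<in> K" using k by (auto simp: K'_def)
      have vs: "\<forall>j\<in>J'. k j = v j" "\<forall>j\<in>J'. k' j = v j" using k by (auto simp: K'_def)
      have abs: "power_act act t (vec3 k k' r) \<in> K" "power_act act t (vec3 k r k') \<in> K"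
        "power_act act t (vec3 r k k') \<in> K"
        using K(4) kk r(1) by (auto simp: ternary_absorbs_def)
      show "act t (vec3 c c' a) \<in> C" using mem[OF abs(1)] vs r k by simp
      show "act t (vec3 c a c') \<in> C" using mem[OF abs(2)] vs r k by simp
      show "act t (vec3 a c c') \<in> C" using mem[OF abs(3)] vs r k by simp
    qed
    ultimately have "C = X" using ternary_freeD[OF X(2)] by blast
    then have "v x \<in> C" using v insert.prems by auto
    then show ?case by (auto simp: C_def K'_def)
  qed
  from this[OF J subset_refl] show ?thesis .
qed

end

section \<open>Cyclic sets of periodic sequences\<close>

text \<open>A \<open>p\<close>-ary tuple is represented by its \<open>p\<close>-periodic extension to the integers, so that rotations are shifts and places can be
  subtracted freely.\<close>

definition cyclic_rel :: "nat \<Rightarrow> (int \<Rightarrow> 'x) set \<Rightarrow> bool" where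
  "cyclic_rel p R \<longleftrightarrow> (\<forall>r\<in>R. (\<forall>i. r (i + int p) = r i) \<and> (\<lambda>i. r (i + 1)) \<in> R)"

lemma periodic_mult:
  fixes r :: "int \<Rightarrow> 'x"
  assumes "\<And>i. r (i + d) = r i"
  shows "r (i + k * d) = r i"
proof -
  have nat: "r (i + int n * d) = r i" for n i
  proof (induction n)
    case (Suc n)
    have "r (i + int (Suc n) * d) = r ((i + int n * d) + d)" by (simp add: algebra_simps)
    then show ?case using assms Suc by simp
  qed simp
  show ?thesis
  proof (cases "k \<ge> 0")
    case True
    then show ?thesis using nat[of i "nat k"] by simp
  next
    case False
    then show ?thesis using nat[of "i + k * d" "nat (- k)"] by simp
  qed
qed

lemma periodic_prime_const:
  fixes r :: "int \<Rightarrow> 'x"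
  assumes p: "prime p" and per: "\<And>i. r (i + int p) = r i" and d: "\<And>i. r (i + d) = r i" and nd: "\<not> int p dvd d"
  shows "r i = r 0"
proof -
  have "coprime (int p) d" using p nd by (intro prime_imp_coprime) auto
  then obtain u v where uv: "u * int p + v * d = 1" using bezout_int[of "int p" d] by auto
  have "r (0 + (i * u) * int p + (i * v) * d) = r (0 + (i * u) * int p)"
    by (rule periodic_mult[of r d, OF d])
  also have "\<dots> = r 0" by (rule periodic_mult[of r "int p", OF per])
  finally have "r (0 + (i * u) * int p + (i * v) * d) = r 0" .
  moreover have "0 + (i * u) * int p + (i * v) * d = i * (u * int p + v * d)" by (simp add: algebra_simps)
  ultimately show ?thesis using uv by simp
qed

lemma cyclic_rel_periodic: "cyclic_rel p R \<Longrightarrow> r \<in> R \<Longrightarrow> r (i + int p) = r i"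
  by (simp add: cyclic_rel_def)

lemma cyclic_rel_mod:
  assumes "cyclic_rel p R" "r \<in> R"
  shows "r (i mod int p) = r i"
  using periodic_mult[of r "int p" "i mod int p" "i div int p"] cyclic_rel_periodic[OF assms] by simp

lemma cyclic_rel_shift:
  assumes R: "cyclic_rel p R" and p: "p > 0" and r: "r \<in> R"
  shows "(\<lambda>i. r (i + d)) \<in> R"
proof -
  have nat: "(\<lambda>i. r (i + int n)) \<in> R" for n
  proof (induction n)
    case (Suc n)
    have "(\<lambda>i. f (i + 1)) \<in> R" if "f \<in> R" for f using R that by (simp add: cyclic_rel_def)
    from this[OF Suc] have "(\<lambda>i. (\<lambda>i. r (i + int n)) (i + 1)) \<in> R" .
    moreover have "(\<lambda>i. (\<lambda>i. r (i + int n)) (i + 1)) = (\<lambda>i. r (i + int (Suc n)))"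
      by (simp add: algebra_simps)
    ultimately show ?case by simp
  qed (use r in simp)
  have "(\<lambda>i. r (i + d)) = (\<lambda>i. r (i + int (nat (d mod int p))))"
  proof
    fix i
    have "r (i + d) = r ((i + d mod int p) + (d div int p) * int p)" by (simp add: algebra_simps)
    also have "\<dots> = r (i + d mod int p)" by (rule periodic_mult) (rule cyclic_rel_periodic[OF R r])
    finally show "r (i + d) = r (i + int (nat (d mod int p)))" using p by simp
  qed
  then show ?thesis by (simp only: nat)
qed

lemma finite_cyclic_rel:
  assumes R: "cyclic_rel p R" and p: "p > 0" and X: "finite X" and RX: "\<And>r i. r \<in> R \<Longrightarrow> r i \<in> X"
  shows "finite R"
proof (rule inj_on_finite)
  show "inj_on (\<lambda>r. restrict r {0..<int p}) R"
  proof (rule inj_onI)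
    fix r r' assume r: "r \<in> R" "r' \<in> R" and eq: "restrict r {0..<int p} = restrict r' {0..<int p}"
    show "r = r'"
    proof
      fix i
      have "i mod int p \<in> {0..<int p}" using p by simp
      then have "r (i mod int p) = r' (i mod int p)" using eq by (metis restrict_apply)
      then show "r i = r' i" using cyclic_rel_mod[OF R] r by metis
    qed
  qed
  show "(\<lambda>r. restrict r {0..<int p}) ` R \<subseteq> {0..<int p} \<rightarrow>\<^sub>E X" using RX by auto
  show "finite ({0..<int p} \<rightarrow>\<^sub>E X)" using X by (intro finite_PiE) auto
qed

text \<open>Without constant sequences all orbits of the shift have \<open>p\<close> elements.\<close>

lemma prime_dvd_card_cyclic_rel:
  assumes p: "prime p" and "finite R" "cyclic_rel p R" "\<And>r. r \<in> R \<Longrightarrow> \<exists>i. r i \<noteq> r 0"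
  shows "p dvd card R"
  using assms(2-)
proof (induction R rule: finite_psubset_induct)
  case (psubset R)
  have p0: "p > 0" using p prime_gt_0_nat by blast
  show ?case
  proof (cases "R = {}")
    case False
    then obtain r where r: "r \<in> R" by auto
    let ?s = "\<lambda>d i. r (i + d)"
    define O' where "O' = ?s ` {0..<int p}"
    have inj: "inj_on ?s {0..<int p}"
    proof (rule inj_onI, rule ccontr)
      fix d e assume de: "d \<in> {0..<int p}" "e \<in> {0..<int p}" "?s d = ?s e" "d \<noteq> e"
      have "r (i + (e - d)) = r i" for i
        using fun_cong[OF de(3), of "i - d"] by (simp add: algebra_simps)
      moreover have "\<not> int p dvd (e - d)"
      proof
        assume "int p dvd e - d"
        then have "\<bar>int p\<bar> \<le> \<bar>e - d\<bar>" using de(4) by (intro dvd_imp_le_int) auto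
        then show False using de(1,2) by auto
      qed
      ultimately have "r i = r 0" for i
        using periodic_prime_const[OF p] cyclic_rel_periodic[OF psubset.prems(1) r] by metis
      then show False using psubset.prems(2)[OF r] by blast
    qed
    have OR: "O' \<subseteq> R" using cyclic_rel_shift[OF psubset.prems(1) p0 r] by (auto simp: O'_def)
    have Osh: "(\<lambda>i. q (i + d)) \<in> O'" if q: "q \<in> O'" for q d
    proof -
      obtain e where e: "q = ?s e" using q by (auto simp: O'_def)
      have "(\<lambda>i. q (i + d)) = ?s ((d + e) mod int p)"
      proof
        fix i
        have "i + d + e = (i + (d + e) mod int p) + ((d + e) div int p) * int p"
          using div_mult_mod_eq[of "d + e" "int p"] by linarith
        then have "q (i + d) = r ((i + (d + e) mod int p) + ((d + e) div int p) * int p)"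
          using e by metis
        also have "\<dots> = r (i + (d + e) mod int p)"
          by (rule periodic_mult) (rule cyclic_rel_periodic[OF psubset.prems(1) r])
        finally show "q (i + d) = r (i + (d + e) mod int p)" .
      qed
      then show ?thesis using p0 by (auto simp: O'_def)
    qed
    have "cyclic_rel p (R - O')"
      unfolding cyclic_rel_def
    proof (intro ballI conjI allI)
      fix q i assume q: "q \<in> R - O'"
      show "q (i + int p) = q i" using q cyclic_rel_periodic[OF psubset.prems(1)] by blast
      have "(\<lambda>i. q (i + 1)) \<notin> O'"
        using Osh[of "\<lambda>i. q (i + 1)" "-1"] q by auto
      then show "(\<lambda>i. q (i + 1)) \<in> R - O'" using q psubset.prems(1) by (auto simp: cyclic_rel_def)
    qed
    moreover have "r \<in> O'" unfolding O'_def by (rule image_eqI[of _ _ 0]) (use p0 in auto)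
    then have "R - O' \<subset> R" using r by blast
    ultimately have "p dvd card (R - O')" using psubset.IH psubset.prems(2) by blast
    moreover have "card O' = p" using card_image[OF inj] by (simp add: O'_def)
    moreover have "card R = card (R - O') + card O'"
      using card_Diff_subset[OF finite_subset[OF OR psubset.hyps] OR] card_mono[OF psubset.hyps OR] by simp
    ultimately show ?thesis by simp
  qed simp
qed

text \<open>Determination of place \<open>0\<close> by place \<open>d\<close> propagates around the cycle, so two sequences that agree somewhere agree everywhere.
  As \<open>X\<close> has fewer than \<open>p\<close> elements, some \<open>r\<close> takes a value at two of the places \<open>0, d, 2d, \<dots>, (p - 1)d\<close>. Thus \<open>r\<close> equals a
  nontrivial shift of itself and is constant.\<close>

lemma constant_if_coordinate_determined:
  assumes p: "prime p" and R: "cyclic_rel p R" "R \<noteq> {}" and X: "finite X" "card X < p"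
    and RX: "\<And>r i. r \<in> R \<Longrightarrow> r i \<in> X"
    and d: "\<not> int p dvd d" and det: "\<And>r r'. r \<in> R \<Longrightarrow> r' \<in> R \<Longrightarrow> r d = r' d \<Longrightarrow> r 0 = r' 0"
  shows "\<exists>r\<in>R. \<forall>i. r i = r 0"
proof -
  have p0: "p > 0" using p prime_gt_0_nat by blast
  note shift = cyclic_rel_shift[OF R(1) p0]
  note per = cyclic_rel_periodic[OF R(1)]
  have down: "r i = r' i" if "r \<in> R" "r' \<in> R" "r (i + d) = r' (i + d)" for r r' i
    using det[OF shift[OF that(1), of i] shift[OF that(2), of i]] that(3) by (simp add: algebra_simps)
  have down_n: "r i = r' i" if "r \<in> R" "r' \<in> R" "r (i + int n * d) = r' (i + int n * d)" for r r' i n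
    using that(3)
  proof (induction n)
    case (Suc n)
    have "r ((i + int n * d) + d) = r' ((i + int n * d) + d)" using Suc.prems by (simp add: algebra_simps)
    from down[OF that(1,2) this] show ?case by (rule Suc.IH)
  qed simp
  have all: "r i = r' i" if r: "r \<in> R" "r' \<in> R" and j: "r j = r' j" for r r' i j
  proof -
    \<comment> \<open>Agreement at a place is itself a sequence of truth values with periods \<open>p\<close> and \<open>d\<close>.\<close>
    define g where "g i = (r i = r' i)" for i
    have "g (i + d) = g i" for i
    proof
      assume "g (i + d)" then show "g i" using down[OF r] by (simp add: g_def)
    next
      assume "g i"
      \<comment> \<open>Going forward by \<open>d\<close> is going back \<open>p - 1\<close> times.\<close>
      have m: "q (i + d + int (p - 1) * d) = q i" if "q \<in> R" for q
      proof -
        have "i + d + int (p - 1) * d = i + d * int p" using p0 by (simp add: of_nat_diff algebra_simps)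
        then show ?thesis using periodic_mult[of q "int p" i d, OF per[OF that]] by metis
      qed
      show "g (i + d)" unfolding g_def
        by (rule down_n[OF r, of _ "p - 1"]) (use \<open>g i\<close>[unfolded g_def] m[OF r(1)] m[OF r(2)] in metis)
    qed
    moreover have "g (i + int p) = g i" for i using per[OF r(1)] per[OF r(2)] by (simp add: g_def)
    ultimately have "g i = g 0" for i using periodic_prime_const[OF p, of g d] d by blast
    then show ?thesis using j g_def by metis
  qed
  obtain r where r: "r \<in> R" using R(2) by auto
  have "\<not> inj_on (\<lambda>k. r (int k * d)) {..<p}"
  proof
    assume "inj_on (\<lambda>k. r (int k * d)) {..<p}"
    then have "card {..<p} \<le> card X" by (rule card_inj_on_le) (use RX r X in auto)
    then show False using X(2) by simp
  qed
  then obtain k l where kl: "k < p" "l < p" "k < l" "r (int k * d) = r (int l * d)"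
    by (auto simp: inj_on_def) (metis linorder_neqE_nat)
  define e where "e = int (l - k) * d"
  have el: "int k * d + e = int l * d" using kl by (simp add: e_def of_nat_diff algebra_simps)
  have "r (i + e) = r i" for i
  proof -
    have "r (int k * d) = r (int k * d + e)" using kl(4) el by simp
    from all[OF r shift[OF r, of e] this] show ?thesis by simp
  qed
  moreover have "\<not> int p dvd e"
  proof
    assume "int p dvd e"
    then have "int p dvd int (l - k)" using p d by (auto simp: e_def prime_dvd_mult_iff)
    then have "p dvd l - k" by simp
    then have "p \<le> l - k" using kl by (intro dvd_imp_le) auto
    then show False using kl by simp
  qed
  ultimately have "r i = r 0" for i using periodic_prime_const[OF p, of r e] per[OF r] by blast
  then show ?thesis using r by blast
qed

section \<open>Cyclic relations contain constant tuples\<close>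

context taylor_clone
begin

text \<open>Simplicity, stated for reflexive symmetric invariant relations, whose transitive closures are
  congruences; in this form it says directly that links are trivial or connect everything.\<close>

definition simple where
  "simple X act \<longleftrightarrow> (\<forall>T. T \<subseteq> X \<times> X \<and> closed (pair_act act act) T \<and> (\<forall>x\<in>X. (x, x) \<in> T) \<and> sym T
     \<longrightarrow> T \<subseteq> Id \<or> T\<^sup>+ = X \<times> X)"

lemma simpleD: "simple X act \<Longrightarrow> T \<subseteq> X \<times> X \<Longrightarrow> closed (pair_act act act) T \<Longrightarrow>
   (\<And>x. x \<in> X \<Longrightarrow> (x, x) \<in> T) \<Longrightarrow> sym T \<Longrightarrow> T \<subseteq> Id \<or> T\<^sup>+ = X \<times> X"
  unfolding simple_def by blast

context
  fixes X :: "'x set" and act :: "'f \<Rightarrow> (nat \<Rightarrow> 'x) \<Rightarrow> 'x" and R :: "(int \<Rightarrow> 'x) set" and p :: nat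
  assumes X: "algebra X act" "finite X" "simple X act"
    and p: "prime p" "card X < p"
    and R: "closed (power_act act) R" "cyclic_rel p R" "R \<noteq> {}" "\<And>r i. r \<in> R \<Longrightarrow> r i \<in> X"
    and sd: "\<And>a. a \<in> X \<Longrightarrow> \<exists>r\<in>R. r 0 = a"
    and no_const: "\<And>r. r \<in> R \<Longrightarrow> \<exists>i. r i \<noteq> r 0"
begin

lemma p_pos: "p > 0"
  using p(1) prime_gt_0_nat by blast

lemmas shift = cyclic_rel_shift[OF R(2) p_pos]

lemma sd_all: "a \<in> X \<Longrightarrow> \<exists>r\<in>R. r i = a"
proof -
  assume "a \<in> X"
  then obtain r where "r \<in> R" "r 0 = a" using sd by blast
  then show ?thesis using shift[of r "-i"] by (intro bexI[of _ "\<lambda>k. r (k + -i)"]) auto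
qed

lemma X_ne: "X \<noteq> {}"
  using R(3,4) by blast

text \<open>Let \<open>J\<close> be a maximal set of places on which \<open>R\<close> projects onto the full power of \<open>X\<close>. For a further place \<open>x\<close>, the links between
  values at \<open>x\<close> of sequences that agree on \<open>J\<close> are trivial, or they connect all of \<open>X\<close>. In the second case
  \<open>linked_center\<close> and \<open>ternary_absorbing_full_projection\<close> would make \<open>x\<close> independent of \<open>J\<close>, against maximality. So
  \<open>R\<close> is determined by its full projection to \<open>J\<close>, and \<open>|R|\<close> is a power of \<open>|X|\<close>.\<close>

lemma ternary_free_contradiction:
  assumes free: "ternary_free X act"
  shows False
proof -
  define full where "full J \<longleftrightarrow> (\<forall>v. (\<forall>j\<in>J. v j \<in> X) \<longrightarrow> (\<exists>r\<in>R. \<forall>j\<in>J. r j = v j))" for J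
  have ex: "\<exists>J\<in>{J. J \<subseteq> {0..<int p} \<and> full J}. {} \<subseteq> J \<and> (\<forall>J'\<in>{J. J \<subseteq> {0..<int p} \<and> full J}. J \<subseteq> J' \<longrightarrow> J = J')"
    by (rule finite_has_maximal2) (use R(3) in \<open>auto simp: full_def\<close>)
  then obtain J where J: "J \<subseteq> {0..<int p}" "full J" and
    Jmax': "\<forall>J'. J' \<subseteq> {0..<int p} \<and> full J' \<longrightarrow> J \<subseteq> J' \<longrightarrow> J = J'" by auto
  have Jmax: "J = J'" if "J' \<subseteq> {0..<int p}" "full J'" "J \<subseteq> J'" for J'
    using Jmax' that by simp
  have fJ: "full J" and J0: "J \<subseteq> {0..<int p}" using J by auto
  have finJ: "finite J" using J0 finite_subset by blast
  have finR: "finite R" by (rule finite_cyclic_rel[OF R(2) p_pos X(2)]) (rule R(4))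
  have Ralg: "algebra R (power_act act)" by (rule power_algebra[OF X(1) R(1)]) (rule R(4))
  have det: "r x = r' x" if x: "x \<in> {0..<int p}" and r: "r \<in> R" "r' \<in> R" and eq: "\<forall>j\<in>J. r j = r' j" for r r' x
  proof (cases "x \<in> J")
    case False
    define T where "T = {(r x, r' x) |r r'. r \<in> R \<and> r' \<in> R \<and> (\<forall>j\<in>J. r j = r' j)}"
    have "T \<subseteq> Id \<or> T\<^sup>+ = X \<times> X"
    proof (rule simpleD[OF X(3)])
      show "T \<subseteq> X \<times> X" using R(4) by (auto simp: T_def)
      show "closed (pair_act act act) T" unfolding T_def by (rule common_coordinate_rel[OF X(1) R(1)])
      show "sym T"
      proof (rule symI)
        fix a b assume "(a, b) \<in> T"
        then obtain r r' where "r \<in> R" "r' \<in> R" "\<forall>j\<in>J. r' j = r j" "a = r x" "b = r' x"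
          unfolding T_def by force
        then show "(b, a) \<in> T" unfolding T_def by blast
      qed
      fix a assume "a \<in> X"
      then obtain r where "r \<in> R" "r x = a" using sd_all by blast
      then show "(a, a) \<in> T" unfolding T_def by blast
    qed
    moreover have "T\<^sup>+ \<noteq> X \<times> X"
    proof
      assume TX: "T\<^sup>+ = X \<times> X"
      \<comment> \<open>The relation between the restriction of \<open>r\<close> to \<open>J\<close> and the possible values at \<open>x\<close>.\<close>
      define E where "E = {(r, r' x) |r r'. r \<in> R \<and> r' \<in> R \<and> (\<forall>j\<in>J. r j = r' j)}"
      have ER: "E \<subseteq> R \<times> X" using R(4) by (auto simp: E_def)
      have clE: "closed (pair_act (power_act act) act) E"
      proof (rule closed_pairI)
        fix f r and a :: "nat \<Rightarrow> 'x" assume f: "f \<in> Sym" and ra: "\<And>k. k < ar f \<Longrightarrow> (r k, a k) \<in> E"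
        then have "\<forall>k. \<exists>r'. k < ar f \<longrightarrow> r k \<in> R \<and> r' \<in> R \<and> (\<forall>j\<in>J. r k j = r' j) \<and> a k = r' x"
          unfolding E_def by blast
        then obtain r' where r': "\<And>k. k < ar f \<Longrightarrow> r k \<in> R \<and> r' k \<in> R \<and> (\<forall>j\<in>J. r k j = r' k j) \<and> a k = r' k x"
          by metis
        have "power_act act f r \<in> R" "power_act act f r' \<in> R" using r' by (auto intro!: closedD[OF R(1) f])
        moreover have "\<forall>j\<in>J. power_act act f r j = power_act act f r' j"
          unfolding power_act_def by (intro ballI act_cong[OF X(1) f]) (use r' in auto)
        moreover have "act f a = power_act act f r' x"
          unfolding power_act_def by (intro act_cong[OF X(1) f]) (use r' in auto)
        ultimately show "(power_act act f r, act f a) \<in> E" unfolding E_def by blast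
      qed
      have "E\<inverse> O E = T"
      proof
        show "E\<inverse> O E \<subseteq> T"
        proof (rule subrelI)
          fix a b assume "(a, b) \<in> E\<inverse> O E"
          then obtain r r1 r2 where "r1 \<in> R" "r2 \<in> R" "\<forall>j\<in>J. r j = r1 j" "\<forall>j\<in>J. r j = r2 j" "a = r1 x" "b = r2 x"
            unfolding E_def by blast
          moreover from this have "\<forall>j\<in>J. r1 j = r2 j" by simp
          ultimately show "(a, b) \<in> T" unfolding T_def by blast
        qed
        show "T \<subseteq> E\<inverse> O E"
        proof (rule subrelI)
          fix a b assume "(a, b) \<in> T"
          then obtain r r' where r: "r \<in> R" "r' \<in> R" "\<forall>j\<in>J. r j = r' j" "a = r x" "b = r' x"
            unfolding T_def by blast
          then have "(r, a) \<in> E" "(r, b) \<in> E" unfolding E_def by blast+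
          then show "(a, b) \<in> E\<inverse> O E" by blast
        qed
      qed
      then have link: "(E\<inverse> O E)\<^sup>+ = X \<times> X" using TX by simp
      define K where "K = {r \<in> R. \<forall>a\<in>X. (r, a) \<in> E}"
      have "K \<noteq> {} \<and> closed (power_act act) K \<and> (\<exists>t. ternary_absorbs (power_act act) t K R)"
        unfolding K_def
      proof (rule linked_center[OF X(1,2) free X_ne Ralg finR ER clE _ _ link])
        fix r assume "r \<in> R" then show "\<exists>a. (r, a) \<in> E" unfolding E_def by blast
      next
        fix a assume "a \<in> X"
        then obtain r where "r \<in> R" "r x = a" using sd_all by blast
        then show "\<exists>r. (r, a) \<in> E" unfolding E_def by blast
      qed
      then obtain t where K: "K \<noteq> {}" "closed (power_act act) K" "ternary_absorbs (power_act act) t K R" by blast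
      have KR: "K \<subseteq> R" by (auto simp: K_def)
      have "full (insert x J)"
        unfolding full_def
      proof (intro allI impI)
        fix v assume v: "\<forall>j\<in>insert x J. v j \<in> X"
        have "\<exists>k\<in>K. \<forall>j\<in>J. k j = v j"
        proof (rule ternary_absorbing_full_projection[OF X(1) free _ _ KR K finJ])
          show "r i \<in> X" if "r \<in> R" for r i using R(4)[OF that] .
          show "\<exists>r\<in>R. \<forall>j\<in>J. r j = u j" if "\<And>j. j \<in> J \<Longrightarrow> u j \<in> X" for u
            using fJ that unfolding full_def by blast
          show "v j \<in> X" if "j \<in> J" for j using v that by blast
        qed
        then obtain k where k: "k \<in> K" "\<forall>j\<in>J. k j = v j" by blast
        then have "(k, v x) \<in> E" using v by (auto simp: K_def)
        then obtain r' where "r' \<in> R" "\<forall>j\<in>J. k j = r' j" "v x = r' x" unfolding E_def by blast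
        then show "\<exists>r\<in>R. \<forall>j\<in>insert x J. r j = v j" using k by (intro bexI[of _ r']) auto
      qed
      then have "J = insert x J" by (intro Jmax) (use J0 x in auto)
      then show False using False by blast
    qed
    ultimately have "T \<subseteq> Id" by blast
    moreover have "(r x, r' x) \<in> T" using r eq unfolding T_def by blast
    ultimately show ?thesis by blast
  qed (use eq in auto)
  have "bij_betw (\<lambda>r. restrict r J) R (J \<rightarrow>\<^sub>E X)"
    unfolding bij_betw_def
  proof
    show "inj_on (\<lambda>r. restrict r J) R"
    proof (rule inj_onI)
      fix r r' assume r: "r \<in> R" "r' \<in> R" "restrict r J = restrict r' J"
      have eq: "\<forall>j\<in>J. r j = r' j" using r(3) by (metis restrict_apply')
      show "r = r'"
      proof
        fix i
        have "i mod int p \<in> {0..<int p}" using p_pos by simp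
        then have "r (i mod int p) = r' (i mod int p)" using det r eq by blast
        then show "r i = r' i" using cyclic_rel_mod[OF R(2)] r by metis
      qed
    qed
    show "(\<lambda>r. restrict r J) ` R = (J \<rightarrow>\<^sub>E X)"
    proof
      show "(\<lambda>r. restrict r J) ` R \<subseteq> (J \<rightarrow>\<^sub>E X)" using R(4) by auto
      show "(J \<rightarrow>\<^sub>E X) \<subseteq> (\<lambda>r. restrict r J) ` R"
      proof
        fix v assume v: "v \<in> J \<rightarrow>\<^sub>E X"
        then have "\<forall>j\<in>J. v j \<in> X" by auto
        then obtain r where r: "r \<in> R" "\<forall>j\<in>J. r j = v j" using fJ unfolding full_def by blast
        have "v = restrict r J" using v r(2) by (intro ext) (auto simp: restrict_def PiE_def extensional_def)
        then show "v \<in> (\<lambda>r. restrict r J) ` R" using r(1) by blast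
      qed
    qed
  qed
  then have "card R = card X ^ card J" using finJ by (simp add: bij_betw_same_card card_PiE)
  moreover have "p dvd card R" by (rule prime_dvd_card_cyclic_rel[OF p(1) finR R(2) no_const])
  ultimately have "p dvd card X" using p(1) prime_dvd_power by metis
  moreover have "card X > 0" using X_ne X(2) by (simp add: card_gt_0_iff)
  ultimately show False using p(2) by (auto dest: dvd_imp_le)
qed

text \<open>\<open>P B\<close> collects the places that are unrestricted once place \<open>0\<close> is in \<open>B\<close>, and \<open>S B i j\<close> the values at place
  \<open>j\<close> when place \<open>i\<close> is in \<open>B\<close>. Let \<open>B\<close> maximize \<open>|P B|\<close> and then \<open>|B|\<close>. Suppose \<open>j\<close> is missing from \<open>P B\<close> and put
  \<open>D = S B 0 j\<close>. If \<open>S D j 0 = X\<close>, then \<open>P D\<close> contains \<open>- j\<close> and the differences \<open>i - j\<close> for \<open>i \<in> P B\<close>, one element too many.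
  Otherwise \<open>S D j 0 = B\<close> by maximality, so \<open>B\<close> is closed under the links at place \<open>0\<close> through place \<open>j\<close>, and
  simplicity leaves only trivial links.\<close>

lemma sequence_in_absorbing_subuniverse:
  assumes C: "C \<subseteq> X" "C \<noteq> {}" "C \<noteq> X" "closed act C" "ternary_absorbs act t C X"
  shows "\<exists>B. B \<subset> X \<and> closed act B \<and> (\<exists>r\<in>R. \<forall>i. r i \<in> B)"
proof -
  have t: "t \<in> Sym" "ar t = 3" using C(5) by (auto simp: ternary_absorbs_def)
  define \<B> where "\<B> = {B. B \<subseteq> X \<and> B \<noteq> {} \<and> B \<noteq> X \<and> closed act B \<and> ternary_absorbs act t B X}"
  define P where "P B = {j \<in> {1..<int p}. \<forall>a\<in>X. \<exists>r\<in>R. r 0 \<in> B \<and> r j = a}" for B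
  define S where "S B i j = (\<lambda>r. r j) ` {r \<in> R. r i \<in> B}" for B and i j :: int
  have finP: "finite (P B)" for B
    by (rule finite_subset[of _ "{1..<int p}"]) (auto simp: P_def)
  have SB: "S B i j \<in> \<B>" if B: "B \<in> \<B>" and ne: "S B i j \<noteq> X" for B i j
  proof -
    have "S B i j \<subseteq> X" using R(4) by (auto simp: S_def)
    moreover obtain b where "b \<in> B" "b \<in> X" using B by (auto simp: \<B>_def)
    then obtain r where "r \<in> R" "r i \<in> B" using sd_all[of b i] by blast
    then have "S B i j \<noteq> {}" by (auto simp: S_def)
    moreover have "closed act (S B i j)"
      unfolding S_def using B by (intro closed_image[OF X(1) R(1)]) (auto simp: \<B>_def)
    moreover have "ternary_absorbs act t (S B i j) X"
      unfolding S_def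
    proof (rule absorbs_image[OF X(1) R(1)])
      show "\<exists>r\<in>R. r j = a" if "a \<in> X" for a using sd_all[OF that] .
      show "r k \<in> X" if "r \<in> R" for r k using R(4)[OF that] .
      show "ternary_absorbs act t B X" using B by (simp add: \<B>_def)
    qed
    ultimately show ?thesis using ne by (simp add: \<B>_def)
  qed
  \<comment> \<open>A lexicographic order in one number, as \<open>|B| \<le> |X|\<close>.\<close>
  define w where "w B = card (P B) * (card X + 1) + card B" for B
  have cardB: "card B \<le> card X" if "B \<in> \<B>" for B using that X(2) by (auto simp: \<B>_def intro: card_mono)
  have "w B < (p + 1) * (card X + 1)" if "B \<in> \<B>" for B
  proof -
    have "card (P B) \<le> card {1..<int p}" by (rule card_mono) (auto simp: P_def)
    then have "card (P B) \<le> p" by simp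
    then have "card (P B) * (card X + 1) \<le> p * (card X + 1)" by (rule mult_right_mono) simp
    then show ?thesis using cardB[OF that] by (simp add: w_def)
  qed
  moreover have "C \<in> \<B>" using C by (simp add: \<B>_def)
  ultimately have "\<exists>B. B \<in> \<B> \<and> (\<forall>B'. B' \<in> \<B> \<longrightarrow> w B' \<le> w B)"
    by (intro ex_has_greatest_nat[of _ C _ "(p + 1) * (card X + 1)"]) auto
  then obtain B where B: "B \<in> \<B>" and wB: "\<And>B'. B' \<in> \<B> \<Longrightarrow> w B' \<le> w B" by blast
  have BX: "B \<subseteq> X" "B \<noteq> {}" "B \<noteq> X" "closed act B" "ternary_absorbs act t B X" using B by (auto simp: \<B>_def)
  have Pmax: "card (P B') \<le> card (P B)" if "B' \<in> \<B>" for B'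
  proof (rule ccontr)
    assume "\<not> ?thesis"
    then have "Suc (card (P B)) * (card X + 1) \<le> card (P B') * (card X + 1)" by (intro mult_right_mono) auto
    then have "w B < w B'" using cardB[OF B] by (simp add: w_def)
    then show False using wB[OF that] by simp
  qed
  have Bmax: "B' = B" if "B' \<in> \<B>" "B \<subseteq> B'" for B'
  proof -
    have "P B \<subseteq> P B'" using that(2) unfolding P_def by blast
    then have "card (P B) \<le> card (P B')" using finP by (rule card_mono[rotated])
    then have "card (P B) * (card X + 1) \<le> card (P B') * (card X + 1)" by (rule mult_right_mono) simp
    then have "card B' \<le> card B" using wB[OF that(1)] by (simp add: w_def)
    moreover have "finite B'" using that(1) X(2) finite_subset by (auto simp: \<B>_def)
    ultimately show ?thesis using card_seteq that(2) by metis
  qed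
  have P: "j \<in> P B" if j: "j \<in> {1..<int p}" for j
  proof (rule ccontr)
    assume nj: "j \<notin> P B"
    define D where "D = S B 0 j"
    have "D \<noteq> X" using nj j unfolding P_def D_def S_def by blast
    then have DB: "D \<in> \<B>" using SB[OF B] by (simp add: D_def)
    have BD: "B \<subseteq> S D j 0"
    proof
      fix b assume b: "b \<in> B"
      then obtain r where r: "r \<in> R" "r 0 = b" using sd BX(1) by blast
      then have "r j \<in> D" using b by (auto simp: D_def S_def)
      then show "b \<in> S D j 0" using r by (auto simp: S_def)
    qed
    show False
    proof (cases "S D j 0 = X")
      case True
      let ?g = "\<lambda>i. (i - j) mod int p"
      have g1: "?g i \<in> P D" if i: "i \<in> insert 0 (P B)" for i
      proof -
        have ij: "i \<noteq> j" "0 \<le> i" "i < int p" using i nj j by (auto simp: P_def)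
        have "?g i \<noteq> 0"
        proof
          assume "?g i = 0"
          then have "int p dvd i - j" by (simp add: mod_eq_0_iff_dvd)
          then have "\<bar>int p\<bar> \<le> \<bar>i - j\<bar>" using ij by (intro dvd_imp_le_int) auto
          then show False using ij j by auto
        qed
        moreover have "0 \<le> ?g i" "?g i < int p" using p_pos by auto
        ultimately have rng: "?g i \<in> {1..<int p}" by simp
        have "\<exists>r\<in>R. r 0 \<in> D \<and> r (?g i) = a" if a: "a \<in> X" for a
        proof -
          have "\<exists>r\<in>R. r j \<in> D \<and> r i = a"
          proof (cases "i = 0")
            case True
            have "a \<in> S D j 0" using a \<open>S D j 0 = X\<close> by simp
            then show ?thesis using True by (auto simp: S_def)
          next
            case False
            then obtain r where "r \<in> R" "r 0 \<in> B" "r i = a" using i a by (auto simp: P_def)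
            then show ?thesis by (auto simp: D_def S_def)
          qed
          then obtain r where r: "r \<in> R" "r j \<in> D" "r i = a" by blast
          have s: "(\<lambda>k. r (k + j)) \<in> R" by (rule shift[OF r(1)])
          have "(\<lambda>k. r (k + j)) (?g i) = (\<lambda>k. r (k + j)) (i - j)" by (rule cyclic_rel_mod[OF R(2) s])
          then show ?thesis using s r by (intro bexI[OF _ s]) simp
        qed
        then show ?thesis using rng by (simp add: P_def)
      qed
      have inj: "inj_on ?g (insert 0 (P B))"
      proof (rule inj_onI)
        fix x y assume xy: "x \<in> insert 0 (P B)" "y \<in> insert 0 (P B)" and eq: "?g x = ?g y"
        have "int p dvd (x - j) - (y - j)" using eq by (simp add: mod_eq_dvd_iff)
        then have dvd: "int p dvd x - y" by simp
        have "0 \<le> x" "x < int p" "0 \<le> y" "y < int p" using xy p_pos by (auto simp: P_def)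
        then show "x = y" using dvd_imp_le_int[OF _ dvd] by fastforce
      qed
      have "card (insert 0 (P B)) \<le> card (P D)" by (rule card_inj_on_le[OF inj _ finP]) (rule image_subsetI, rule g1)
      moreover have "card (insert 0 (P B)) = Suc (card (P B))" using finP by (subst card_insert_disjoint) (auto simp: P_def)
      ultimately show False using Pmax[OF DB] by simp
    next
      case False
      then have DD: "S D j 0 = B" using Bmax[OF SB[OF DB False] BD] by simp
      define T where "T = {(r 0, r' 0) |r r'. r \<in> R \<and> r' \<in> R \<and> (\<forall>k\<in>{j}. r k = r' k)}"
      have TI: "(r 0, r' 0) \<in> T" if "r \<in> R" "r' \<in> R" "r j = r' j" for r r'
        using that unfolding T_def by blast
      have TE: "\<exists>r r'. r \<in> R \<and> r' \<in> R \<and> r j = r' j \<and> a = r 0 \<and> b = r' 0" if "(a, b) \<in> T" for a b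
        using that unfolding T_def by blast
      have "T \<subseteq> Id \<or> T\<^sup>+ = X \<times> X"
      proof (rule simpleD[OF X(3)])
        show "T \<subseteq> X \<times> X" using R(4) by (auto simp: T_def)
        show "closed (pair_act act act) T" unfolding T_def by (rule common_coordinate_rel[OF X(1) R(1)])
        show "sym T"
        proof (rule symI)
          fix a b assume "(a, b) \<in> T"
          then show "(b, a) \<in> T" using TE TI by metis
        qed
        fix a assume "a \<in> X"
        then show "(a, a) \<in> T" using sd TI by metis
      qed
      then show False
      proof
        assume "T \<subseteq> Id"
        then have det: "r 0 = r' 0" if "r \<in> R" "r' \<in> R" "r j = r' j" for r r' using TI[OF that] by blast
        have ndvd: "\<not> int p dvd j" using j by (auto dest: zdvd_imp_le)
        have "\<exists>r\<in>R. \<forall>i. r i = r 0"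
        proof (rule constant_if_coordinate_determined[OF p(1) R(2,3) X(2) p(2) _ ndvd])
          show "r i \<in> X" if "r \<in> R" for r i using R(4)[OF that] .
          show "r 0 = r' 0" if "r \<in> R" "r' \<in> R" "r j = r' j" for r r' using det[OF that] .
        qed
        then show False using no_const by blast
      next
        assume TX: "T\<^sup>+ = X \<times> X"
        have step: "b \<in> B" if ab: "(a, b) \<in> T" "a \<in> B" for a b
        proof -
          obtain r r' where r: "r \<in> R" "r' \<in> R" "r j = r' j" "a = r 0" "b = r' 0" using TE[OF ab(1)] by blast
          then have "r j \<in> D" unfolding D_def S_def using ab(2) by (intro image_eqI[of _ _ r]) auto
          then have "b \<in> S D j 0" using r by (auto simp: S_def)
          then show ?thesis using DD by simp
        qed
        have "b \<in> B" if "(a, b) \<in> T\<^sup>+" "a \<in> B" for a b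
          using that by (induction rule: trancl_induct) (auto intro: step)
        then have "X \<subseteq> B" using TX BX(1,2) by blast
        then show False using BX by blast
      qed
    qed
  qed
  have pair: "\<exists>r\<in>R. r i \<in> B \<and> r j \<in> B" for i j
  proof -
    obtain b where b: "b \<in> B" "b \<in> X" using BX by blast
    have "\<exists>r\<in>R. r 0 \<in> B \<and> r ((j - i) mod int p) \<in> B"
    proof (cases "(j - i) mod int p = 0")
      case True
      then show ?thesis using sd[OF b(2)] b(1) by auto
    next
      case False
      moreover have "0 \<le> (j - i) mod int p" "(j - i) mod int p < int p" using p_pos by auto
      ultimately have "(j - i) mod int p \<in> P B" by (intro P) simp
      then show ?thesis using b by (auto simp: P_def)
    qed
    then obtain r where r: "r \<in> R" "r 0 \<in> B" "r ((j - i) mod int p) \<in> B" by blast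
    then have "r (j - i) \<in> B" using cyclic_rel_mod[OF R(2) r(1)] by metis
    then show ?thesis using r shift[OF r(1), of "- i"] by (intro bexI[of _ "\<lambda>k. r (k + - i)"]) auto
  qed
  have all: "\<exists>r\<in>R. \<forall>c\<in>I. r c \<in> B" if "finite I" for I
    using that
  proof (induction I rule: finite_psubset_induct)
    case (psubset I)
    show ?case
    proof (cases "\<exists>x y z. x \<in> I \<and> y \<in> I \<and> z \<in> I \<and> x \<noteq> y \<and> x \<noteq> z \<and> y \<noteq> z")
      case True
      then obtain x y z where xyz: "x \<in> I" "y \<in> I" "z \<in> I" "x \<noteq> y" "x \<noteq> z" "y \<noteq> z" by blast
      have ex: "\<exists>r\<in>R. \<forall>c\<in>I - {u}. r c \<in> B" if "u \<in> I" for u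
        using psubset.IH[of "I - {u}"] that by blast
      obtain q1 q2 q3 where q: "q1 \<in> R" "q2 \<in> R" "q3 \<in> R"
        "\<forall>c\<in>I - {x}. q1 c \<in> B" "\<forall>c\<in>I - {y}. q2 c \<in> B" "\<forall>c\<in>I - {z}. q3 c \<in> B"
        using ex[OF xyz(1)] ex[OF xyz(2)] ex[OF xyz(3)] by blast
      have "power_act act t (vec3 q1 q2 q3) \<in> R"
        by (rule closedD[OF R(1) t(1)]) (use q in \<open>auto simp: vec3_def\<close>)
      moreover have "power_act act t (vec3 q1 q2 q3) c \<in> B" if c: "c \<in> I" for c
      proof -
        have eq: "power_act act t (vec3 q1 q2 q3) c = act t (vec3 (q1 c) (q2 c) (q3 c))"
          unfolding power_act_def by (subst act_vec3[OF X(1) t]) simp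
        have qX: "q1 c \<in> X" "q2 c \<in> X" "q3 c \<in> X" using q R(4) by auto
        \<comment> \<open>At most one of the three sequences can leave \<open>B\<close> at \<open>c\<close>.\<close>
        consider "c \<noteq> x" "c \<noteq> y" | "c \<noteq> x" "c \<noteq> z" | "c \<noteq> y" "c \<noteq> z" using xyz by metis
        then show ?thesis
          unfolding eq using BX(5) q(4-6) c qX unfolding ternary_absorbs_def by cases auto
      qed
      ultimately show ?thesis by blast
    next
      case False
      then have "\<exists>i j. I \<subseteq> {i, j}" by blast
      then show ?thesis using pair by blast
    qed
  qed
  obtain r where r: "r \<in> R" "\<forall>c\<in>{0..<int p}. r c \<in> B" using all[of "{0..<int p}"] by auto
  have "r i \<in> B" for i
    using r(2) cyclic_rel_mod[OF R(2) r(1), of i] p_pos by (metis atLeastLessThan_iff of_nat_0_less_iff pos_mod_bound pos_mod_sign)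
  then show ?thesis using BX r(1) by (intro exI[of _ B]) auto
qed

end

text \<open>A quotient is realized on representatives: \<open>rep\<close> picks one element of each congruence class, and every operation is followed by
  \<open>rep\<close>. In this way the induction stays within one type.\<close>

theorem cyclic_rel_constant:
  assumes p: "prime p"
  shows "algebra X act \<Longrightarrow> finite X \<Longrightarrow> card X < p \<Longrightarrow> closed (power_act act) R \<Longrightarrow> cyclic_rel p R \<Longrightarrow>
    R \<noteq> {} \<Longrightarrow> (\<And>r i. r \<in> R \<Longrightarrow> r i \<in> X) \<Longrightarrow> \<exists>r\<in>R. \<forall>i. r i = r 0"
proof (induction "card X" arbitrary: X act R rule: less_induct)
  case less
  note X = less.prems(1,2,3) and R = less.prems(4,5,6,7)
  have p0: "p > 0" using p prime_gt_0_nat by blast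
  \<comment> \<open>The induction hypothesis applies as soon as one sequence lies in a proper subuniverse.\<close>
  have sub: ?case if B: "B \<subset> X" "closed act B" and r0: "r0 \<in> R" "\<And>i. r0 i \<in> B" for B r0
  proof -
    let ?R = "{r \<in> R. \<forall>i. r i \<in> B}"
    have cB: "card B < card X" using B(1) X(2) by (rule psubset_card_mono[rotated])
    have clR: "closed (power_act act) ?R"
    proof (rule closedI)
      fix f and x :: "nat \<Rightarrow> int \<Rightarrow> 'a" assume f: "f \<in> Sym" and x: "\<And>k. k < ar f \<Longrightarrow> x k \<in> ?R"
      have "power_act act f x \<in> R" by (rule closedD[OF R(1) f]) (use x in auto)
      moreover have "power_act act f x i \<in> B" for i
        unfolding power_act_def by (rule closedD[OF B(2) f]) (use x in auto)
      ultimately show "power_act act f x \<in> ?R" by simp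
    qed
    have cyc: "cyclic_rel p ?R" using R(2) by (auto simp: cyclic_rel_def)
    have "\<exists>r\<in>?R. \<forall>i. r i = r 0"
    proof (rule less.hyps[OF cB _ _ _ clR cyc])
      show "algebra B act" by (rule subalgebra[OF X(1) _ B(2)]) (use B(1) in auto)
      show "finite B" using B(1) X(2) finite_subset by auto
      show "card B < p" using cB X(3) by simp
      show "?R \<noteq> {}" using r0 by blast
    qed auto
    then show ?thesis by blast
  qed
  show ?case
  proof (cases "(\<lambda>r. r 0) ` R = X")
    case False
    obtain r0 where r0: "r0 \<in> R" using R(3) by blast
    have eq: "(\<lambda>r. r 0) ` R = (\<lambda>r. r 0) ` {r \<in> R. r 0 \<in> X}" using R(4) by auto
    show ?thesis
    proof (rule sub[OF _ _ r0])
      show "(\<lambda>r. r 0) ` R \<subset> X" using False R(4) by auto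
      show "closed act ((\<lambda>r. r 0) ` R)"
        unfolding eq by (rule closed_image[OF X(1) R(1) algebra_closed[OF X(1)]])
      show "r0 i \<in> (\<lambda>r. r 0) ` R" for i
        using cyclic_rel_shift[OF R(2) p0 r0, of i] by (intro image_eqI[of _ _ "\<lambda>k. r0 (k + i)"]) auto
    qed
  next
    case sd: True
    show ?thesis
    proof (cases "simple X act")
      case simple: True
      show ?thesis
      proof (rule ccontr)
        assume no: "\<not> ?thesis"
        have sd': "\<exists>r\<in>R. r 0 = a" if "a \<in> X" for a
        proof -
          have "a \<in> (\<lambda>r. r 0) ` R" using that sd by simp
          then show ?thesis by blast
        qed
        have no': "\<exists>i. r i \<noteq> r 0" if "r \<in> R" for r using no that by blast
        have "\<not> ternary_free X act"
        proof
          assume free: "ternary_free X act"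
          show False
          proof (rule ternary_free_contradiction[OF X(1,2) simple p X(3) R(1,2,3) _ _ _ free])
            show "r i \<in> X" if "r \<in> R" for r i using R(4)[OF that] .
            show "\<exists>r\<in>R. r 0 = a" if "a \<in> X" for a using sd'[OF that] .
            show "\<exists>i. r i \<noteq> r 0" if "r \<in> R" for r using no'[OF that] .
          qed
        qed
        then obtain C t where C: "C \<subseteq> X" "C \<noteq> {}" "C \<noteq> X" "closed act C" "ternary_absorbs act t C X"
          unfolding ternary_free_def by blast
        have "\<exists>B. B \<subset> X \<and> closed act B \<and> (\<exists>r\<in>R. \<forall>i. r i \<in> B)"
        proof (rule sequence_in_absorbing_subuniverse[OF X(1,2) simple p X(3) R(1,2,3) _ _ _ C])
          show "r i \<in> X" if "r \<in> R" for r i using R(4)[OF that] .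
          show "\<exists>r\<in>R. r 0 = a" if "a \<in> X" for a using sd'[OF that] .
          show "\<exists>i. r i \<noteq> r 0" if "r \<in> R" for r using no'[OF that] .
        qed
        then obtain B r where B: "B \<subset> X" "closed act B" and r: "r \<in> R" "\<And>i. r i \<in> B" by blast
        show False using sub[OF B r] no by blast
      qed
    next
      case False
      then obtain T where T: "T \<subseteq> X \<times> X" "closed (pair_act act act) T" "\<And>x. x \<in> X \<Longrightarrow> (x, x) \<in> T" "sym T"
        "\<not> T \<subseteq> Id" "T\<^sup>+ \<noteq> X \<times> X" unfolding simple_def by blast
      define L where "L = T\<^sup>+"
      have LX: "L \<subseteq> X \<times> X" unfolding L_def using trancl_subset_Sigma[OF T(1)] .
      have Lcl: "closed (pair_act act act) L" unfolding L_def by (rule closed_trancl[OF T(1) X(2) T(2,3)])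
      have Lrefl: "(x, x) \<in> L" if "x \<in> X" for x using T(3)[OF that] by (auto simp: L_def)
      have Lsym: "(y, x) \<in> L" if "(x, y) \<in> L" for x y
        using that sym_trancl[OF T(4)] by (auto simp: L_def dest: symD)
      have Ltrans: "(x, z) \<in> L" if "(x, y) \<in> L" "(y, z) \<in> L" for x y z
        using that unfolding L_def by (rule trancl_trans)
      define rep where "rep x = (SOME y. (x, y) \<in> L)" for x
      have rep: "(x, rep x) \<in> L" if "x \<in> X" for x unfolding rep_def using Lrefl[OF that] by (rule someI)
      have rep_eq: "rep x = rep y" if "(x, y) \<in> L" for x y
      proof -
        have "(x, z) \<in> L \<longleftrightarrow> (y, z) \<in> L" for z using that Lsym Ltrans by blast
        then show ?thesis by (simp add: rep_def)
      qed
      have repX: "rep x \<in> X" if "x \<in> X" for x using rep[OF that] LX by blast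
      have rep_rep: "rep (rep x) = rep x" if "x \<in> X" for x using rep_eq[OF rep[OF that]] by simp
      define act' where "act' f x = rep (act f x)" for f x
      have act_rep: "rep (act f (\<lambda>k. rep (x k))) = rep (act f x)"
        if f: "f \<in> Sym" and x: "\<And>k. k < ar f \<Longrightarrow> x k \<in> X" for f x
        using rep_eq[OF closed_pairD[OF Lcl f, of x "\<lambda>k. rep (x k)"]] rep x by simp
      define Y where "Y = rep ` X"
      have YX: "Y \<subseteq> X" using repX by (auto simp: Y_def)
      have repY: "rep y = y" if "y \<in> Y" for y using that rep_rep by (auto simp: Y_def)
      have Yalg: "algebra Y act'"
        unfolding algebra_def
      proof (intro conjI ballI allI impI)
        show "closed act' Y"
        proof (rule closedI)
          fix f x assume "f \<in> Sym" "\<And>k. k < ar f \<Longrightarrow> x k \<in> Y"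
          then have "act f x \<in> X" using closedD[OF algebra_closed[OF X(1)]] YX by blast
          then show "act' f x \<in> Y" by (simp add: act'_def Y_def)
        qed
      next
        fix f and x y :: "nat \<Rightarrow> 'a" assume "f \<in> Sym" "\<forall>k<ar f. x k = y k"
        then show "act' f x = act' f y" unfolding act'_def using act_cong[OF X(1)] by metis
      next
        fix f m gs and x :: "nat \<Rightarrow> 'a"
        assume f: "f \<in> Sym" and gs: "\<forall>k<ar f. gs k \<in> Sym \<and> ar (gs k) = m" and x: "\<forall>k<m. x k \<in> Y"
        have xX: "\<And>k. k < m \<Longrightarrow> x k \<in> X" using x YX by blast
        have "act (cmp m f gs) x = act f (\<lambda>k. act (gs k) x)"
          by (rule act_cmp[OF X(1) f _ xX]) (use gs in auto)
        moreover have "act (gs k) x \<in> X" if "k < ar f" for k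
          using closedD[OF algebra_closed[OF X(1)]] gs xX that by blast
        ultimately show "act' (cmp m f gs) x = act' f (\<lambda>k. act' (gs k) x)"
          unfolding act'_def using act_rep[OF f, of "\<lambda>k. act (gs k) x"] by simp
      next
        fix n i and x :: "nat \<Rightarrow> 'a" assume i: "i < n" and x: "\<forall>k<n. x k \<in> Y"
        then have "act (prj n i) x = x i" using YX by (intro act_prj[OF X(1)]) auto
        then show "act' (prj n i) x = x i" using repY x i by (simp add: act'_def)
      next
        fix f a assume "f \<in> Sym" "a \<in> Y"
        then show "act' f (\<lambda>_. a) = a" using act_idem[OF X(1)] YX repY by (auto simp: act'_def)
      qed
      have cY: "card Y < card X"
      proof -
        obtain a b where ab: "(a, b) \<in> T" "a \<noteq> b" using T(5) by auto
        have abX: "a \<in> X" "b \<in> X" using ab T(1) by auto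
        have "rep a = rep b" using rep_eq ab by (auto simp: L_def)
        then have "\<not> inj_on rep X" using ab abX by (auto simp: inj_on_def)
        then have "card Y \<noteq> card X" unfolding Y_def using eq_card_imp_inj_on[OF X(2)] by blast
        moreover have "card Y \<le> card X" unfolding Y_def by (rule card_image_le[OF X(2)])
        ultimately show ?thesis by simp
      qed
      let ?R = "(\<lambda>r i. rep (r i)) ` R"
      have "\<exists>q\<in>?R. \<forall>i. q i = q 0"
      proof (rule less.hyps[OF cY Yalg])
        show "finite Y" unfolding Y_def using X(2) by simp
        show "card Y < p" using cY X(3) by simp
        show "closed (power_act act') ?R"
        proof (rule closedI)
          fix f and q :: "nat \<Rightarrow> int \<Rightarrow> 'a" assume f: "f \<in> Sym" and q: "\<And>k. k < ar f \<Longrightarrow> q k \<in> ?R"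
          then have "\<forall>k. \<exists>r. k < ar f \<longrightarrow> r \<in> R \<and> q k = (\<lambda>i. rep (r i))" by blast
          then obtain r where r: "\<And>k. k < ar f \<Longrightarrow> r k \<in> R \<and> q k = (\<lambda>i. rep (r k i))" by metis
          have "power_act act' f q i = rep (power_act act f r i)" for i
          proof -
            have "act f (\<lambda>k. q k i) = act f (\<lambda>k. rep (r k i))" by (rule act_cong[OF X(1) f]) (use r in auto)
            then show ?thesis using act_rep[OF f, of "\<lambda>k. r k i"] r R(4) by (simp add: power_act_def act'_def)
          qed
          moreover have "power_act act f r \<in> R" by (rule closedD[OF R(1) f]) (use r in auto)
          ultimately show "power_act act' f q \<in> ?R" by (intro image_eqI[of _ _ "power_act act f r"]) auto
        qed
        show "cyclic_rel p ?R" using R(2) unfolding cyclic_rel_def by (auto intro!: image_eqI)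
        show "?R \<noteq> {}" using R(3) by simp
        show "q i \<in> Y" if "q \<in> ?R" for q i using that R(4) by (auto simp: Y_def)
      qed
      then obtain r where r: "r \<in> R" "\<And>i. rep (r i) = rep (r 0)" by auto
      let ?B = "{x \<in> X. rep x = rep (r 0)}"
      show ?thesis
      proof (rule sub[OF _ _ r(1)])
        show "closed act ?B"
        proof (rule closedI)
          fix f x assume f: "f \<in> Sym" and x: "\<And>k. k < ar f \<Longrightarrow> x k \<in> ?B"
          have "act f x \<in> X" by (rule closedD[OF algebra_closed[OF X(1)] f]) (use x in auto)
          moreover have "rep (act f x) = rep (act f (\<lambda>k. rep (x k)))" by (rule act_rep[OF f, symmetric]) (use x in auto)
          moreover have "act f (\<lambda>k. rep (x k)) = rep (r 0)"
            by (rule act_const[OF X(1) f]) (use x repX R(4)[OF r(1)] in auto)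
          ultimately show "act f x \<in> ?B" using rep_rep R(4)[OF r(1)] by simp
        qed
        show "r i \<in> ?B" for i using r R(4) by auto
        show "?B \<subset> X"
        proof (rule psubsetI)
          show "?B \<noteq> X"
          proof
            assume eq: "?B = X"
            have "(x, y) \<in> L" if "x \<in> X" "y \<in> X" for x y
            proof -
              have "x \<in> ?B" "y \<in> ?B" using that unfolding eq by auto
              then have "rep x = rep y" by simp
              then show ?thesis using rep[OF that(1)] rep[OF that(2)] Lsym Ltrans by metis
            qed
            then have "L = X \<times> X" using LX by blast
            then show False using T(6) by (simp add: L_def)
          qed
        qed auto
      qed
    qed
  qed
qed

end

section \<open>Cyclic operations in idempotent clones\<close>

lemma compose_op_in:
  assumes C: "function_clone C" and f: "f \<in> ops C n" and gs: "\<And>k. k < n \<Longrightarrow> gs k \<in> ops C m"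
  shows "compose_op (base C) m f (map gs [0..<n]) \<in> ops C m"
proof -
  have n: "n \<ge> 1" using f C by (cases n) (auto simp: function_clone_def)
  then have "gs 0 \<in> ops C m" using gs by simp
  then have m: "m \<ge> 1" using C by (cases m) (auto simp: function_clone_def)
  have "map gs [0..<n] \<in> tuples (ops C m) n" using gs by (auto simp: tuples_def)
  then show ?thesis using C n m f unfolding function_clone_def by blast
qed

lemma ops_value:
  assumes C: "function_clone C" and f: "f \<in> ops C n" and x: "\<And>k. k < n \<Longrightarrow> x k \<in> base C"
  shows "f (map x [0..<n]) \<in> base C"
proof -
  have "f \<in> operations (base C) n" using C f unfolding function_clone_def by blast
  moreover have "map x [0..<n] \<in> tuples (base C) n" using x by (auto simp: tuples_def)
  ultimately show ?thesis by (auto simp: operations_def)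
qed

lemma compose_op_map:
  assumes "\<And>k. k < m \<Longrightarrow> x k \<in> D"
  shows "compose_op D m f (map gs [0..<n]) (map x [0..<m]) = f (map (\<lambda>k. gs k (map x [0..<m])) [0..<n])"
proof -
  have "map x [0..<m] \<in> tuples D m" using assms by (auto simp: tuples_def)
  then show ?thesis by (simp add: compose_op_def comp_def)
qed

lemma proj_map:
  assumes "i < n" "\<And>k. k < n \<Longrightarrow> x k \<in> D"
  shows "proj D n i (map x [0..<n]) = x i"
proof -
  have "map x [0..<n] \<in> tuples D n" using assms by (auto simp: tuples_def)
  then show ?thesis using assms(1) by (simp add: proj_def)
qed

locale idempotent_taylor =
  fixes C :: "'a op_set"
  assumes clone: "function_clone C" and fin: "finite (base C)"
    and idem: "\<And>n f a. f \<in> ops C n \<Longrightarrow> a \<in> base C \<Longrightarrow> f (replicate n a) = a"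
    and no_hom: "\<nexists>\<xi>. clone_hom C one_clone \<xi>"
begin

text \<open>The symbols are the operations tagged with their arity, since a function on lists need not determine its arity.\<close>

definition "Symbols = {(n, f). f \<in> ops C n}"
definition "substitute m f gs = (m, compose_op (base C) m (snd f) (map (\<lambda>k. snd (gs k)) [0..<fst f]))"
definition "projection n i = (n, proj (base C) n i)"
definition "evaluate f x = snd f (map x [0..<fst f])"

lemma Symbols_iff: "f \<in> Symbols \<longleftrightarrow> snd f \<in> ops C (fst f)"
  by (cases f) (simp add: Symbols_def)

lemma substitute_in:
  assumes "f \<in> Symbols" "\<And>k. k < fst f \<Longrightarrow> gs k \<in> Symbols \<and> fst (gs k) = m"
  shows "substitute m f gs \<in> Symbols \<and> fst (substitute m f gs) = m"
  using assms compose_op_in[OF clone, of "snd f" "fst f" "\<lambda>k. snd (gs k)" m]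
  by (auto simp: Symbols_iff substitute_def)

sublocale taylor_clone Symbols fst substitute projection
proof
  show "projection n i \<in> Symbols \<and> fst (projection n i) = n" if "i < n" for i n
    using clone that by (auto simp: projection_def Symbols_def function_clone_def)
  show "0 < fst f" if "f \<in> Symbols" for f
    using clone that by (cases f; cases "fst f") (auto simp: Symbols_def function_clone_def)
  show "\<nexists>\<xi>. (\<forall>f\<in>Symbols. \<xi> f < fst f) \<and> (\<forall>n i. i < n \<longrightarrow> \<xi> (projection n i) = i) \<and>
    (\<forall>f\<in>Symbols. \<forall>m gs. (\<forall>k<fst f. gs k \<in> Symbols \<and> fst (gs k) = m) \<longrightarrow>
       \<xi> (substitute m f gs) = \<xi> (gs (\<xi> f)))"
  proof (rule notI, elim exE conjE)
    fix \<xi> :: "nat \<times> ('a list \<Rightarrow> 'a) \<Rightarrow> nat"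
    assume lt: "\<forall>f\<in>Symbols. \<xi> f < fst f" and pr: "\<forall>n i. i < n \<longrightarrow> \<xi> (projection n i) = i"
      and sb: "\<forall>f\<in>Symbols. \<forall>m gs. (\<forall>k<fst f. gs k \<in> Symbols \<and> fst (gs k) = m) \<longrightarrow>
         \<xi> (substitute m f gs) = \<xi> (gs (\<xi> f))"
    define \<eta> where "\<eta> n f = proj (UNIV :: bool set) n (\<xi> (n, f))" for n f
    have lt': "\<xi> (n, f) < n" if "f \<in> ops C n" for n f using lt that by (auto simp: Symbols_def)
    have "clone_hom C one_clone \<eta>"
      unfolding clone_hom_def
    proof (intro conjI allI impI ballI)
      show "arity_preserving C one_clone \<eta>"
        using lt' by (auto simp: arity_preserving_def one_clone_def projection_clone_def \<eta>_def)
      show "\<eta> n (proj (base C) n k) = proj (base one_clone) n k" if "k < n" for n k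
        using pr that by (auto simp: \<eta>_def projection_def one_clone_def projection_clone_def)
      fix n m f gs assume f: "f \<in> ops C n" and gs: "gs \<in> tuples (ops C m) n"
      have len: "length gs = n" and gsC: "\<And>k. k < n \<Longrightarrow> gs ! k \<in> ops C m" using gs by (auto simp: tuples_def)
      have "map (\<lambda>k. gs ! k) [0..<n] = gs" using len map_nth by blast
      then have "\<xi> (m, compose_op (base C) m f gs) = \<xi> (substitute m (n, f) (\<lambda>k. (m, gs ! k)))"
        by (simp add: substitute_def)
      also have "\<dots> = \<xi> (m, gs ! \<xi> (n, f))"
        using sb f gsC by (simp add: Symbols_def)
      finally have 1: "\<eta> m (compose_op (base C) m f gs) = \<eta> m (gs ! \<xi> (n, f))"
        by (simp add: \<eta>_def)
      have "compose_op (UNIV :: bool set) m (\<eta> n f) (map (\<eta> m) gs) = \<eta> m (gs ! \<xi> (n, f))"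
      proof
        fix xs :: "bool list"
        show "compose_op UNIV m (\<eta> n f) (map (\<eta> m) gs) xs = \<eta> m (gs ! \<xi> (n, f)) xs"
          using lt'[OF f] len by (auto simp: compose_op_def \<eta>_def proj_def tuples_def)
      qed
      then show "\<eta> m (compose_op (base C) m f gs) = compose_op (base one_clone) m (\<eta> n f) (map (\<eta> m) gs)"
        using 1 by (simp add: one_clone_def projection_clone_def)
    qed
    then show False using no_hom by blast
  qed
qed (rule substitute_in)

lemma base_algebra: "algebra (base C) evaluate"
  unfolding algebra_def
proof (intro conjI ballI allI impI)
  show "closed evaluate (base C)"
  proof (rule closedI)
    fix f :: "nat \<times> ('a list \<Rightarrow> 'a)" and x
    assume "f \<in> Symbols" "\<And>k. k < fst f \<Longrightarrow> x k \<in> base C"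
    then show "evaluate f x \<in> base C"
      unfolding evaluate_def by (intro ops_value[OF clone, of "snd f" "fst f"]) (auto simp: Symbols_iff)
  qed
next
  fix f :: "nat \<times> ('a list \<Rightarrow> 'a)" and x y :: "nat \<Rightarrow> 'a"
  assume "\<forall>k<fst f. x k = y k"
  then have "map x [0..<fst f] = map y [0..<fst f]" by auto
  then show "evaluate f x = evaluate f y" unfolding evaluate_def by (simp only:)
next
  fix f :: "nat \<times> ('a list \<Rightarrow> 'a)" and m and gs :: "nat \<Rightarrow> nat \<times> ('a list \<Rightarrow> 'a)" and x
  assume gs: "\<forall>k<fst f. gs k \<in> Symbols \<and> fst (gs k) = m" and x: "\<forall>k<m. x k \<in> base C"
  have "evaluate (substitute m f gs) x = snd f (map (\<lambda>k. snd (gs k) (map x [0..<m])) [0..<fst f])"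
    using x by (simp add: evaluate_def substitute_def compose_op_map)
  also have "map (\<lambda>k. snd (gs k) (map x [0..<m])) [0..<fst f] = map (\<lambda>k. evaluate (gs k) x) [0..<fst f]"
    using gs by (auto simp: evaluate_def)
  finally show "evaluate (substitute m f gs) x = evaluate f (\<lambda>k. evaluate (gs k) x)"
    by (simp add: evaluate_def)
next
  fix n i :: nat and x assume "i < n" "\<forall>k<n. x k \<in> base C"
  then show "evaluate (projection n i) x = x i"
    by (simp add: evaluate_def projection_def proj_map)
next
  fix f :: "nat \<times> ('a list \<Rightarrow> 'a)" and a assume "f \<in> Symbols" "a \<in> base C"
  then show "evaluate f (\<lambda>_. a) = a"
    using idem[of "snd f" "fst f" a] by (auto simp: evaluate_def Symbols_def map_replicate_const)
qed

context
  fixes p :: nat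
  assumes p: "prime p" "card (base C) < p"
begin

text \<open>For a periodic sequence \<open>c\<close>, \<open>window c i\<close> is the \<open>p\<close>-tuple of \<open>c\<close> rotated by \<open>i\<close>.\<close>

definition "window c i = map (\<lambda>j. c (i + int j)) [0..<p]" for c :: "int \<Rightarrow> 'a"

definition "periodic = {c. (\<forall>i. c i \<in> base C) \<and> (\<forall>i. c (i + int p) = c i)}"

lemma p_positive: "p > 0" using p(1) prime_gt_0_nat by blast

lemma window_value: "f \<in> ops C p \<Longrightarrow> c \<in> periodic \<Longrightarrow> f (window c i) \<in> base C"
  unfolding window_def by (rule ops_value[OF clone]) (auto simp: periodic_def)

lemma window_shift: "c \<in> periodic \<Longrightarrow> window c (i + int p) = window c i"
proof -
  assume "c \<in> periodic"
  then have "c (i + int j + int p) = c (i + int j)" for j by (simp add: periodic_def)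
  then show ?thesis unfolding window_def by (simp add: algebra_simps)
qed

lemma finite_periodic: "finite periodic"
proof (rule finite_cyclic_rel[OF _ p_positive fin])
  have shift: "(\<lambda>i. c (i + 1)) \<in> periodic" if "c \<in> periodic" for c
  proof -
    have "c (i + 1 + int p) = c (i + 1)" for i using that unfolding periodic_def by blast
    then show ?thesis using that by (simp add: periodic_def algebra_simps)
  qed
  then show "cyclic_rel p periodic" unfolding cyclic_rel_def by (auto simp: periodic_def)
qed (auto simp: periodic_def)

definition "rotated j f = compose_op (base C) p f (map (\<lambda>k. proj (base C) p ((j + k) mod p)) [0..<p])"

lemma rotated_in: "f \<in> ops C p \<Longrightarrow> rotated j f \<in> ops C p"
  unfolding rotated_def
  by (rule compose_op_in[OF clone]) (use clone p_positive in \<open>auto simp: function_clone_def\<close>)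

lemma rotated_window:
  assumes c: "c \<in> periodic"
  shows "rotated j f (window c i) = f (window c (i + int j))"
proof -
  have cb: "c (i + int k) \<in> base C" for k using c by (simp add: periodic_def)
  have "rotated j f (window c i) = f (map (\<lambda>k. proj (base C) p ((j + k) mod p) (window c i)) [0..<p])"
    unfolding rotated_def window_def by (rule compose_op_map) (rule cb)
  also have "map (\<lambda>k. proj (base C) p ((j + k) mod p) (window c i)) [0..<p] = window c (i + int j)"
    unfolding window_def
  proof (rule map_cong)
    fix k assume "k \<in> set [0..<p]"
    have "proj (base C) p ((j + k) mod p) (map (\<lambda>j. c (i + int j)) [0..<p]) = c (i + int ((j + k) mod p))"
      by (rule proj_map) (use p_positive cb in auto)
    also have "\<dots> = c (i + int ((j + k) mod p) + int ((j + k) div p) * int p)"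
      using c by (intro periodic_mult[symmetric]) (auto simp: periodic_def)
    also have "i + int ((j + k) mod p) + int ((j + k) div p) * int p = i + int j + int k"
    proof -
      have "(j + k) mod p + (j + k) div p * p = j + k" by (rule mod_div_mult_eq)
      then have "int ((j + k) mod p) + int ((j + k) div p) * int p = int (j + k)"
        by (metis of_nat_add of_nat_mult)
      then show ?thesis by simp
    qed
    finally show "proj (base C) p ((j + k) mod p) (map (\<lambda>j. c (i + int j)) [0..<p]) = c (i + int j + int k)" .
  qed simp
  finally show ?thesis .
qed

text \<open>The values that the \<open>p\<close>-ary operations take on the rotations of a tuple form the cyclic relation generated by this tuple.\<close>

lemma constant_on_rotations:
  assumes c: "c \<in> periodic"
  shows "\<exists>f\<in>ops C p. \<forall>i. f (window c i) = f (window c 0)"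
proof -
  define R where "R = {(\<lambda>i. f (window c i)) |f. f \<in> ops C p}"
  have "\<exists>r\<in>R. \<forall>i. r i = r 0"
  proof (rule cyclic_rel_constant[OF p(1) base_algebra fin p(2)])
    show "closed (power_act evaluate) R"
    proof (rule closedI)
      fix f and r :: "nat \<Rightarrow> int \<Rightarrow> 'a" assume f: "f \<in> Symbols" and r: "\<And>k. k < fst f \<Longrightarrow> r k \<in> R"
      have "\<forall>k. \<exists>g. k < fst f \<longrightarrow> g \<in> ops C p \<and> r k = (\<lambda>i. g (window c i))" using r unfolding R_def by blast
      then obtain g where g: "\<And>k. k < fst f \<Longrightarrow> g k \<in> ops C p \<and> r k = (\<lambda>i. g k (window c i))" by metis
      let ?h = "compose_op (base C) p (snd f) (map g [0..<fst f])"
      have "?h \<in> ops C p"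
        by (rule compose_op_in[OF clone]) (use f g in \<open>auto simp: Symbols_def\<close>)
      moreover have "power_act evaluate f r i = ?h (window c i)" for i
      proof -
        have "map (\<lambda>k. r k i) [0..<fst f] = map (\<lambda>k. g k (window c i)) [0..<fst f]" using g by auto
        moreover have "?h (window c i) = snd f (map (\<lambda>k. g k (window c i)) [0..<fst f])"
          unfolding window_def by (rule compose_op_map) (use c in \<open>auto simp: periodic_def\<close>)
        ultimately show ?thesis unfolding power_act_def evaluate_def by (simp only:)
      qed
      ultimately show "power_act evaluate f r \<in> R" unfolding R_def by blast
    qed
    show "cyclic_rel p R"
      unfolding cyclic_rel_def
    proof (intro ballI conjI allI)
      fix r i assume "r \<in> R"
      then obtain f where f: "f \<in> ops C p" "r = (\<lambda>i. f (window c i))" by (auto simp: R_def)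
      show "r (i + int p) = r i" unfolding f(2) window_shift[OF c] ..
      have "(\<lambda>i. r (i + 1)) = (\<lambda>i. rotated 1 f (window c i))"
        unfolding f(2) by (simp add: rotated_window[OF c])
      then show "(\<lambda>i. r (i + 1)) \<in> R" unfolding R_def using rotated_in[OF f(1)] by blast
    qed
    have "proj (base C) p 0 \<in> ops C p" using clone p_positive by (auto simp: function_clone_def)
    then show "R \<noteq> {}" by (auto simp: R_def)
    show "r i \<in> base C" if "r \<in> R" for r i using that window_value c by (auto simp: R_def)
  qed
  then show ?thesis by (auto simp: R_def)
qed

text \<open>One operation that serves all tuples is built tuple by tuple. If \<open>f\<close> is invariant on the tuples in \<open>F\<close>, compose an operation \<open>g\<close>,
  chosen for the tuple of values of \<open>f\<close> on the rotations of \<open>c\<close>, with all rotations of \<open>f\<close>. On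
  tuples in \<open>F\<close> the arguments of \<open>g\<close> are equal, so idempotence preserves what was achieved.\<close>

lemma constant_on_all_rotations:
  assumes "finite F" "F \<subseteq> periodic"
  shows "\<exists>f\<in>ops C p. \<forall>c\<in>F. \<forall>i. f (window c i) = f (window c 0)"
  using assms
proof (induction F)
  case empty
  have "proj (base C) p 0 \<in> ops C p" using clone p_positive by (auto simp: function_clone_def)
  then show ?case by auto
next
  case (insert c F)
  then obtain f where f: "f \<in> ops C p" "\<And>c i. c \<in> F \<Longrightarrow> f (window c i) = f (window c 0)" by auto
  define c' where "c' = (\<lambda>i. f (window c i))"
  have c: "c \<in> periodic" using insert.prems by simp
  have "c' \<in> periodic"
    unfolding periodic_def c'_def using window_value[OF f(1) c] window_shift[OF c] by simp
  then obtain g where g: "g \<in> ops C p" "\<And>i. g (window c' i) = g (window c' 0)"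
    using constant_on_rotations by blast
  define h where "h = compose_op (base C) p g (map (\<lambda>j. rotated j f) [0..<p])"
  have h: "h \<in> ops C p" unfolding h_def by (rule compose_op_in[OF clone g(1) rotated_in[OF f(1)]])
  have hw: "h (window d i) = g (window (\<lambda>i. f (window d i)) i)" if d: "d \<in> periodic" for d i
  proof -
    have "h (window d i) = g (map (\<lambda>j. rotated j f (window d i)) [0..<p])"
      unfolding h_def window_def by (rule compose_op_map) (use d in \<open>auto simp: periodic_def\<close>)
    then show ?thesis unfolding rotated_window[OF d] by (simp add: window_def)
  qed
  have "h (window d i) = h (window d 0)" if d: "d \<in> insert c F" for d i
  proof (cases "d = c")
    case True
    then show ?thesis using g(2)[of i] c by (simp add: hw c'_def)
  next
    case False
    then have dF: "d \<in> F" using d by simp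
    then have "d \<in> periodic" using insert.prems by blast
    then have "f (window d 0) \<in> base C" by (rule window_value[OF f(1)])
    then have "g (window (\<lambda>i. f (window d i)) i) = f (window d 0)" for i
      using idem[OF g(1)] f(2)[OF dF] by (simp add: window_def map_replicate_const)
    then show ?thesis by (simp add: hw \<open>d \<in> periodic\<close>)
  qed
  then show ?case using h by blast
qed

lemma has_cyclic_of_prime: "has_cyclic C"
proof -
  obtain t where t: "t \<in> ops C p" "\<And>c i. c \<in> periodic \<Longrightarrow> t (window c i) = t (window c 0)"
    using constant_on_all_rotations[OF finite_periodic subset_refl] by blast
  have "t xs = t (rotate1 xs)" if xs: "xs \<in> tuples (base C) p" for xs
  proof -
    have len: "length xs = p" and set: "set xs \<subseteq> base C" using xs by (auto simp: tuples_def)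
    define c where "c i = xs ! nat (i mod int p)" for i
    have "c i \<in> base C" for i
    proof -
      have "0 \<le> i mod int p" "i mod int p < int p" using p_positive by auto
      then have "nat (i mod int p) < length xs" using len by linarith
      then show ?thesis unfolding c_def using set nth_mem by blast
    qed
    then have c: "c \<in> periodic" by (simp add: periodic_def c_def)
    have "window c 0 = xs"
      by (rule nth_equalityI) (use len in \<open>auto simp: window_def c_def\<close>)
    moreover have "window c 1 = rotate1 xs"
    proof (rule nth_equalityI)
      fix k assume "k < length (window c 1)"
      then have k: "k < p" by (simp add: window_def)
      have "nat ((1 + int k) mod int p) = Suc k mod p"
        by (simp flip: of_nat_Suc of_nat_mod)
      then show "window c 1 ! k = rotate1 xs ! k" using k len by (simp add: window_def c_def nth_rotate1)
    qed (use len in \<open>simp add: window_def\<close>)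
    ultimately show ?thesis using t(2)[OF c, of 1] by simp
  qed
  then show ?thesis using t(1) prime_ge_2_nat[OF p(1)] unfolding has_cyclic_def cyclic_op_def by blast
qed

end

theorem has_cyclic: "has_cyclic C"
proof -
  obtain p where "prime p" "card (base C) < p" using bigger_prime by blast
  then show ?thesis by (rule has_cyclic_of_prime)
qed

end

section \<open>Siggers operations and minor-preserving maps\<close>

text \<open>The four variables of a Siggers operation are the edges \<open>a \<rightarrow> r\<close>, \<open>r \<rightarrow> a\<close>, \<open>e \<rightarrow> r\<close>, \<open>a \<rightarrow> e\<close> of a digraph: the two sides of the
  identity list their sources and their targets. Substituting the edges of a closed walk of length \<open>n\<close> into an
  \<open>n\<close>-ary cyclic operation turns the identity into a rotation. Closed walks of all lengths \<open>n \<ge> 2\<close> are composed of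
  \<open>a \<rightarrow> r \<rightarrow> a\<close> and \<open>a \<rightarrow> e \<rightarrow> r \<rightarrow> a\<close>.\<close>

lemma cyclic_imp_siggers:
  assumes C: "function_clone C" and "has_cyclic C"
  shows "has_siggers C"
proof -
  obtain n t where t: "t \<in> ops C n" and n: "n \<ge> 2" and cyc: "\<And>xs. xs \<in> tuples (base C) n \<Longrightarrow> t xs = t (rotate1 xs)"
    using assms(2) unfolding has_cyclic_def cyclic_op_def by blast
  \<comment> \<open>The walk \<open>a r a r \<dots>\<close> for even \<open>n\<close>, and \<open>a e r\<close> followed by \<open>a r a r \<dots>\<close> for odd \<open>n\<close>;
    the value is the number of the edge taken in step \<open>k\<close>.\<close>
  define w :: "nat \<Rightarrow> nat" where "w k =
    (if even n then (if even k then 0 else 1)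
     else if k = 0 then 3 else if k = 1 then 2 else if even k then 1 else 0)" for k
  have w4: "w k < 4" for k by (simp add: w_def)
  define s where "s = compose_op (base C) 4 t (map (\<lambda>k. proj (base C) 4 (w k)) [0..<n])"
  have s: "s \<in> ops C 4"
    unfolding s_def by (rule compose_op_in[OF C t]) (use C w4 in \<open>auto simp: function_clone_def\<close>)
  have val: "s (map x [0..<4]) = t (map (\<lambda>k. x (w k)) [0..<n])" if x: "\<And>k. k < 4 \<Longrightarrow> x k \<in> base C" for x
    unfolding s_def using compose_op_map[of 4 x "base C" t "\<lambda>k. proj (base C) 4 (w k)" n, OF x]
    by (simp add: proj_map[OF w4 x])
  have "s [a, r, e, a] = s [r, a, r, e]" if "a \<in> base C" "r \<in> base C" "e \<in> base C" for a r e
  proof -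
    let ?x = "\<lambda>k. [a, r, e, a] ! k" and ?y = "\<lambda>k. [r, a, r, e] ! k"
    have l: "map ?x [0..<4] = [a, r, e, a]" "map ?y [0..<4] = [r, a, r, e]"
      by (simp_all add: numeral_eq_Suc upt_rec)
    have m: "?x k \<in> base C" "?y k \<in> base C" if "k < 4" for k
      using that \<open>a \<in> base C\<close> \<open>r \<in> base C\<close> \<open>e \<in> base C\<close> by (auto simp: numeral_eq_Suc less_Suc_eq)
    have step: "?y (w k) = ?x (w (Suc k mod n))" if k: "k < n" for k
    proof (cases "Suc k = n")
      case True
      then show ?thesis using n by (auto simp: w_def simp flip: True)
    next
      case False
      then have "Suc k mod n = Suc k" using k by simp
      then show ?thesis by (auto simp: w_def)
    qed
    have "map (\<lambda>k. ?y (w k)) [0..<n] = rotate1 (map (\<lambda>k. ?x (w k)) [0..<n])"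
      by (rule nth_equalityI) (use step in \<open>auto simp: nth_rotate1\<close>)
    moreover have "map (\<lambda>k. ?x (w k)) [0..<n] \<in> tuples (base C) n"
      using m(1)[OF w4] by (auto simp: tuples_def)
    ultimately have "t (map (\<lambda>k. ?x (w k)) [0..<n]) = t (map (\<lambda>k. ?y (w k)) [0..<n])" using cyc by metis
    then show ?thesis using val[of ?x, OF m(1)] val[of ?y, OF m(2)] unfolding l by simp
  qed
  then show ?thesis using s by (auto simp: has_siggers_def siggers_op_def)
qed

text \<open>Both sides of the Siggers identity are minors of \<open>t\<close>, so the identity would be inherited by a projection; but the two sides name
  different variables at each position.\<close>

lemma siggers_imp_no_h1_hom:
  assumes "has_siggers C"
  shows "\<nexists>\<xi>. h1_clone_hom C one_clone \<xi>"
proof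
  assume "\<exists>\<xi>. h1_clone_hom C one_clone \<xi>"
  then obtain \<xi> where \<xi>: "h1_clone_hom C one_clone \<xi>" by blast
  obtain t where t: "t \<in> ops C 4" and sig: "siggers_op (base C) t" using assms by (auto simp: has_siggers_def)
  have "arity_preserving C one_clone \<xi>" using \<xi> by (simp only: h1_clone_hom_def)
  then have "\<xi> 4 \<in> ops C 4 \<rightarrow> ops one_clone 4" by (simp add: arity_preserving_def)
  with t have "\<xi> 4 t \<in> ops one_clone 4" by blast
  then obtain i where i: "i < 4" "\<xi> 4 t = proj UNIV 4 i" by (auto simp: one_clone_def projection_clone_def)
  let ?l = "[0, 1, 2, 0::nat]" and ?r = "[1, 0, 1, 2::nat]"
  have h1: "\<xi> 3 (compose_op (base C) 3 t (map (proj (base C) 3) is)) = compose_op UNIV 3 (proj UNIV 4 i) (map (proj UNIV 3) is)"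
    if "is \<in> tuples {..<3} 4" for "is"
  proof -
    have "\<forall>n\<ge>1. \<forall>m\<ge>1. \<forall>f\<in>ops C n. \<forall>is\<in>tuples {..<m} n.
        \<xi> m (compose_op (base C) m f (map (proj (base C) m) is)) =
          compose_op (base one_clone) m (\<xi> n f) (map (proj (base one_clone) m) is)"
      by (rule conjunct2[OF \<xi>[unfolded h1_clone_hom_def]])
    from this[rule_format, of 4 3 t "is"] show ?thesis
      using t that i(2) by (simp add: one_clone_def projection_clone_def)
  qed
  have lr: "?l \<in> tuples {..<3} 4" "?r \<in> tuples {..<3} 4" by (auto simp: tuples_def)
  have "compose_op (base C) 3 t (map (proj (base C) 3) ?l) = compose_op (base C) 3 t (map (proj (base C) 3) ?r)"
  proof
    fix xs
    show "compose_op (base C) 3 t (map (proj (base C) 3) ?l) xs = compose_op (base C) 3 t (map (proj (base C) 3) ?r) xs"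
    proof (cases "xs \<in> tuples (base C) 3")
      case True
      then have "xs ! 0 \<in> base C" "xs ! 1 \<in> base C" "xs ! 2 \<in> base C" by (auto simp: tuples_def subset_iff)
      then have "t [xs ! 0, xs ! 1, xs ! 2, xs ! 0] = t [xs ! 1, xs ! 0, xs ! 1, xs ! 2]"
        using sig unfolding siggers_op_def by blast
      then show ?thesis using True by (simp add: compose_op_def proj_def)
    qed (simp add: compose_op_def)
  qed
  then have eq: "compose_op UNIV 3 (proj (UNIV :: bool set) 4 i) (map (proj UNIV 3) ?l) = compose_op UNIV 3 (proj UNIV 4 i) (map (proj UNIV 3) ?r)"
    using h1[OF lr(1)] h1[OF lr(2)] by simp
  have val: "compose_op UNIV 3 (proj (UNIV :: bool set) 4 i) (map (proj UNIV 3) is) xs = xs ! (is ! i)"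
    if "length xs = 3" "length is = 4" for xs "is"
    using that i(1) by (simp add: compose_op_def proj_def tuples_def)
  have e: "xs ! (?l ! i) = xs ! (?r ! i)" if "length xs = 3" for xs :: "bool list"
    using fun_cong[OF eq, of xs] val[OF that, of ?l] val[OF that, of ?r] by simp
  from i(1) have "i = 0 \<or> i = 1 \<or> i = 2 \<or> i = 3" by auto
  then show False using e[of "[True, False, False]"] e[of "[False, True, False]"] by auto
qed

lemma clone_hom_imp_h1_clone_hom:
  assumes C: "function_clone C" and \<xi>: "clone_hom C D \<xi>"
  shows "h1_clone_hom C D \<xi>"
  unfolding h1_clone_hom_def
proof (intro conjI allI impI ballI)
  show "arity_preserving C D \<xi>" using \<xi> by (simp add: clone_hom_def)
  fix n m :: nat and f "is" assume nm: "n \<ge> 1" "m \<ge> 1" and f: "f \<in> ops C n" and is': "is \<in> tuples {..<m} n"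
  have "map (proj (base C) m) is \<in> tuples (ops C m) n"
    using is' C by (auto simp: tuples_def function_clone_def)
  then have "\<xi> m (compose_op (base C) m f (map (proj (base C) m) is)) =
      compose_op (base D) m (\<xi> n f) (map (\<xi> m) (map (proj (base C) m) is))"
    using \<xi> nm f unfolding clone_hom_def by blast
  also have "map (\<xi> m) (map (proj (base C) m) is) = map (proj (base D) m) is"
    using \<xi> is' unfolding clone_hom_def by (auto simp: tuples_def)
  finally show "\<xi> m (compose_op (base C) m f (map (proj (base C) m) is)) =
      compose_op (base D) m (\<xi> n f) (map (proj (base D) m) is)" .
qed

section \<open>A structure and its core\<close>

lemma PolI:
  assumes "\<And>xs. xs \<in> tuples (domain S) n \<Longrightarrow> f xs \<in> domain S" "n \<ge> 1"
    and "\<And>s rs. s \<in> symbols S \<Longrightarrow> rs \<in> tuples (rel S s) n \<Longrightarrow> map (\<lambda>j. f (map (\<lambda>r. r ! j) rs)) [0..<arity S s] \<in> rel S s"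
    and S: "rel_structure S"
  shows "restrict f (tuples (domain S) n) \<in> ops (Pol S) n"
proof -
  have "preserves n (restrict f (tuples (domain S) n)) (arity S s) (rel S s)" if s: "s \<in> symbols S" for s
    unfolding preserves_def
  proof
    fix rs assume rs: "rs \<in> tuples (rel S s) n"
    have "map (\<lambda>r. r ! j) rs \<in> tuples (domain S) n" if "j < arity S s" for j
    proof -
      have "r ! j \<in> domain S" if "r \<in> set rs" for r
      proof -
        have "r \<in> tuples (domain S) (arity S s)"
          using that rs S s unfolding rel_structure_def tuples_def by blast
        then show ?thesis using \<open>j < arity S s\<close> by (auto simp: tuples_def)
      qed
      then show ?thesis using rs by (auto simp: tuples_def)
    qed
    then have eq: "map (\<lambda>j. restrict f (tuples (domain S) n) (map (\<lambda>r. r ! j) rs)) [0..<arity S s]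
        = map (\<lambda>j. f (map (\<lambda>r. r ! j) rs)) [0..<arity S s]" by simp
    then show "map (\<lambda>j. restrict f (tuples (domain S) n) (map (\<lambda>r. r ! j) rs)) [0..<arity S s] \<in> rel S s"
      using assms(3)[OF s rs] by (simp only: eq)
  qed
  then show ?thesis using assms(1,2) by (auto simp: Pol_def operations_def)
qed

lemma Pol_preserves:
  "f \<in> ops (Pol S) n \<Longrightarrow> s \<in> symbols S \<Longrightarrow> rs \<in> tuples (rel S s) n \<Longrightarrow>
    map (\<lambda>j. f (map (\<lambda>r. r ! j) rs)) [0..<arity S s] \<in> rel S s"
  by (auto simp: Pol_def preserves_def)

lemma Pol_value: "f \<in> ops (Pol S) n \<Longrightarrow> xs \<in> tuples (domain S) n \<Longrightarrow> f xs \<in> domain S"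
  by (auto simp: Pol_def operations_def)

lemma Pol_transfer:
  assumes t: "t \<in> ops (Pol S) n" and g: "homomorphism S T g" and h: "homomorphism T S h"
    and ST: "same_signature S T" and S: "rel_structure S" and T: "rel_structure T"
  shows "(\<lambda>xs\<in>tuples (domain T) n. g (t (map h xs))) \<in> ops (Pol T) n"
proof (rule PolI[OF _ _ _ T])
  show "n \<ge> 1" using t by (simp add: Pol_def)
  show "g (t (map h xs)) \<in> domain T" if "xs \<in> tuples (domain T) n" for xs
  proof -
    have "map h xs \<in> tuples (domain S) n" using that h by (auto simp: homomorphism_def tuples_def)
    then show ?thesis using Pol_value[OF t] g by (auto simp: homomorphism_def)
  qed
  fix s rs assume s: "s \<in> symbols T" and rs: "rs \<in> tuples (rel T s) n"
  have s': "s \<in> symbols S" "arity S s = arity T s" using ST s by (auto simp: same_signature_def)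
  have "map (map h) rs \<in> tuples (rel S s) n" using rs h s by (auto simp: homomorphism_def tuples_def)
  from Pol_preserves[OF t s'(1) this] have "map (\<lambda>j. t (map (\<lambda>r. r ! j) (map (map h) rs))) [0..<arity T s] \<in> rel S s"
    by (simp add: s'(2))
  then have "map g (map (\<lambda>j. t (map (\<lambda>r. r ! j) (map (map h) rs))) [0..<arity T s]) \<in> rel T s"
    using g s'(1) unfolding homomorphism_def by blast
  moreover have "map g (map (\<lambda>j. t (map (\<lambda>r. r ! j) (map (map h) rs))) [0..<arity T s]) =
      map (\<lambda>j. g (t (map h (map (\<lambda>r. r ! j) rs)))) [0..<arity T s]"
  proof -
    have "length r = arity T s" if "r \<in> set rs" for r
      using that rs T s unfolding rel_structure_def tuples_def by blast
    then have eq: "map (\<lambda>r. r ! j) (map (map h) rs) = map h (map (\<lambda>r. r ! j) rs)" if "j < arity T s" for j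
      using that by simp
    show ?thesis
      unfolding map_map[of g]
    proof (rule map_cong)
      fix j assume "j \<in> set [0..<arity T s]"
      then have "j < arity T s" by simp
      then show "(g \<circ> (\<lambda>j. t (map (\<lambda>r. r ! j) (map (map h) rs)))) j = g (t (map h (map (\<lambda>r. r ! j) rs)))"
        by (simp only: o_apply eq)
    qed simp
  qed
  ultimately show "map (\<lambda>j. g (t (map h (map (\<lambda>r. r ! j) rs)))) [0..<arity T s] \<in> rel T s" by (simp only:)
qed

text \<open>Hence, on a core, the diagonal is an automorphism and can be inverted.\<close>

lemma Pol_diagonal:
  assumes u: "u \<in> ops (Pol S) n" and S: "rel_structure S"
  shows "homomorphism S S (\<lambda>c\<in>domain S. u (replicate n c))"
  unfolding homomorphism_def
proof (intro conjI ballI)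
  show "(\<lambda>c\<in>domain S. u (replicate n c)) \<in> domain S \<rightarrow> domain S"
    by (auto intro!: Pol_value[OF u] simp: tuples_def)
  fix s xs assume s: "s \<in> symbols S" and xs: "xs \<in> rel S s"
  have xt: "length xs = arity S s" "set xs \<subseteq> domain S"
    using xs S s unfolding rel_structure_def tuples_def by auto
  have "replicate n xs \<in> tuples (rel S s) n" using xs by (auto simp: tuples_def)
  from Pol_preserves[OF u s this] have "map (\<lambda>j. u (replicate n (xs ! j))) [0..<arity S s] \<in> rel S s" by simp
  moreover have "map (\<lambda>j. u (replicate n (xs ! j))) [0..<arity S s] = map (\<lambda>c\<in>domain S. u (replicate n c)) xs"
    by (rule nth_equalityI) (use xt in \<open>auto simp: subset_iff\<close>)
  ultimately show "map (\<lambda>c\<in>domain S. u (replicate n c)) xs \<in> rel S s" by simp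
qed

lemma rel_structure_expand: "rel_structure S \<Longrightarrow> rel_structure (expand_by_singletons S)"
  by (fastforce simp: rel_structure_def expand_by_singletons_def tuples_def)

lemma domain_expand [simp]: "domain (expand_by_singletons S) = domain S"
  by (simp add: expand_by_singletons_def)

lemma base_Pol [simp]: "base (Pol S) = domain S"
  by (simp add: Pol_def)

text \<open>Preserving the singletons means being idempotent.\<close>

lemma Pol_expand:
  "f \<in> ops (Pol (expand_by_singletons S)) n \<longleftrightarrow> f \<in> ops (Pol S) n \<and> (\<forall>a\<in>domain S. f (replicate n a) = a)"
proof -
  have "preserves n f 1 {[a]} \<longleftrightarrow> f (replicate n a) = a" for a
  proof -
    have "tuples {[a]} n = {replicate n [a]}"
      by (auto simp: tuples_def) (metis insert_iff replicate_eqI subset_singletonD empty_iff subsetD)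
    then show ?thesis by (simp add: preserves_def)
  qed
  then show ?thesis by (auto simp: Pol_def expand_by_singletons_def ball_Un)
qed

context
  fixes A :: "('s, 'a) rstruct" and K :: "('s, 'b) rstruct" and g h
  assumes A: "rel_structure A" and K: "is_core K"
    and g: "homomorphism A K g" and h: "homomorphism K A h" and AK: "same_signature A K"
begin

definition "diagonal n t = (\<lambda>c\<in>domain K. g (t (replicate n (h c))))"

definition "idempotent_version n t =
  (\<lambda>xs\<in>tuples (domain K) n. inv_into (domain K) (diagonal n t) (g (t (map h xs))))"

lemma K_rel: "rel_structure K" using K by (simp add: is_core_def finite_structure_def)

lemma idempotent_version_in:
  assumes t: "t \<in> ops (Pol A) n"
  shows "idempotent_version n t \<in> ops (Pol (expand_by_singletons K)) n"
proof -
  let ?u = "\<lambda>xs\<in>tuples (domain K) n. g (t (map h xs))"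
  let ?D = "domain K"
  have u: "?u \<in> ops (Pol K) n" by (rule Pol_transfer[OF t g h AK A K_rel])
  have diag: "diagonal n t = (\<lambda>c\<in>?D. ?u (replicate n c))"
    by (rule ext) (auto simp: diagonal_def tuples_def)
  then have "homomorphism K K (diagonal n t)" using Pol_diagonal[OF u K_rel] by simp
  then have auto: "automorphism K (diagonal n t)" using K by (simp add: is_core_def)
  let ?i = "inv_into ?D (diagonal n t)"
  have inv: "homomorphism K K ?i" and bij: "bij_betw (diagonal n t) ?D ?D"
    using auto by (auto simp: automorphism_def)
  have un: "g (t (map h xs)) \<in> ?D" if "xs \<in> tuples ?D n" for xs
    using Pol_value[OF u that] that by simp
  have 1: "idempotent_version n t \<in> ops (Pol K) n"
    unfolding idempotent_version_def
  proof (rule PolI[OF _ _ _ K_rel])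
    show "n \<ge> 1" using t by (simp add: Pol_def)
    show "?i (g (t (map h xs))) \<in> ?D" if "xs \<in> tuples ?D n" for xs
      using un[OF that] inv by (auto simp: homomorphism_def)
    fix s rs assume s: "s \<in> symbols K" and rs: "rs \<in> tuples (rel K s) n"
    have tup: "map (\<lambda>r. r ! j) rs \<in> tuples ?D n" if j: "j < arity K s" for j
    proof -
      have "r ! j \<in> ?D" if "r \<in> set rs" for r
      proof -
        have "r \<in> tuples ?D (arity K s)"
          using that rs K_rel s unfolding rel_structure_def tuples_def by blast
        then show ?thesis using j by (auto simp: tuples_def)
      qed
      then show ?thesis using rs by (auto simp: tuples_def)
    qed
    have "\<forall>xs\<in>rel K s. map ?i xs \<in> rel K s" using inv s unfolding homomorphism_def by blast
    then have "map ?i (map (\<lambda>j. ?u (map (\<lambda>r. r ! j) rs)) [0..<arity K s]) \<in> rel K s"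
      by (rule bspec) (rule Pol_preserves[OF u s rs])
    also have "map ?i (map (\<lambda>j. ?u (map (\<lambda>r. r ! j) rs)) [0..<arity K s]) =
        map (\<lambda>j. ?i (g (t (map h (map (\<lambda>r. r ! j) rs))))) [0..<arity K s]"
      using tup by simp
    finally show "map (\<lambda>j. ?i (g (t (map h (map (\<lambda>r. r ! j) rs))))) [0..<arity K s] \<in> rel K s" .
  qed
  have "idempotent_version n t (replicate n a) = a" if a: "a \<in> ?D" for a
  proof -
    have "replicate n a \<in> tuples ?D n" using a by (auto simp: tuples_def)
    then have "idempotent_version n t (replicate n a) = ?i (diagonal n t a)"
      using a by (simp add: idempotent_version_def diagonal_def)
    then show ?thesis using bij_betw_inv_into_left[OF bij a] by simp
  qed
  with 1 show ?thesis by (simp add: Pol_expand)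
qed

text \<open>A minor has the same diagonal as the operation itself, so the correction by its inverse commutes with taking minors. It does
  not commute with general composition.\<close>

lemma idempotent_version_minor:
  assumes t: "t \<in> ops (Pol A) n" and is': "is \<in> tuples {..<m} n"
  shows "idempotent_version m (compose_op (domain A) m t (map (proj (domain A) m) is)) =
    compose_op (domain K) m (idempotent_version n t) (map (proj (domain K) m) is)"
proof -
  let ?t = "compose_op (domain A) m t (map (proj (domain A) m) is)"
  have len: "length is = n" and lt: "\<And>i. i \<in> set is \<Longrightarrow> i < m" using is' by (auto simp: tuples_def)
  have hD: "h c \<in> domain A" if "c \<in> domain K" for c using h that by (auto simp: homomorphism_def)
  have val: "?t (map h xs) = t (map h (map (\<lambda>i. xs ! i) is))" if xs: "xs \<in> tuples (domain K) m" for xs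
  proof -
    have "map h xs \<in> tuples (domain A) m" using xs hD by (auto simp: tuples_def)
    moreover have "length xs = m" using xs by (simp add: tuples_def)
    ultimately have "?t (map h xs) = t (map (\<lambda>i. map h xs ! i) is)"
      by (simp add: compose_op_def proj_def comp_def)
    also have "map (\<lambda>i. map h xs ! i) is = map h (map (\<lambda>i. xs ! i) is)"
      using lt \<open>length xs = m\<close> by simp
    finally show ?thesis .
  qed
  have diag: "diagonal m ?t = diagonal n t"
  proof
    fix c
    show "diagonal m ?t c = diagonal n t c"
    proof (cases "c \<in> domain K")
      case True
      have "replicate m c \<in> tuples (domain K) m" using True by (auto simp: tuples_def)
      from val[OF this] have "?t (replicate m (h c)) = t (map h (map (\<lambda>i. replicate m c ! i) is))" by simp
      also have "map (\<lambda>i. replicate m c ! i) is = replicate n c"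
        using lt len by (intro replicate_eqI) auto
      finally show ?thesis using True by (simp add: diagonal_def)
    qed (simp add: diagonal_def)
  qed
  show ?thesis
  proof
    fix xs
    show "idempotent_version m ?t xs =
        compose_op (domain K) m (idempotent_version n t) (map (proj (domain K) m) is) xs"
    proof (cases "xs \<in> tuples (domain K) m")
      case True
      have ys: "map (\<lambda>i. xs ! i) is \<in> tuples (domain K) n"
      proof -
        have "xs ! i \<in> domain K" if "i \<in> set is" for i
        proof -
          have "i < length xs" "set xs \<subseteq> domain K" using True lt[OF that] by (auto simp: tuples_def)
          then show ?thesis using nth_mem by blast
        qed
        then show ?thesis using len by (auto simp: tuples_def)
      qed
      have "compose_op (domain K) m (idempotent_version n t) (map (proj (domain K) m) is) xs =
          idempotent_version n t (map (\<lambda>i. xs ! i) is)"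
        using True by (simp add: compose_op_def proj_def comp_def)
      also have "\<dots> = inv_into (domain K) (diagonal n t) (g (t (map h (map (\<lambda>i. xs ! i) is))))"
        using ys by (simp add: idempotent_version_def)
      also have "\<dots> = idempotent_version m ?t xs"
        using True by (simp add: idempotent_version_def diag val del: map_map)
      finally show ?thesis by simp
    qed (simp add: idempotent_version_def compose_op_def)
  qed
qed

lemma h1_clone_hom_from_core:
  assumes \<xi>: "h1_clone_hom (Pol (expand_by_singletons K)) D \<xi>"
  shows "\<exists>\<eta>. h1_clone_hom (Pol A) D \<eta>"
proof
  let ?\<eta> = "\<lambda>n t. \<xi> n (idempotent_version n t)"
  show "h1_clone_hom (Pol A) D ?\<eta>"
    unfolding h1_clone_hom_def arity_preserving_def
  proof (intro conjI allI impI ballI)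
    show "?\<eta> n \<in> ops (Pol A) n \<rightarrow> ops D n" if "n \<ge> 1" for n
      using \<xi> that idempotent_version_in by (auto simp: h1_clone_hom_def arity_preserving_def)
    fix n m :: nat and t "is" assume nm: "1 \<le> n" "1 \<le> m" and t: "t \<in> ops (Pol A) n" and is': "is \<in> tuples {..<m} n"
    have "\<xi> m (compose_op (base (Pol (expand_by_singletons K))) m (idempotent_version n t)
          (map (proj (base (Pol (expand_by_singletons K))) m) is)) =
        compose_op (base D) m (?\<eta> n t) (map (proj (base D) m) is)"
      using \<xi> nm idempotent_version_in[OF t] is' unfolding h1_clone_hom_def by blast
    then show "?\<eta> m (compose_op (base (Pol A)) m t (map (proj (base (Pol A)) m) is)) =
        compose_op (base D) m (?\<eta> n t) (map (proj (base D) m) is)"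
      using idempotent_version_minor[OF t is'] by simp
  qed
qed

lemma has_cyclic_from_core:
  assumes "has_cyclic (Pol (expand_by_singletons K))"
  shows "has_cyclic (Pol A)"
proof -
  obtain n t where t': "t \<in> ops (Pol (expand_by_singletons K)) n" "n \<ge> 2"
      "\<And>xs. xs \<in> tuples (domain K) n \<Longrightarrow> t xs = t (rotate1 xs)"
    using assms unfolding has_cyclic_def cyclic_op_def base_Pol domain_expand by blast
  have t: "t \<in> ops (Pol K) n" using t'(1) unfolding Pol_expand by blast
  have KA: "same_signature K A" using AK by (auto simp: same_signature_def)
  let ?u = "\<lambda>xs\<in>tuples (domain A) n. h (t (map g xs))"
  have u: "?u \<in> ops (Pol A) n" by (rule Pol_transfer[OF t h g KA K_rel A])
  have "?u xs = ?u (rotate1 xs)" if xs: "xs \<in> tuples (domain A) n" for xs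
  proof -
    have "rotate1 xs \<in> tuples (domain A) n" using xs by (simp add: tuples_def)
    moreover have "map g xs \<in> tuples (domain K) n" using xs g by (auto simp: tuples_def homomorphism_def)
    moreover have "map g (rotate1 xs) = rotate1 (map g xs)" by (simp add: rotate1_map)
    ultimately show ?thesis using xs arg_cong[OF t'(3)[of "map g xs"], of h] by (simp only: restrict_apply if_True)
  qed
  then have "cyclic_op (domain A) n ?u" using t'(2) unfolding cyclic_op_def by blast
  then show ?thesis using u unfolding has_cyclic_def base_Pol by blast
qed

end

theorem theorem1p4:
  fixes A :: "('s, 'a) rstruct" and B :: "('s + 'b, 'b) rstruct"
  assumes "finite_structure A"
    and "idempotent_core_of B A"
  shows "((\<nexists>\<xi>. clone_hom (Pol B) one_clone \<xi>) \<longleftrightarrow> (\<nexists>\<xi>. h1_clone_hom (Pol B) one_clone \<xi>)) \<and>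
    ((\<nexists>\<xi>. h1_clone_hom (Pol B) one_clone \<xi>) \<longleftrightarrow> (\<nexists>\<xi>. h1_clone_hom (Pol A) one_clone \<xi>)) \<and>
    ((\<nexists>\<xi>. h1_clone_hom (Pol A) one_clone \<xi>) \<longleftrightarrow> has_cyclic (Pol B)) \<and>
    (has_cyclic (Pol B) \<longleftrightarrow> has_cyclic (Pol A)) \<and>
    (has_cyclic (Pol A) \<longleftrightarrow> has_siggers (Pol B)) \<and>
    (has_siggers (Pol B) \<longleftrightarrow> has_siggers (Pol A))"
proof -
  obtain K where K: "is_core K" "hom_equivalent K A" and B: "B = expand_by_singletons K"
    using assms(2) by (auto simp: idempotent_core_of_def core_of_def)
  obtain g h where gh: "homomorphism A K g" "homomorphism K A h" and KA: "same_signature K A"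
    using K(2) by (auto simp: hom_equivalent_def)
  have AK: "same_signature A K" using KA by (auto simp: same_signature_def)
  have A: "rel_structure A" using assms(1) by (simp add: finite_structure_def)
  have Kf: "rel_structure K" "finite (domain K)" using K(1) by (auto simp: is_core_def finite_structure_def)
  have cA: "function_clone (Pol A)" by (rule function_clone_Pol[OF A])
  have cB: "function_clone (Pol B)" unfolding B by (rule function_clone_Pol[OF rel_structure_expand[OF Kf(1)]])
  have i_iii: "has_cyclic (Pol B)" if no: "\<nexists>\<xi>. clone_hom (Pol B) one_clone \<xi>"
  proof -
    interpret idempotent_taylor "Pol B"
      by unfold_locales (use cB Kf(2) no in \<open>auto simp: B Pol_expand\<close>)
    show ?thesis by (rule has_cyclic)
  qed
  have iii_iii': "has_cyclic (Pol B) \<Longrightarrow> has_cyclic (Pol A)"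
    unfolding B by (rule has_cyclic_from_core[OF A K(1) gh AK])
  have iii'_iv': "has_cyclic (Pol A) \<Longrightarrow> has_siggers (Pol A)" by (rule cyclic_imp_siggers[OF cA])
  have iv'_ii': "has_siggers (Pol A) \<Longrightarrow> \<nexists>\<xi>. h1_clone_hom (Pol A) one_clone \<xi>" by (rule siggers_imp_no_h1_hom)
  have ii'_ii: "\<nexists>\<xi>. h1_clone_hom (Pol B) one_clone \<xi>" if "\<nexists>\<xi>. h1_clone_hom (Pol A) one_clone \<xi>"
    using that h1_clone_hom_from_core[OF A K(1) gh AK] unfolding B by blast
  have ii_i: "\<nexists>\<xi>. clone_hom (Pol B) one_clone \<xi>" if "\<nexists>\<xi>. h1_clone_hom (Pol B) one_clone \<xi>"
    using that clone_hom_imp_h1_clone_hom[OF cB] by blast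
  have iii_iv: "has_cyclic (Pol B) \<Longrightarrow> has_siggers (Pol B)" by (rule cyclic_imp_siggers[OF cB])
  have iv_ii: "has_siggers (Pol B) \<Longrightarrow> \<nexists>\<xi>. h1_clone_hom (Pol B) one_clone \<xi>" by (rule siggers_imp_no_h1_hom)
  show ?thesis
    using i_iii iii_iii' iii'_iv' iv'_ii' ii'_ii ii_i iii_iv iv_ii by argo
qed

end
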